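(* Let $p$ be a weight (of class $C^2$ on $\{|z|>R_0\}$ for some $R_0\ge 0$) such that $p(z)=O(|z|^2\Delta p(z))$ as $|z|\to\infty$, and suppose there exist constants $C_1,C_2>0$ such that for all $z,w\in\mathbb{C}$, $|z-w|\le|z|$ implies $p(w)\le C_1p(z)+C_2$. Let $V=\{(z_j,m_j)\}_{j\in\mathbb{N}}$ be a multiplicity variety. Then $V$ is an interpolating variety for $A_p(\mathbb{C})$ if and only if there exist constants $A,B>0$ such that for all $j\in\mathbb{N}$ $$N(z_j,|z_j|)\le A\,p(z_j)+B.$$
   Context: A weight is a subharmonic function $p:\mathbb{C}\to[0,\infty)$ such that (a) $\ln(1+|z|^2)=O(p(z))$ as $|z|\to\infty$; (b) there exist constants $C_1,C_2>0$ such that $|z-w|\le 1$ implies $p(w)\le C_1p(z)+C_2$. $\Delta=4\partial\bar\partial$ is the Laplacian. $A_p(\mathbb{C})$ is the space of entire functions $f$ for which there exist $A,B>0$ with $|f(z)|\le Ae^{Bp(z)}$ for all $z\in\mathbb{C}$. A multiplicity variety $V=\{(z_j,m_j)\}_{j\in\mathbb{N}}$ consists of a sequence of (pairwise distinct) points $z_j\in\mathbb{C}$ with $|z_j|\to\infty$ and a sequence of positive integers $m_j$. $V$ is an interpolating variety for $A_p(\mathbb{C})$ if for every family $\{w_{j,l}\}_{j\in\mathbb{N},\,0\le l<m_j}$ of complex numbers for which there exist $A,B>0$ with $\sum_{l=0}^{m_j-1}|w_{j,l}|\le Ae^{Bp(z_j)}$ for all $j$, there is $f\in A_p(\mathbb{C})$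 with $f^{(l)}(z_j)/l!=w_{j,l}$ for all $j\in\mathbb{N}$ and $0\le l<m_j$. For $z\in\mathbb{C}$ and $r>0$, $n(z,r)=\sum_{|z-z_j|\le r}m_j$ (and $n(z,0)$ is $m_j$ if $z=z_j$ for some $j$, and $0$ otherwise), and $$N(z,r)=\int_0^r\frac{n(z,t)-n(z,0)}{t}\,dt+n(z,0)\ln r=\sum_{0<|z-z_j|\le r}m_j\ln\frac{r}{|z-z_j|}+n(z,0)\ln r.$$ If some $z_j=0$, the inequality for that $j$ is regarded as vacuously true ($\ln 0=-\infty$). *)

theory Defs
  imports "HOL-Complex_Analysis.Complex_Analysis" "HOL-Library.Landau_Symbols"
begin

text \<open>Subharmonicity of a real-valued function: upper semicontinuity and the sub-mean value
  inequality on all circles. Integrability on circles is part of the definition because the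
  Bochner integral of a non-integrable function is \<open>0\<close>; for a subharmonic function that is
  nowhere \<open>-\<infinity>\<close> it always holds.\<close>

definition subharmonic :: "(complex \<Rightarrow> real) \<Rightarrow> bool" where
  "subharmonic p \<longleftrightarrow>
     (\<forall>c. open {z. p z < c}) \<and>
     (\<forall>z. \<forall>r>0.
        set_integrable lborel {0..2 * pi} (\<lambda>\<theta>. p (z + of_real r * cis \<theta>)) \<and>
        p z \<le> (LBINT \<theta>:{0..2 * pi}. p (z + of_real r * cis \<theta>)) / (2 * pi))"

definition weight :: "(complex \<Rightarrow> real) \<Rightarrow> bool" where
  "weight p \<longleftrightarrow>
     (\<forall>z. 0 \<le> p z) \<and> subharmonic p \<and>
     (\<lambda>z. ln (1 + (cmod z)\<^sup>2)) \<in> O[at_infinity](p) \<and>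
     (\<exists>C1>0. \<exists>C2>0. \<forall>z w. cmod (z - w) \<le> 1 \<longrightarrow> p w \<le> C1 * p z + C2)"

text \<open>\<open>dir_deriv v f z\<close> is the real directional derivative, so the directions \<open>1\<close> and \<open>\<i>\<close> give
  the partial derivatives with respect to \<open>x\<close> and \<open>y\<close>.\<close>

definition dir_deriv :: "complex \<Rightarrow> (complex \<Rightarrow> real) \<Rightarrow> complex \<Rightarrow> real" where
  "dir_deriv v f z = deriv (\<lambda>t::real. f (z + of_real t * v)) 0"

definition C1_on :: "complex set \<Rightarrow> (complex \<Rightarrow> real) \<Rightarrow> bool" where
  "C1_on S f \<longleftrightarrow>
     continuous_on S f \<and>
     (\<forall>v\<in>{1, \<i>}.
        (\<forall>z\<in>S. (\<lambda>t::real. f (z + of_real t * v)) differentiable at 0) \<and>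
        continuous_on S (dir_deriv v f))"

definition C2_on :: "complex set \<Rightarrow> (complex \<Rightarrow> real) \<Rightarrow> bool" where
  "C2_on S f \<longleftrightarrow> C1_on S f \<and> (\<forall>v\<in>{1, \<i>}. C1_on S (dir_deriv v f))"

text \<open>This is normalised so that it equals \<open>4 \<partial> \<partial>-bar\<close>, where
  \<open>\<partial> = (\<partial>\<^sub>x - \<i> \<partial>\<^sub>y) / 2\<close> and \<open>\<partial>-bar = (\<partial>\<^sub>x + \<i> \<partial>\<^sub>y) / 2\<close>.\<close>

definition laplacian :: "(complex \<Rightarrow> real) \<Rightarrow> complex \<Rightarrow> real" where
  "laplacian f z = dir_deriv 1 (dir_deriv 1 f) z + dir_deriv \<i> (dir_deriv \<i> f) z"

definition A_space :: "(complex \<Rightarrow> real) \<Rightarrow> (complex \<Rightarrow> complex) set" where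
  "A_space p = {f. f holomorphic_on UNIV \<and>
     (\<exists>A>0. \<exists>B>0. \<forall>z. cmod (f z) \<le> A * exp (B * p z))}"

text \<open>The variety \<open>{(\<zeta>\<^sub>j, m\<^sub>j)}\<close> is represented by the two sequences \<open>\<zeta>\<close> and \<open>m\<close>.\<close>

definition multiplicity_variety :: "(nat \<Rightarrow> complex) \<Rightarrow> (nat \<Rightarrow> nat) \<Rightarrow> bool" where
  "multiplicity_variety \<zeta> m \<longleftrightarrow>
     inj \<zeta> \<and> filterlim (\<lambda>j. cmod (\<zeta> j)) at_top sequentially \<and> (\<forall>j. 0 < m j)"

definition interpolating_variety ::
  "(complex \<Rightarrow> real) \<Rightarrow> (nat \<Rightarrow> complex) \<Rightarrow> (nat \<Rightarrow> nat) \<Rightarrow> bool" where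
  "interpolating_variety p \<zeta> m \<longleftrightarrow>
     (\<forall>w :: nat \<Rightarrow> nat \<Rightarrow> complex.
        (\<exists>A>0. \<exists>B>0. \<forall>j. (\<Sum>l<m j. cmod (w j l)) \<le> A * exp (B * p (\<zeta> j))) \<longrightarrow>
        (\<exists>f\<in>A_space p. \<forall>j. \<forall>l<m j. (deriv ^^ l) f (\<zeta> j) / fact l = w j l))"

definition counting_n :: "(nat \<Rightarrow> complex) \<Rightarrow> (nat \<Rightarrow> nat) \<Rightarrow> complex \<Rightarrow> real \<Rightarrow> nat" where
  "counting_n \<zeta> m z r = (\<Sum>j | cmod (z - \<zeta> j) \<le> r. m j)"

definition counting_N :: "(nat \<Rightarrow> complex) \<Rightarrow> (nat \<Rightarrow> nat) \<Rightarrow> complex \<Rightarrow> real \<Rightarrow> real" where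
  "counting_N \<zeta> m z r =
     integral {0..r} (\<lambda>t. (real (counting_n \<zeta> m z t) - real (counting_n \<zeta> m z 0)) / t) +
     real (counting_n \<zeta> m z 0) * ln r"

lemma multiplicity_variety_finite:
  assumes "multiplicity_variety \<zeta> m"
  shows "finite {j. cmod (z - \<zeta> j) \<le> r}"
proof -
  have "eventually (\<lambda>j. cmod (\<zeta> j) \<ge> r + cmod z + 1) sequentially"
    using assms unfolding multiplicity_variety_def filterlim_at_top by blast
  then obtain M where M: "\<And>j. j \<ge> M \<Longrightarrow> cmod (\<zeta> j) \<ge> r + cmod z + 1"
    unfolding eventually_sequentially by blast
  have "j < M" if "cmod (z - \<zeta> j) \<le> r" for j
  proof (rule ccontr)
    assume "\<not> j < M"
    then have "cmod (\<zeta> j) \<ge> r + cmod z + 1"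
      using M by simp
    moreover have "cmod (\<zeta> j) \<le> cmod z + cmod (z - \<zeta> j)"
      by (metis norm_minus_commute norm_triangle_sub)
    ultimately show False
      using that by linarith
  qed
  then have "{j. cmod (z - \<zeta> j) \<le> r} \<subseteq> {..<M}"
    by auto
  then show ?thesis
    by (rule finite_subset) simp
qed

lemma counting_n_0:
  assumes "multiplicity_variety \<zeta> m"
  shows "counting_n \<zeta> m (\<zeta> j) 0 = m j"
    and "z \<notin> range \<zeta> \<Longrightarrow> counting_n \<zeta> m z 0 = 0"
proof -
  have "{i. cmod (\<zeta> j - \<zeta> i) \<le> 0} = {j}"
    using assms by (auto simp: multiplicity_variety_def inj_def)
  then show "counting_n \<zeta> m (\<zeta> j) 0 = m j"
    by (simp add: counting_n_def)
  show "counting_n \<zeta> m z 0 = 0" if "z \<notin> range \<zeta>"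
  proof -
    have "{i. cmod (z - \<zeta> i) \<le> 0} = {}"
      using that by auto
    then show ?thesis
      by (simp add: counting_n_def)
  qed
qed

lemma counting_N_eq_sum:
  assumes V: "multiplicity_variety \<zeta> m" and r: "0 < r"
  shows "counting_N \<zeta> m z r =
    (\<Sum>j | 0 < cmod (z - \<zeta> j) \<and> cmod (z - \<zeta> j) \<le> r. real (m j) * ln (r / cmod (z - \<zeta> j))) +
    real (counting_n \<zeta> m z 0) * ln r"
proof -
  define d where "d j = cmod (z - \<zeta> j)" for j
  define F where "F = {j. 0 < d j \<and> d j \<le> r}"
  have fin: "finite {j. d j \<le> t}" for t
    using multiplicity_variety_finite[OF V] by (simp add: d_def)
  have finF: "finite F"
    by (rule finite_subset[OF _ fin[of r]]) (auto simp: F_def)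
  have eq: "(real (counting_n \<zeta> m z t) - real (counting_n \<zeta> m z 0)) / t =
      (\<Sum>j\<in>F. real (m j) * (if t \<in> {d j..r} then 1 / t else 0))" if t: "t \<in> {0..r}" for t
  proof -
    have "{j. d j \<le> t} = {j. d j \<le> 0} \<union> {j\<in>F. d j \<le> t}"
      using t by (auto simp: F_def)
    then have "counting_n \<zeta> m z t = counting_n \<zeta> m z 0 + (\<Sum>j | j \<in> F \<and> d j \<le> t. m j)"
      unfolding counting_n_def d_def[symmetric]
      using sum.union_disjoint[of "{j. d j \<le> 0}" "{j\<in>F. d j \<le> t}" m] fin finF
      by (force simp: F_def)
    then have "(real (counting_n \<zeta> m z t) - real (counting_n \<zeta> m z 0)) / t =
        (\<Sum>j | j \<in> F \<and> d j \<le> t. real (m j) * (1 / t))"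
      by (simp add: sum_divide_distrib)
    also have "\<dots> = (\<Sum>j\<in>F. if d j \<le> t then real (m j) * (1 / t) else 0)"
      using finF by (rule sum.inter_filter)
    also have "\<dots> = (\<Sum>j\<in>F. real (m j) * (if t \<in> {d j..r} then 1 / t else 0))"
      using t by (intro sum.cong) auto
    finally show ?thesis .
  qed
  have "((\<lambda>t. if t \<in> {d j..r} then 1 / t else 0) has_integral ln (r / d j)) {0..r}"
    if "j \<in> F" for j
  proof -
    have j: "0 < d j" "d j \<le> r"
      using that by (auto simp: F_def)
    have "((\<lambda>t. 1 / t) has_integral (ln r - ln (d j))) {d j..r}"
      using j by (intro fundamental_theorem_of_calculus)
        (auto intro!: derivative_eq_intros simp flip: has_real_derivative_iff_has_vector_derivative)
    then have "((\<lambda>t. 1 / t) has_integral ln (r / d j)) {d j..r}"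
      using j r by (simp add: ln_div)
    then show ?thesis
      using j by (subst has_integral_restrict) auto
  qed
  then have "((\<lambda>t. \<Sum>j\<in>F. real (m j) * (if t \<in> {d j..r} then 1 / t else 0)) has_integral
      (\<Sum>j\<in>F. real (m j) * ln (r / d j))) {0..r}"
    by (intro has_integral_sum finF has_integral_mult_right)
  then have "((\<lambda>t. (real (counting_n \<zeta> m z t) - real (counting_n \<zeta> m z 0)) / t) has_integral
      (\<Sum>j\<in>F. real (m j) * ln (r / d j))) {0..r}"
    by (rule has_integral_eq[rotated]) (simp add: eq)
  then show ?thesis
    unfolding counting_N_def F_def d_def by (simp add: integral_unique)
qed

end

theory Submission
  imports Defs
begin

text \<open>Everything is reduced to a radial growth function, for which interpolating functions can be written
  down explicitly.

  \<^bold>\<open>The weight.\<close> Chaining the condition on \<open>\<bar>z - w\<bar> \<le> \<bar>z\<bar>\<close> shows that \<open>p\<close> is comparable to a radial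
  function that is doubling. The condition \<open>p = O(\<bar>z\<bar>\<^sup>2 \<Delta>p)\<close> makes \<open>p\<close> a subsolution of
  \<open>\<bar>z\<bar>\<^sup>2 \<Delta>h = \<delta>\<^sup>2 h\<close>, whose radial solutions are \<open>\<bar>z\<bar>\<close> to the power \<open>\<plusminus>\<delta>\<close>; comparison on annuli
  (\<open>subsolution_le_powers\<close>) shows that \<open>p\<close> grows by a definite power from each circle to any larger
  one. Hence \<open>p\<close> is comparable to \<open>Q (1 + \<bar>z\<bar>)\<close> where \<open>Q\<close> is doubling and \<open>Q r / r powr \<delta>\<close>
  is nondecreasing (\<open>weight_regular_growth\<close>), and every dyadic sum below is a geometric series.

  \<^bold>\<open>Necessity.\<close> If the bound on \<open>N\<close> fails, it fails badly along a subsequence \<open>\<zeta> (g i)\<close> whose moduli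
  grow geometrically. A single \<open>f \<in> A_p\<close> that takes the value \<open>1\<close> in the top coefficient at the points
  \<open>\<zeta> (g i)\<close> and \<open>0\<close> in all other prescribed coefficients contradicts Jensen's inequality around
  \<open>\<zeta> (g i)\<close>: the zeros missing at the other members of the subsequence cost at most \<open>1\<close> each, and at
  most \<open>i\<close> of them lie in the disc.

  \<^bold>\<open>Sufficiency.\<close> The bound on \<open>N (\<zeta> j, \<bar>\<zeta> j\<bar>)\<close> controls the multiplicity of the disc of radius
  \<open>\<bar>\<zeta> j\<bar> / 2\<close> around \<open>\<zeta> j\<close>, hence in dyadic annuli, hence in discs around the origin (\<open>spread_points_of_counting_N\<close>).
  For a finite set of points, the jet at \<open>\<zeta> j\<close> is produced by \<open>R\<^sub>j E\<^sub>j\<close>, where \<open>E\<^sub>j\<close> is the product of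
  \<^item> \<open>(z - \<zeta> k) / (1 + \<bar>\<zeta> j\<bar>)\<close> over the \<open>\<zeta> k\<close> of modulus up to about \<open>4 \<bar>\<zeta> j\<bar>\<close>; it is bounded below at
    \<open>\<zeta> j\<close> by the hypothesis on \<open>N\<close>;
  \<^item> \<open>1 - (z / \<zeta> k) ^ L\<close> over the more remote \<open>\<zeta> k\<close>; the \<open>L\<close>-th power makes the product grow no faster
    than \<open>exp (C Q)\<close>, which a product of the factors \<open>1 - z / \<zeta> k\<close> need not do;
  \<^item> the peak function \<open>(z / \<zeta> j) ^ N\<close> with \<open>N\<close> of size \<open>Q \<bar>\<zeta> j\<bar>\<close>, which makes \<open>E\<^sub>j\<close> exponentially
    small well inside \<open>\<bar>z\<bar> < \<bar>\<zeta> j\<bar>\<close> and, because \<open>Q r / r powr \<delta>\<close> is nondecreasing, stays below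
    \<open>exp (C Q \<bar>z\<bar>)\<close> everywhere else,

  and \<open>R\<^sub>j\<close> is a Taylor polynomial of the desired jet divided by \<open>E\<^sub>j\<close>. The sum over \<open>j\<close> satisfies
  bounds that do not depend on the finite set (\<open>finite_interpolation\<close>), and Montel's theorem passes to
  the whole sequence (\<open>interpolation_sequence\<close>).\<close>

section \<open>Zeros, jets and Jensen's inequality\<close>

definition vanishes_to_order :: "nat \<Rightarrow> (complex \<Rightarrow> complex) \<Rightarrow> complex \<Rightarrow> bool" where
  "vanishes_to_order \<mu> f a \<longleftrightarrow> (\<forall>l<\<mu>. (deriv ^^ l) f a = 0)"

lemma vanishes_to_order_mult:
  assumes "f holomorphic_on S" "u holomorphic_on S" "open S" "a \<in> S" "vanishes_to_order \<mu> f a"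
  shows "vanishes_to_order \<mu> (\<lambda>z. u z * f z) a"
  unfolding vanishes_to_order_def
proof (intro allI impI)
  fix l assume "l < \<mu>"
  then show "(deriv ^^ l) (\<lambda>z. u z * f z) a = 0"
    using assms by (subst higher_deriv_mult[of _ S]) (auto simp: vanishes_to_order_def intro!: sum.neutral)
qed

lemma vanishes_to_order_power: "vanishes_to_order \<mu> (\<lambda>z. (z - a) ^ \<mu>) a"
  by (auto simp: vanishes_to_order_def higher_deriv_power)

lemma vanishes_to_order_power_mult:
  assumes "h holomorphic_on UNIV"
  shows "vanishes_to_order \<mu> (\<lambda>z. (z - a) ^ \<mu> * h z) a"
proof -
  have "vanishes_to_order \<mu> (\<lambda>z. h z * (z - a) ^ \<mu>) a"
    using assms by (intro vanishes_to_order_mult[of _ UNIV] vanishes_to_order_power)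
      (auto intro!: holomorphic_intros)
  then show ?thesis by (simp add: mult.commute)
qed

lemma higher_deriv_power_mult_at:
  assumes "h holomorphic_on UNIV"
  shows "(deriv ^^ \<nu>) (\<lambda>z. (z - a) ^ \<nu> * h z) a = fact \<nu> * h a"
proof -
  have "(deriv ^^ \<nu>) (\<lambda>z. (z - a) ^ \<nu> * h z) a =
      (\<Sum>i = 0..\<nu>. of_nat (\<nu> choose i) * (deriv ^^ i) (\<lambda>z. (z - a) ^ \<nu>) a * (deriv ^^ (\<nu> - i)) h a)"
    using assms by (intro higher_deriv_mult[of _ UNIV]) (auto intro!: holomorphic_intros)
  also have "\<dots> = (\<Sum>i = 0..\<nu>. if i = \<nu> then fact \<nu> * h a else 0)"
    by (intro sum.cong) (auto simp: higher_deriv_power pochhammer_fact)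
  finally show ?thesis by simp
qed

lemma vanishes_to_order_factor:
  assumes "f holomorphic_on UNIV" "vanishes_to_order \<mu> f a"
  obtains h where "h holomorphic_on UNIV" "\<And>z. f z = (z - a) ^ \<mu> * h z"
  using assms(2)
proof (induction \<mu> arbitrary: thesis)
  case 0
  show ?case by (rule 0(1)[of f]) (use assms in auto)
next
  case (Suc \<mu>)
  obtain h where h: "h holomorphic_on UNIV" "\<And>z. f z = (z - a) ^ \<mu> * h z"
    using Suc.IH Suc.prems(2) by (auto simp: vanishes_to_order_def)
  have "f = (\<lambda>z. (z - a) ^ \<mu> * h z)" using h by auto
  then have "h a = 0"
    using Suc.prems(2) higher_deriv_power_mult_at[OF h(1), of \<mu> a] by (auto simp: vanishes_to_order_def)
  define g where "g z = (if z = a then deriv h a else (h z - h a) / (z - a))" for z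
  have "g holomorphic_on UNIV"
    unfolding g_def using pole_lemma_open[OF h(1) open_UNIV] .
  moreover have "f z = (z - a) ^ Suc \<mu> * g z" for z
    using h(2)[of z] \<open>h a = 0\<close> by (auto simp: g_def)
  ultimately show ?case using Suc.prems(1) by blast
qed

text \<open>The zeros are divided out one at a time: near a point outside \<open>\<zeta> ` K\<close> the quotient differs from \<open>f\<close>
  by a holomorphic factor, so it vanishes there to the same order as \<open>f\<close>.\<close>

lemma vanishes_to_order_factor_prod:
  assumes "finite K" "f holomorphic_on UNIV" "inj_on \<zeta> K"
    and "\<And>k. k \<in> K \<Longrightarrow> vanishes_to_order (\<mu> k) f (\<zeta> k)"
  shows "\<exists>h. h holomorphic_on UNIV \<and> (\<forall>z. f z = (\<Prod>k\<in>K. (z - \<zeta> k) ^ \<mu> k) * h z)"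
  using assms(1,3,4)
proof (induction K rule: finite_induct)
  case empty
  show ?case by (rule exI[of _ f]) (use assms in auto)
next
  case (insert k K)
  have "\<exists>h. h holomorphic_on UNIV \<and> (\<forall>z. f z = (\<Prod>k\<in>K. (z - \<zeta> k) ^ \<mu> k) * h z)"
  proof (rule insert.IH)
    show "inj_on \<zeta> K" using insert.prems(1) by (rule inj_on_subset) auto
    show "vanishes_to_order (\<mu> i) f (\<zeta> i)" if "i \<in> K" for i using insert.prems(2) that by blast
  qed
  then obtain h where h: "h holomorphic_on UNIV" "\<And>z. f z = (\<Prod>i\<in>K. (z - \<zeta> i) ^ \<mu> i) * h z"
    by blast
  define S where "S = UNIV - \<zeta> ` K"
  have S: "open S" "\<zeta> k \<in> S" "S \<subseteq> UNIV"
    using insert.hyps insert.prems(1) by (auto simp: S_def open_Diff finite_imp_closed)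
  define u where "u z = inverse (\<Prod>i\<in>K. (z - \<zeta> i) ^ \<mu> i)" for z
  have nz: "(\<Prod>i\<in>K. (z - \<zeta> i) ^ \<mu> i) \<noteq> 0" if "z \<in> S" for z
    using that insert.hyps(1) by (auto simp: S_def)
  have u: "u holomorphic_on S"
    unfolding u_def using nz by (intro holomorphic_intros) auto
  have uf: "(\<lambda>z. u z * f z) holomorphic_on S"
    by (rule holomorphic_on_mult[OF u holomorphic_on_subset[OF assms(2)]]) simp
  have "vanishes_to_order (\<mu> k) (\<lambda>z. u z * f z) (\<zeta> k)"
    using insert.prems(2)
    by (intro vanishes_to_order_mult[OF holomorphic_on_subset[OF assms(2)] u S(1,2)]) auto
  moreover have "(deriv ^^ l) (\<lambda>z. u z * f z) (\<zeta> k) = (deriv ^^ l) h (\<zeta> k)" for l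
  proof (rule higher_deriv_transform_within_open[OF uf _ S(1,2)])
    show "h holomorphic_on S" using h(1) S(3) by (rule holomorphic_on_subset)
    show "u z * f z = h z" if "z \<in> S" for z
      unfolding h(2) u_def using nz[OF that] by simp
  qed
  ultimately have "vanishes_to_order (\<mu> k) h (\<zeta> k)"
    by (simp add: vanishes_to_order_def)
  then obtain g where g: "g holomorphic_on UNIV" "\<And>z. h z = (z - \<zeta> k) ^ \<mu> k * g z"
    using vanishes_to_order_factor[OF h(1)] by blast
  have "f z = (\<Prod>k\<in>insert k K. (z - \<zeta> k) ^ \<mu> k) * g z" for z
    unfolding h(2) g(2) using insert.hyps by simp
  with g(1) show ?case by blast
qed

text \<open>Jensen's inequality in multiplicative form. All prescribed zeros are divided out, and each factor
  \<open>z - \<zeta> k\<close> is replaced by the Blaschke-type factor \<open>b k\<close>, which has the same modulus on the circle and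
  modulus \<open>r\<close> at the centre; the estimate is then the maximum principle.\<close>

lemma jensen_inequality:
  fixes \<zeta> :: "'k \<Rightarrow> complex"
  assumes f: "f holomorphic_on UNIV" and r: "0 < r"
    and K: "finite K" "inj_on \<zeta> K" "\<And>k. k \<in> K \<Longrightarrow> \<zeta> k \<noteq> a" "\<And>k. k \<in> K \<Longrightarrow> cmod (a - \<zeta> k) \<le> r"
    and van: "\<And>k. k \<in> K \<Longrightarrow> vanishes_to_order (\<mu> k) f (\<zeta> k)"
    and van_a: "vanishes_to_order \<nu> f a" "(deriv ^^ \<nu>) f a / fact \<nu> = 1"
    and M: "\<And>z. cmod (a - z) = r \<Longrightarrow> cmod (f z) \<le> M"
  shows "(\<Prod>k\<in>K. (r / cmod (a - \<zeta> k)) ^ \<mu> k) * r ^ \<nu> \<le> M"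
proof -
  obtain f1 where f1: "f1 holomorphic_on UNIV" "\<And>z. f z = (z - a) ^ \<nu> * f1 z"
    using vanishes_to_order_factor[OF f van_a(1)] by blast
  have "f = (\<lambda>z. (z - a) ^ \<nu> * f1 z)" using f1 by auto
  then have f1a: "f1 a = 1"
    using van_a(2) higher_deriv_power_mult_at[OF f1(1), of \<nu> a] by simp
  have "vanishes_to_order (\<mu> k) f1 (\<zeta> k)" if "k \<in> K" for k
  proof -
    define S where "S = UNIV - {a}"
    have S: "open S" "\<zeta> k \<in> S" using K(3)[OF that] by (auto simp: S_def open_Diff)
    have u: "(\<lambda>z. inverse ((z - a) ^ \<nu>)) holomorphic_on S"
      by (intro holomorphic_intros) (auto simp: S_def)
    have "vanishes_to_order (\<mu> k) (\<lambda>z. inverse ((z - a) ^ \<nu>) * f z) (\<zeta> k)"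
      using S u f van[OF that] by (intro vanishes_to_order_mult[of _ S]) (auto intro: holomorphic_on_subset)
    moreover have "(deriv ^^ l) (\<lambda>z. inverse ((z - a) ^ \<nu>) * f z) (\<zeta> k) = (deriv ^^ l) f1 (\<zeta> k)" for l
    proof (rule higher_deriv_transform_within_open[of _ S])
      show "(\<lambda>z. inverse ((z - a) ^ \<nu>) * f z) holomorphic_on S"
        by (rule holomorphic_on_mult[OF u holomorphic_on_subset[OF f]]) simp
      show "f1 holomorphic_on S" using f1(1) by (rule holomorphic_on_subset) simp
      show "inverse ((z - a) ^ \<nu>) * f z = f1 z" if "z \<in> S" for z
        unfolding f1(2) using that by (simp add: S_def)
    qed (use S in auto)
    ultimately show ?thesis by (auto simp: vanishes_to_order_def)
  qed
  then obtain g where g: "g holomorphic_on UNIV" "\<And>z. f1 z = (\<Prod>k\<in>K. (z - \<zeta> k) ^ \<mu> k) * g z"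
    using vanishes_to_order_factor_prod[OF K(1) f1(1) K(2)] by blast
  define b where "b k z = (of_real (r\<^sup>2) - cnj (\<zeta> k - a) * (z - a)) / of_real r" for k z
  define G where "G z = (\<Prod>k\<in>K. b k z ^ \<mu> k) * g z" for z
  have b: "cmod (b k z) = cmod (z - \<zeta> k)" if "cmod (a - z) = r" for k z
  proof -
    have "of_real (r\<^sup>2) = (z - a) * cnj (z - a)"
      using that by (metis complex_norm_square norm_minus_commute)
    then have "of_real (r\<^sup>2) - cnj (\<zeta> k - a) * (z - a) = (z - a) * cnj (z - \<zeta> k)"
      by (simp add: algebra_simps)
    then have "cmod (b k z) = cmod ((z - a) * cnj (z - \<zeta> k)) / r"
      unfolding b_def norm_divide using r by simp
    also have "\<dots> = cmod (z - \<zeta> k)"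
      unfolding norm_mult complex_mod_cnj using r that by (simp add: norm_minus_commute)
    finally show ?thesis .
  qed
  have G: "G holomorphic_on UNIV"
    unfolding G_def b_def using r g(1) by (intro holomorphic_intros) auto
  have G_le: "cmod (G z) \<le> M / r ^ \<nu>" if "cmod (a - z) = r" for z
  proof -
    have "cmod (G z) * r ^ \<nu> = cmod (f z)"
      unfolding f1(2) g(2) G_def norm_mult norm_power prod_norm[symmetric] b[OF that]
      using that by (simp add: norm_minus_commute mult.commute)
    then show ?thesis using M[OF that] r by (simp add: pos_le_divide_eq)
  qed
  have "cmod (G a) \<le> M / r ^ \<nu>"
  proof (rule maximum_modulus_frontier[where f = G and S = "cball a r" and \<xi> = a])
    show "G holomorphic_on interior (cball a r)" using G by (rule holomorphic_on_subset) simp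
    show "continuous_on (closure (cball a r)) G"
      by (intro holomorphic_on_imp_continuous_on holomorphic_on_subset[OF G]) simp
    show "cmod (G z) \<le> M / r ^ \<nu>" if "z \<in> frontier (cball a r)" for z
      using that G_le[of z] by (simp add: frontier_cball dist_norm)
  qed (use r in auto)
  moreover have "cmod (G a) = (\<Prod>k\<in>K. (r / cmod (a - \<zeta> k)) ^ \<mu> k)"
  proof -
    have "cmod (f1 a) = (\<Prod>k\<in>K. cmod (a - \<zeta> k) ^ \<mu> k) * cmod (g a)"
      unfolding g(2) norm_mult norm_power prod_norm[symmetric] ..
    then have 1: "(\<Prod>k\<in>K. cmod (a - \<zeta> k) ^ \<mu> k) * cmod (g a) = 1"
      using f1a by simp
    have 2: "cmod (b k a) = r" for k
      using r by (simp add: b_def norm_divide power2_eq_square norm_mult)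
    have 3: "(\<Prod>k\<in>K. cmod (a - \<zeta> k) ^ \<mu> k) \<noteq> 0"
      using K by auto
    have "cmod (G a) = (\<Prod>k\<in>K. r ^ \<mu> k) * cmod (g a)"
      unfolding G_def norm_mult norm_power prod_norm[symmetric] 2 ..
    also have "cmod (g a) = 1 / (\<Prod>k\<in>K. cmod (a - \<zeta> k) ^ \<mu> k)"
      using 1 3 by (simp add: eq_divide_eq mult.commute)
    finally show ?thesis by (simp add: power_divide prod_dividef)
  qed
  ultimately show ?thesis using r by (simp add: pos_le_divide_eq)
qed

lemma deriv_funpow_sum:
  assumes "\<And>i. i \<in> I \<Longrightarrow> f i holomorphic_on UNIV"
  shows "(deriv ^^ l) (\<lambda>z. \<Sum>i\<in>I. f i z) a = (\<Sum>i\<in>I. (deriv ^^ l) (f i) (a::complex))"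
  using assms
proof (induction I rule: infinite_finite_induct)
  case (insert i I)
  then show ?case
    by (simp add: higher_deriv_add[of _ UNIV] holomorphic_on_sum)
qed auto

text \<open>A non-vanishing \<open>E\<close> can be corrected to have any prescribed jet at \<open>a\<close>: \<open>R\<close> is the Taylor polynomial
  at \<open>a\<close> of \<open>W / E\<close>, where \<open>W\<close> is the polynomial with the desired jet. Its coefficients are bounded by
  Cauchy's estimates on the circle of radius \<open>s\<close>, inside which \<open>E\<close> is bounded below.\<close>

lemma jet_correction:
  fixes w :: "nat \<Rightarrow> complex"
  assumes E: "E holomorphic_on UNIV" and s: "0 < s" and e0: "0 < e0"
    and low: "\<And>z. cmod (z - a) \<le> s \<Longrightarrow> e0 \<le> cmod (E z)"
    and w: "(\<Sum>l<\<mu>. cmod (w l)) \<le> W0"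
  obtains R where "R holomorphic_on UNIV"
    "\<And>l. l < \<mu> \<Longrightarrow> (deriv ^^ l) (\<lambda>z. R z * E z) a / fact l = w l"
    "\<And>z. cmod (R z) \<le> real \<mu> * (W0 * max 1 s ^ \<mu> / e0 * max 1 (cmod (z - a) / s) ^ \<mu>)"
proof -
  define W where "W z = (\<Sum>l<\<mu>. w l * (z - a) ^ l)" for z
  define S where "S = {z. E z \<noteq> 0}"
  have contE: "continuous_on UNIV E" using E holomorphic_on_imp_continuous_on by blast
  have oS: "open S" unfolding S_def
    using open_Collect_neq[OF contE continuous_on_const[of _ 0]] by simp
  have sub: "cball a s \<subseteq> S"
  proof
    fix z assume "z \<in> cball a s"
    then have "e0 \<le> cmod (E z)" using low[of z] by (simp add: dist_norm norm_minus_commute)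
    then show "z \<in> S" using e0 by (auto simp: S_def)
  qed
  then have aS: "a \<in> S" using s by auto
  define g where "g z = W z / E z" for z
  have W: "W holomorphic_on X" for X unfolding W_def by (intro holomorphic_intros)
  have g: "g holomorphic_on S" unfolding g_def
    by (intro holomorphic_intros W holomorphic_on_subset[OF E]) (auto simp: S_def)
  define c where "c l = (deriv ^^ l) g a / fact l" for l
  define R where "R z = (\<Sum>l<\<mu>. c l * (z - a) ^ l)" for z
  have R: "R holomorphic_on X" for X unfolding R_def by (intro holomorphic_intros)
  have jetpoly: "(deriv ^^ l) (\<lambda>z. \<Sum>i<\<mu>. v i * (z - a) ^ i) a = fact l * v l"
    if "l < \<mu>" for l and v :: "nat \<Rightarrow> complex"
  proof -
    have "(deriv ^^ l) (\<lambda>z. v i * (z - a) ^ i) a = (if i = l then fact l * v l else 0)" for i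
    proof -
      have "(deriv ^^ l) (\<lambda>z. v i * (z - a) ^ i) a = v i * (deriv ^^ l) (\<lambda>z. (z - a) ^ i) a"
        by (rule higher_deriv_cmult[of _ UNIV]) (auto intro!: holomorphic_intros)
      moreover have "l \<noteq> i \<Longrightarrow> pochhammer (of_nat (Suc i - l)) l * (0::complex) ^ (i - l) = 0"
        by (cases "l < i") (auto simp: pochhammer_0_left not_less)
      ultimately show ?thesis
        by (auto simp: higher_deriv_power pochhammer_fact[symmetric])
    qed
    then show ?thesis
      using that by (subst deriv_funpow_sum) (auto intro!: holomorphic_intros)
  qed
  have W0: "0 \<le> W0" by (rule order_trans[OF _ w]) (simp add: sum_nonneg)
  show ?thesis
  proof (rule that[of R])
    show "R holomorphic_on UNIV" by (rule R)
    show "(deriv ^^ l) (\<lambda>z. R z * E z) a / fact l = w l" if "l < \<mu>" for l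
    proof -
      have hE: "E holomorphic_on S" using E holomorphic_on_subset by blast
      have "vanishes_to_order \<mu> (\<lambda>z. g z - R z) a"
        unfolding vanishes_to_order_def
      proof (intro allI impI)
        fix i assume i: "i < \<mu>"
        have "(deriv ^^ i) R a = fact i * c i"
          unfolding R_def using jetpoly[OF i] .
        then show "(deriv ^^ i) (\<lambda>z. g z - R z) a = 0"
          by (subst higher_deriv_diff[OF g R oS aS]) (simp add: c_def)
      qed
      then have "vanishes_to_order \<mu> (\<lambda>z. E z * (g z - R z)) a"
        using oS aS hE g R by (intro vanishes_to_order_mult[of _ S]) (auto intro!: holomorphic_intros)
      then have "0 = (deriv ^^ l) (\<lambda>z. E z * (g z - R z)) a"
        using that by (auto simp: vanishes_to_order_def)
      also have "\<dots> = (deriv ^^ l) (\<lambda>z. W z - R z * E z) a"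
      proof (rule higher_deriv_transform_within_open[OF _ _ oS aS])
        show "(\<lambda>z. E z * (g z - R z)) holomorphic_on S" using hE g R by (intro holomorphic_intros)
        show "(\<lambda>z. W z - R z * E z) holomorphic_on S" using hE W R by (intro holomorphic_intros)
        show "E z * (g z - R z) = W z - R z * E z" if "z \<in> S" for z
          using that by (simp add: g_def S_def field_simps)
      qed
      also have "\<dots> = (deriv ^^ l) W a - (deriv ^^ l) (\<lambda>z. R z * E z) a"
        using oS aS hE R W by (intro higher_deriv_diff[of _ S]) (auto intro!: holomorphic_intros)
      also have "(deriv ^^ l) W a = fact l * w l"
        unfolding W_def using jetpoly[OF that] .
      finally have "(deriv ^^ l) (\<lambda>z. R z * E z) a = fact l * w l" by simp
      then show ?thesis by simp
    qed
    show "cmod (R z) \<le> real \<mu> * (W0 * max 1 s ^ \<mu> / e0 * max 1 (cmod (z - a) / s) ^ \<mu>)" for z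
    proof -
      have gb: "cmod (g x) \<le> W0 * max 1 s ^ \<mu> / e0" if "cmod (a - x) = s" for x
      proof -
        have "cmod (W x) \<le> (\<Sum>l<\<mu>. cmod (w l) * s ^ l)"
          unfolding W_def using that
          by (intro sum_norm_le) (auto simp: norm_mult norm_power norm_minus_commute)
        also have "\<dots> \<le> (\<Sum>l<\<mu>. cmod (w l) * max 1 s ^ \<mu>)"
        proof (intro sum_mono mult_left_mono)
          fix l assume "l \<in> {..<\<mu>}"
          have "s ^ l \<le> max 1 s ^ l" using s by (intro power_mono) auto
          also have "\<dots> \<le> max 1 s ^ \<mu>" using \<open>l \<in> _\<close> by (intro power_increasing) auto
          finally show "s ^ l \<le> max 1 s ^ \<mu>" .
        qed auto
        also have "\<dots> \<le> W0 * max 1 s ^ \<mu>"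
          using w by (simp add: sum_distrib_right[symmetric] mult_right_mono)
        finally have "cmod (W x) \<le> W0 * max 1 s ^ \<mu>" .
        moreover have "e0 \<le> cmod (E x)" using low[of x] that by (simp add: norm_minus_commute)
        ultimately show ?thesis
          unfolding g_def norm_divide using e0 W0 by (intro frac_le) auto
      qed
      have cb: "cmod (c l) \<le> W0 * max 1 s ^ \<mu> / e0 / s ^ l" for l
      proof -
        have "cmod ((deriv ^^ l) g a) \<le> fact l * (W0 * max 1 s ^ \<mu> / e0) / s ^ l"
          using s sub gb by (intro Cauchy_inequality holomorphic_on_subset[OF g]
            holomorphic_on_imp_continuous_on) auto
        then show ?thesis by (simp add: c_def norm_divide field_simps)
      qed
      have "cmod (R z) \<le> (\<Sum>l<\<mu>. W0 * max 1 s ^ \<mu> / e0 * max 1 (cmod (z - a) / s) ^ \<mu>)"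
        unfolding R_def
      proof (rule sum_norm_le)
        fix l assume l: "l \<in> {..<\<mu>}"
        have "cmod (c l * (z - a) ^ l) \<le> W0 * max 1 s ^ \<mu> / e0 / s ^ l * cmod (z - a) ^ l"
          unfolding norm_mult norm_power using cb by (intro mult_right_mono) auto
        also have "\<dots> = W0 * max 1 s ^ \<mu> / e0 * (cmod (z - a) / s) ^ l"
          by (simp add: power_divide)
        also have "\<dots> \<le> W0 * max 1 s ^ \<mu> / e0 * max 1 (cmod (z - a) / s) ^ \<mu>"
        proof (rule mult_left_mono)
          have "(cmod (z - a) / s) ^ l \<le> max 1 (cmod (z - a) / s) ^ l"
            using s by (intro power_mono) auto
          also have "\<dots> \<le> max 1 (cmod (z - a) / s) ^ \<mu>"
            using l by (intro power_increasing) auto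
          finally show "(cmod (z - a) / s) ^ l \<le> max 1 (cmod (z - a) / s) ^ \<mu>" .
        qed (use W0 e0 in auto)
        finally show "cmod (c l * (z - a) ^ l) \<le> W0 * max 1 s ^ \<mu> / e0 * max 1 (cmod (z - a) / s) ^ \<mu>" .
      qed
      then show ?thesis by simp
    qed
  qed
qed

section \<open>Growth functions and sums over sparse points\<close>

text \<open>The assumption \<open>growth\<close> says that \<open>Q r / r powr \<delta>\<close> is nondecreasing, and \<open>doubling\<close> bounds the order
  of \<open>Q\<close> from above. The restriction to radii \<open>\<ge> 1\<close>, where \<open>Q\<close> is at least \<open>1\<close>, lets additive constants be absorbed into
  multiples of \<open>Q\<close>.\<close>

locale regular_growth =
  fixes Q :: "real \<Rightarrow> real" and \<delta> D :: real
  assumes \<delta>_pos: "0 < \<delta>"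
    and Q_ge_1: "1 \<le> r \<Longrightarrow> 1 \<le> Q r"
    and growth: "1 \<le> r \<Longrightarrow> r \<le> R \<Longrightarrow> Q r \<le> (r / R) powr \<delta> * Q R"
    and doubling: "1 \<le> r \<Longrightarrow> Q (2 * r) \<le> D * Q r"
begin

lemma Q_mono: assumes "1 \<le> r" "r \<le> R" shows "Q r \<le> Q R"
proof -
  have "(r / R) powr \<delta> \<le> 1"
    using assms \<delta>_pos by (intro powr_le1) auto
  moreover have "0 \<le> Q R" using Q_ge_1[of R] assms by auto
  ultimately show ?thesis
    using growth[OF assms] mult_right_mono[of "(r / R) powr \<delta>" 1 "Q R"] by simp
qed

lemma D_ge_1: "1 \<le> D"
proof -
  have "Q 1 \<le> D * Q 1" using Q_mono[of 1 2] doubling[of 1] by simp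
  then show ?thesis using Q_ge_1[of 1] mult_le_cancel_right1[of "Q 1" D] by simp
qed

lemma doubling_power: "1 \<le> r \<Longrightarrow> Q (2 ^ n * r) \<le> D ^ n * Q r"
proof (induction n)
  case (Suc n)
  have "1 \<le> 2 ^ n * r" using Suc.prems mult_mono[of 1 "2 ^ n" 1 r] by simp
  then have "Q (2 ^ Suc n * r) \<le> D * Q (2 ^ n * r)"
    using doubling[of "2 ^ n * r"] by (simp add: mult.assoc)
  also have "\<dots> \<le> D * (D ^ n * Q r)"
    using Suc D_ge_1 by (intro mult_left_mono) auto
  finally show ?case by simp
qed simp

text \<open>A polynomial of degree comparable to \<open>Q r\<close> whose natural length scale is \<open>r\<close> is of size
  \<open>(4 + R / r) ^ degree\<close> at distance \<open>R\<close>; this inequality shows that its logarithm is \<open>O(Q r + Q R)\<close>.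
  The logarithm loses against the power \<open>(R / r) powr \<delta>\<close> that \<open>Q\<close> gains between \<open>r\<close> and \<open>R\<close>.\<close>

lemma Q_log_le:
  assumes "1 \<le> r" "1 \<le> R"
  shows "Q r * ln (4 + R / r) \<le> (ln 5 + 1 / \<delta>) * (Q r + Q R)"
proof -
  have Q: "1 \<le> Q r" "1 \<le> Q R" using assms Q_ge_1 by auto
  show ?thesis
  proof (cases "R \<le> r")
    case True
    then have "ln (4 + R / r) \<le> ln 5" using assms by (subst ln_le_cancel_iff) (auto simp: add_pos_nonneg)
    also have "\<dots> \<le> ln 5 + 1 / \<delta>" using \<delta>_pos by simp
    finally have "Q r * ln (4 + R / r) \<le> (ln 5 + 1 / \<delta>) * Q r" using Q by simp
    also have "\<dots> \<le> (ln 5 + 1 / \<delta>) * (Q r + Q R)"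
      using Q \<delta>_pos by (intro mult_left_mono) auto
    finally show ?thesis .
  next
    case False
    then have x: "1 \<le> R / r" using assms by simp
    have "ln (4 + R / r) \<le> ln (5 * (R / r))" using x by (subst ln_le_cancel_iff) auto
    also have "\<dots> = ln 5 + ln (R / r)" using x by (subst ln_mult_pos) auto
    also have "ln (R / r) \<le> (R / r) powr \<delta> / \<delta>" using ln_powr_bound[OF x \<delta>_pos] .
    finally have "Q r * ln (4 + R / r) \<le> Q r * (ln 5 + (R / r) powr \<delta> / \<delta>)"
      using Q by (intro mult_left_mono) auto
    then have "Q r * ln (4 + R / r) \<le> Q r * ln 5 + (Q r * (R / r) powr \<delta>) / \<delta>"
      by (simp add: distrib_left)
    also have "Q r * (R / r) powr \<delta> \<le> Q R"
    proof -
      have "Q r * (R / r) powr \<delta> \<le> ((r / R) powr \<delta> * Q R) * (R / r) powr \<delta>"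
        using growth[of r R] assms False by (intro mult_right_mono) auto
      also have "\<dots> = ((r / R) * (R / r)) powr \<delta> * Q R"
        using assms by (subst powr_mult) auto
      finally show ?thesis using assms by simp
    qed
    finally have "Q r * ln (4 + R / r) \<le> Q r * ln 5 + Q R / \<delta>"
      using \<delta>_pos by (simp add: divide_right_mono)
    also have "\<dots> \<le> (ln 5 + 1 / \<delta>) * (Q r + Q R)"
      using Q \<delta>_pos by (simp add: algebra_simps)
    finally show ?thesis .
  qed
qed

text \<open>Unrolling the recursion over \<open>r, r / 2, r / 4, \<dots>\<close> gives a geometric series with ratio
  \<open>c / 2 powr \<delta>\<close>, because \<open>Q (r / 2) \<le> Q r / 2 powr \<delta>\<close>.\<close>

lemma halving_recursion:
  fixes g :: "real \<Rightarrow> real"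
  assumes small: "\<And>r. r < 1 \<Longrightarrow> g r \<le> 0"
    and rec: "\<And>r. 1 \<le> r \<Longrightarrow> g r \<le> c * g (r / 2) + C * Q r"
    and c: "0 \<le> c" "c < 2 powr \<delta>" and C: "0 \<le> C" and r: "1 \<le> r"
  shows "g r \<le> C / (1 - c / 2 powr \<delta>) * Q r"
proof -
  define K where "K = C / (1 - c / 2 powr \<delta>)"
  have q: "0 < 1 - c / 2 powr \<delta>" using c by simp
  then have K: "0 \<le> K" using C by (simp add: K_def)
  have "K * (1 - c / 2 powr \<delta>) = C" using q by (simp add: K_def)
  then have KK: "c * (K * (1 / 2 powr \<delta>)) + C = K" by (simp add: algebra_simps)
  have "1 \<le> r \<and> r < 2 ^ n \<longrightarrow> g r \<le> K * Q r" for n r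
  proof (induction n arbitrary: r)
    case (Suc n)
    show ?case
    proof (intro impI, elim conjE)
      assume r: "1 \<le> r" "r < 2 ^ Suc n"
      have half: "g (r / 2) \<le> K * ((1 / 2 powr \<delta>) * Q r)"
      proof (cases "1 \<le> r / 2")
        case True
        then have "g (r / 2) \<le> K * Q (r / 2)" using Suc[of "r / 2"] r by simp
        also have "\<dots> \<le> K * (((r / 2) / r) powr \<delta> * Q r)"
          using True r K by (intro mult_left_mono growth) auto
        also have "((r / 2) / r) powr \<delta> = 1 / 2 powr \<delta>" using r by (simp add: powr_divide)
        finally show ?thesis by simp
      next
        case False
        have "0 \<le> K * ((1 / 2 powr \<delta>) * Q r)"
          using K Q_ge_1[OF r(1)] by (intro mult_nonneg_nonneg) auto
        then show ?thesis using False small[of "r / 2"] by linarith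
      qed
      have "g r \<le> c * g (r / 2) + C * Q r" using rec r by blast
      also have "\<dots> \<le> c * (K * ((1 / 2 powr \<delta>) * Q r)) + C * Q r"
        using mult_left_mono[OF half c(1)] by simp
      also have "\<dots> = (c * (K * (1 / 2 powr \<delta>)) + C) * Q r" by (simp add: algebra_simps)
      finally show "g r \<le> K * Q r" using KK by simp
    qed
  qed auto
  moreover obtain n where "r < 2 ^ n" using real_arch_pow[of 2 r] by auto
  ultimately show ?thesis using r by (auto simp: K_def)
qed

text \<open>Going outwards through dyadic annuli, the number of points grows by a factor of at most \<open>D\<close> per step
  while \<open>(r / \<tau> k) ^ L\<close> shrinks by \<open>2 ^ L\<close>. The induction is on the number of doublings needed to exhaust
  the finite set, so the constant does not depend on \<open>J\<close>.\<close>

lemma tail_sum_le: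
  fixes \<tau> :: "'k \<Rightarrow> real" and m :: "'k \<Rightarrow> nat"
  assumes J: "finite J"
    and count: "\<And>R. 1 \<le> R \<Longrightarrow> (\<Sum>k | k \<in> J \<and> \<tau> k \<le> R. real (m k)) \<le> C * Q R"
    and L: "2 * D \<le> 2 ^ L" and r: "1 \<le> r"
  shows "(\<Sum>k | k \<in> J \<and> r < \<tau> k. real (m k) * (r / \<tau> k) ^ L) \<le> 2 * C * D * Q r"
proof -
  have C: "0 \<le> C"
  proof -
    have "0 \<le> C * Q 1"
      using count[of 1] by (rule order_trans[rotated]) (auto simp: sum_nonneg)
    then show ?thesis using Q_ge_1[of 1] by (simp add: zero_le_mult_iff)
  qed
  define T where "T = Max (insert 1 (\<tau> ` J))"
  have T: "\<tau> k \<le> T" if "k \<in> J" for k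
    using J that by (auto simp: T_def)
  have "\<forall>r. 1 \<le> r \<and> T \<le> 2 ^ n * r \<longrightarrow>
      (\<Sum>k | k \<in> J \<and> r < \<tau> k. real (m k) * (r / \<tau> k) ^ L) \<le> 2 * C * D * Q r" for n
  proof (induction n)
    case 0
    show ?case
    proof (intro allI impI)
      fix r :: real assume r: "1 \<le> r \<and> T \<le> 2 ^ 0 * r"
      then have "{k. k \<in> J \<and> r < \<tau> k} = {}" using T by fastforce
      then show "(\<Sum>k | k \<in> J \<and> r < \<tau> k. real (m k) * (r / \<tau> k) ^ L) \<le> 2 * C * D * Q r"
        using C D_ge_1 Q_ge_1[of r] r by (simp only: sum.empty) auto
    qed
  next
    case (Suc n)
    show ?case
    proof (intro allI impI)
      fix r :: real assume r: "1 \<le> r \<and> T \<le> 2 ^ Suc n * r"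
      let ?f = "\<lambda>r k. real (m k) * (r / \<tau> k) ^ L"
      have "{k. k \<in> J \<and> r < \<tau> k} = {k. k \<in> J \<and> r < \<tau> k \<and> \<tau> k \<le> 2 * r} \<union> {k. k \<in> J \<and> 2 * r < \<tau> k}"
        using r by auto
      then have "(\<Sum>k | k \<in> J \<and> r < \<tau> k. ?f r k) =
          (\<Sum>k | k \<in> J \<and> r < \<tau> k \<and> \<tau> k \<le> 2 * r. ?f r k) + (\<Sum>k | k \<in> J \<and> 2 * r < \<tau> k. ?f r k)"
        using J by (simp only:) (subst sum.union_disjoint, auto)
      also have "(\<Sum>k | k \<in> J \<and> r < \<tau> k \<and> \<tau> k \<le> 2 * r. ?f r k) \<le>
          (\<Sum>k | k \<in> J \<and> r < \<tau> k \<and> \<tau> k \<le> 2 * r. real (m k))"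
        using r by (intro sum_mono mult_left_le power_le_one) auto
      also have "\<dots> \<le> (\<Sum>k | k \<in> J \<and> \<tau> k \<le> 2 * r. real (m k))"
        using J by (intro sum_mono2) auto
      also have "\<dots> \<le> C * Q (2 * r)" using r by (intro count) auto
      also have "\<dots> \<le> C * (D * Q r)" using r C doubling[of r] by (intro mult_left_mono) auto
      also have "(\<Sum>k | k \<in> J \<and> 2 * r < \<tau> k. ?f r k) =
          (1 / 2 ^ L) * (\<Sum>k | k \<in> J \<and> 2 * r < \<tau> k. ?f (2 * r) k)"
        by (simp add: sum_distrib_left power_divide power_mult_distrib)
      also have "\<dots> \<le> (1 / 2 ^ L) * (2 * C * D * Q (2 * r))"
        using Suc[rule_format, of "2 * r"] r by (intro mult_left_mono) (auto simp: mult_ac)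
      also have "\<dots> \<le> (1 / 2 ^ L) * (2 * C * D * (D * Q r))"
        using r C D_ge_1 doubling[of r] by (intro mult_left_mono) auto
      also have "\<dots> = (2 * D / 2 ^ L) * (C * D * Q r)" by simp
      also have "\<dots> \<le> 1 * (C * D * Q r)"
        using L C D_ge_1 Q_ge_1[of r] r by (intro mult_right_mono) auto
      finally show "(\<Sum>k | k \<in> J \<and> r < \<tau> k. ?f r k) \<le> 2 * C * D * Q r" by simp
    qed
  qed
  moreover obtain n where "T < 2 ^ n" using real_arch_pow[of 2 T] by auto
  moreover have "(2::real) ^ n \<le> 2 ^ n * r" using r by simp
  ultimately show ?thesis using r by (meson less_le_trans less_imp_le)
qed

text \<open>Going inwards, the summands grow by \<open>2 powr (\<delta> / 2)\<close> per dyadic step, which is less than the factor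
  \<open>2 powr \<delta>\<close> by which \<open>Q\<close> shrinks.\<close>

lemma head_sum_le:
  fixes \<tau> :: "'k \<Rightarrow> real" and m :: "'k \<Rightarrow> nat"
  assumes J: "finite J" and \<tau>: "\<And>k. k \<in> J \<Longrightarrow> 1 \<le> \<tau> k"
    and count: "\<And>R. 1 \<le> R \<Longrightarrow> (\<Sum>k | k \<in> J \<and> \<tau> k \<le> R. real (m k)) \<le> C * Q R"
    and r: "1 \<le> r" and C: "0 \<le> C"
  shows "(\<Sum>k | k \<in> J \<and> \<tau> k \<le> r. real (m k) * (r / \<tau> k) powr (\<delta> / 2)) \<le>
    2 powr (\<delta> / 2) * C / (1 - 1 / 2 powr (\<delta> / 2)) * Q r"
proof -
  define c :: real where "c = 2 powr (\<delta> / 2)"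
  have cc: "2 powr \<delta> = c * c" by (simp add: c_def powr_add[symmetric])
  have c1: "1 < c" using \<delta>_pos by (simp add: c_def)
  let ?f = "\<lambda>r k. real (m k) * (r / \<tau> k) powr (\<delta> / 2)"
  have "(\<Sum>k | k \<in> J \<and> \<tau> k \<le> r. ?f r k) \<le> (c * C) / (1 - c / 2 powr \<delta>) * Q r"
  proof (rule halving_recursion[where c = c])
    show "(\<Sum>k | k \<in> J \<and> \<tau> k \<le> r. ?f r k) \<le> 0" if "r < 1" for r
    proof -
      have "{k. k \<in> J \<and> \<tau> k \<le> r} = {}" using \<tau> that by fastforce
      then show ?thesis by (simp only: sum.empty)
    qed
    show "(\<Sum>k | k \<in> J \<and> \<tau> k \<le> r. ?f r k) \<le>
        c * (\<Sum>k | k \<in> J \<and> \<tau> k \<le> r / 2. ?f (r / 2) k) + c * C * Q r" if r: "1 \<le> r" for r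
    proof -
      have "{k. k \<in> J \<and> \<tau> k \<le> r} = {k. k \<in> J \<and> \<tau> k \<le> r / 2} \<union> {k. k \<in> J \<and> r / 2 < \<tau> k \<and> \<tau> k \<le> r}"
        using r by auto
      then have "(\<Sum>k | k \<in> J \<and> \<tau> k \<le> r. ?f r k) =
          (\<Sum>k | k \<in> J \<and> \<tau> k \<le> r / 2. ?f r k) + (\<Sum>k | k \<in> J \<and> r / 2 < \<tau> k \<and> \<tau> k \<le> r. ?f r k)"
        using J by (simp only:) (subst sum.union_disjoint, auto)
      also have "(\<Sum>k | k \<in> J \<and> \<tau> k \<le> r / 2. ?f r k) = c * (\<Sum>k | k \<in> J \<and> \<tau> k \<le> r / 2. ?f (r / 2) k)"
        unfolding sum_distrib_left
      proof (rule sum.cong)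
        fix k assume k: "k \<in> {k. k \<in> J \<and> \<tau> k \<le> r / 2}"
        have "(r / \<tau> k) powr (\<delta> / 2) = (2 * ((r / 2) / \<tau> k)) powr (\<delta> / 2)" by simp
        also have "\<dots> = c * ((r / 2) / \<tau> k) powr (\<delta> / 2)"
          using k \<tau>[of k] r unfolding c_def by (subst powr_mult) auto
        finally show "?f r k = c * ?f (r / 2) k" by simp
      qed simp
      also have "(\<Sum>k | k \<in> J \<and> r / 2 < \<tau> k \<and> \<tau> k \<le> r. ?f r k) \<le>
          (\<Sum>k | k \<in> J \<and> r / 2 < \<tau> k \<and> \<tau> k \<le> r. c * real (m k))"
      proof (rule sum_mono)
        fix k assume k: "k \<in> {k. k \<in> J \<and> r / 2 < \<tau> k \<and> \<tau> k \<le> r}"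
        have "(r / \<tau> k) powr (\<delta> / 2) \<le> 2 powr (\<delta> / 2)"
          using k \<tau>[of k] r \<delta>_pos by (intro powr_mono2) (auto simp: field_simps)
        then show "?f r k \<le> c * real (m k)"
          unfolding c_def by (simp add: mult.commute mult_left_mono)
      qed
      also have "\<dots> \<le> (\<Sum>k | k \<in> J \<and> \<tau> k \<le> r. c * real (m k))"
        using J c1 by (intro sum_mono2) auto
      also have "\<dots> = c * (\<Sum>k | k \<in> J \<and> \<tau> k \<le> r. real (m k))" by (simp add: sum_distrib_left)
      also have "\<dots> \<le> c * (C * Q r)" using count[OF r] c1 by (intro mult_left_mono) auto
      finally show ?thesis by simp
    qed
  qed (use c1 cc C r in auto)
  also have "c / 2 powr \<delta> = 1 / c" using cc c1 by simp
  finally show ?thesis by (simp add: c_def)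
qed

text \<open>This is the bound for \<open>ln \<bar>\<Prod> (1 - (z / \<zeta> k) ^ L) ^ m k\<bar>\<close> on \<open>\<bar>z\<bar> = r\<close>. Points beyond \<open>r\<close> contribute at most
  \<open>(r / \<tau> k) ^ L\<close>, and points before \<open>r\<close> only a logarithm, hence a small power of \<open>r / \<tau> k\<close>. The constant is
  chosen before the finite set \<open>J\<close>.\<close>

lemma log_sum_le:
  fixes \<tau> :: "'k \<Rightarrow> real" and m :: "'k \<Rightarrow> nat"
  assumes L: "2 * D \<le> 2 ^ L" and C: "0 \<le> C"
  obtains K where "0 < K"
    "\<And>(J :: 'k set) r. finite J \<Longrightarrow> (\<And>k. k \<in> J \<Longrightarrow> 1 \<le> \<tau> k) \<Longrightarrow>
      (\<And>R. 1 \<le> R \<Longrightarrow> (\<Sum>k | k \<in> J \<and> \<tau> k \<le> R. real (m k)) \<le> C * Q R) \<Longrightarrow> 1 \<le> r \<Longrightarrow>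
      (\<Sum>k\<in>J. real (m k) * ln (1 + (r / \<tau> k) ^ L)) \<le> K * Q r"
proof -
  define c where "c = 1 + real L * (2 / \<delta>)"
  have c: "0 \<le> c" using \<delta>_pos by (simp add: c_def)
  define K1 where "K1 = 2 powr (\<delta> / 2) * C / (1 - 1 / 2 powr (\<delta> / 2))"
  have "1 < 2 powr (\<delta> / 2)" using \<delta>_pos by simp
  then have K1: "0 \<le> K1" using C by (simp add: K1_def)
  have ln_le: "ln (1 + x ^ L) \<le> c * x powr (\<delta> / 2)" if "1 \<le> x" for x :: real
  proof -
    have "ln (1 + x ^ L) \<le> ln (2 * x ^ L)"
      using that one_le_power[OF that, of L] by (subst ln_le_cancel_iff) (auto simp: add_pos_pos)
    also have "\<dots> = ln 2 + real L * ln x"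
      using that by (subst ln_mult_pos) (auto simp: ln_realpow)
    also have "\<dots> \<le> 1 + real L * (x powr (\<delta> / 2) / (\<delta> / 2))"
      using \<delta>_pos that ln_2_less_1 by (intro add_mono mult_left_mono ln_powr_bound) auto
    also have "1 \<le> x powr (\<delta> / 2)" using that \<delta>_pos by (intro ge_one_powr_ge_zero) auto
    finally show ?thesis by (simp add: c_def algebra_simps)
  qed
  show ?thesis
  proof (rule that[of "c * K1 + 2 * C * D + 1"])
    show "0 < c * K1 + 2 * C * D + 1" using c K1 C D_ge_1 by (simp add: add_nonneg_pos)
    fix J :: "'k set" and r :: real
    assume J: "finite J" and \<tau>: "\<And>k. k \<in> J \<Longrightarrow> 1 \<le> \<tau> k" and r: "1 \<le> r"
      and count: "\<And>R. 1 \<le> R \<Longrightarrow> (\<Sum>k | k \<in> J \<and> \<tau> k \<le> R. real (m k)) \<le> C * Q R"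
    have "J = {k. k \<in> J \<and> \<tau> k \<le> r} \<union> {k. k \<in> J \<and> r < \<tau> k}" by auto
    then have "(\<Sum>k\<in>J. real (m k) * ln (1 + (r / \<tau> k) ^ L)) =
        (\<Sum>k\<in>{k. k \<in> J \<and> \<tau> k \<le> r} \<union> {k. k \<in> J \<and> r < \<tau> k}. real (m k) * ln (1 + (r / \<tau> k) ^ L))"
      by (rule arg_cong)
    also have "\<dots> =
        (\<Sum>k | k \<in> J \<and> \<tau> k \<le> r. real (m k) * ln (1 + (r / \<tau> k) ^ L)) +
        (\<Sum>k | k \<in> J \<and> r < \<tau> k. real (m k) * ln (1 + (r / \<tau> k) ^ L))"
      using J by (intro sum.union_disjoint) auto
    also have "(\<Sum>k | k \<in> J \<and> \<tau> k \<le> r. real (m k) * ln (1 + (r / \<tau> k) ^ L)) \<le>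
        (\<Sum>k | k \<in> J \<and> \<tau> k \<le> r. c * (real (m k) * (r / \<tau> k) powr (\<delta> / 2)))"
    proof (rule sum_mono)
      fix k assume k: "k \<in> {k. k \<in> J \<and> \<tau> k \<le> r}"
      then have "1 \<le> r / \<tau> k" using \<tau>[of k] by simp
      then show "real (m k) * ln (1 + (r / \<tau> k) ^ L) \<le> c * (real (m k) * (r / \<tau> k) powr (\<delta> / 2))"
        using mult_left_mono[OF ln_le, of "r / \<tau> k" "real (m k)"] by (simp add: algebra_simps)
    qed
    also have "\<dots> = c * (\<Sum>k | k \<in> J \<and> \<tau> k \<le> r. real (m k) * (r / \<tau> k) powr (\<delta> / 2))"
      by (simp add: sum_distrib_left)
    also have "\<dots> \<le> c * (K1 * Q r)"
      unfolding K1_def using c J \<tau> count r C by (intro mult_left_mono head_sum_le) auto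
    also have "(\<Sum>k | k \<in> J \<and> r < \<tau> k. real (m k) * ln (1 + (r / \<tau> k) ^ L)) \<le>
        (\<Sum>k | k \<in> J \<and> r < \<tau> k. real (m k) * (r / \<tau> k) ^ L)"
    proof (intro sum_mono mult_left_mono ln_add_one_self_le_self)
      fix k assume "k \<in> {k. k \<in> J \<and> r < \<tau> k}"
      then show "0 \<le> (r / \<tau> k) ^ L" using r by auto
    qed auto
    also have "\<dots> \<le> 2 * C * D * Q r" using J count L r by (rule tail_sum_le)
    finally have "(\<Sum>k\<in>J. real (m k) * ln (1 + (r / \<tau> k) ^ L)) \<le> (c * K1 + 2 * C * D) * Q r"
      by (simp add: algebra_simps)
    also have "\<dots> \<le> (c * K1 + 2 * C * D + 1) * Q r"
      using Q_ge_1[OF r] by (intro mult_right_mono) auto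
    finally show "(\<Sum>k\<in>J. real (m k) * ln (1 + (r / \<tau> k) ^ L)) \<le> (c * K1 + 2 * C * D + 1) * Q r" .
  qed
qed

end

section \<open>Products vanishing at the other points\<close>

text \<open>The shift by \<open>1\<close> keeps all radii at least \<open>1\<close>, so that logarithms of radii are nonnegative and points of the
  variety at or near the origin are treated like all others.\<close>

definition tau :: "complex \<Rightarrow> real" where "tau z = 1 + cmod z"

lemma tau_ge_1 [simp]: "1 \<le> tau z" by (simp add: tau_def)

lemma tau_pos [simp]: "0 < tau z" by (simp add: tau_def add_pos_nonneg)

lemma tau_nonneg [simp]: "0 \<le> tau z" by (simp add: tau_def)

lemma norm_prod_power_le_exp:
  fixes a :: "'k \<Rightarrow> complex"
  assumes "\<And>k. k \<in> A \<Longrightarrow> cmod (a k) \<le> exp (b k)"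
  shows "cmod (\<Prod>k\<in>A. a k ^ m k) \<le> exp (\<Sum>k\<in>A. real (m k) * b k)"
proof (cases "finite A")
  case True
  have "cmod (\<Prod>k\<in>A. a k ^ m k) = (\<Prod>k\<in>A. cmod (a k) ^ m k)"
    by (simp add: prod_norm[symmetric] norm_power)
  also have "\<dots> \<le> (\<Prod>k\<in>A. exp (b k) ^ m k)"
    using assms by (intro prod_mono) (auto intro: power_mono)
  also have "\<dots> = exp (\<Sum>k\<in>A. real (m k) * b k)"
    using True by (simp add: exp_sum exp_of_nat_mult)
  finally show ?thesis .
qed simp

lemma norm_prod_power_ge_exp:
  fixes a :: "'k \<Rightarrow> complex"
  assumes "\<And>k. k \<in> A \<Longrightarrow> exp (b k) \<le> cmod (a k)"
  shows "exp (\<Sum>k\<in>A. real (m k) * b k) \<le> cmod (\<Prod>k\<in>A. a k ^ m k)"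
proof (cases "finite A")
  case True
  have "exp (\<Sum>k\<in>A. real (m k) * b k) = (\<Prod>k\<in>A. exp (b k) ^ m k)"
    using True by (simp add: exp_sum exp_of_nat_mult)
  also have "\<dots> \<le> (\<Prod>k\<in>A. cmod (a k) ^ m k)"
    using assms by (intro prod_mono) (auto intro: power_mono)
  also have "\<dots> = cmod (\<Prod>k\<in>A. a k ^ m k)"
    by (simp add: prod_norm[symmetric] norm_power)
  finally show ?thesis .
qed simp

lemma exp_minus_double_le: "0 \<le> x \<Longrightarrow> x \<le> 1 / 2 \<Longrightarrow> exp (- 2 * x) \<le> 1 - (x::real)"
proof -
  assume x: "0 \<le> x" "x \<le> 1 / 2"
  have "x\<^sup>2 \<le> x * (1 / 2)" unfolding power2_eq_square using x by (intro mult_left_mono) auto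
  then have "- 2 * x \<le> - x - 2 * x\<^sup>2" by simp
  also have "\<dots> \<le> ln (1 - x)" using ln_one_minus_pos_lower_bound[OF x] .
  finally have "exp (- 2 * x) \<le> exp (ln (1 - x))" by (subst exp_le_cancel_iff)
  then show ?thesis using x by simp
qed

text \<open>The ranks of the \<open>\<rho> j\<close> are at least \<open>1, 2, 3, \<dots>\<close> in increasing order of \<open>\<rho>\<close>. This allows terms that
  decay exponentially in a counting function to be summed without enumerating the points by modulus.\<close>

lemma sum_rank_le_1:
  fixes \<rho> :: "'k \<Rightarrow> real"
  assumes "finite J"
  shows "(\<Sum>j\<in>J. (1 / 2 :: real) ^ card {i \<in> J. \<rho> i \<le> \<rho> j}) \<le> 1 - (1 / 2) ^ card J"
  using assms
proof (induction rule: finite_ranking_induct[where f = \<rho>])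
  case (insert x S)
  show ?case
  proof (cases "x \<in> S")
    case True
    then show ?thesis using insert.IH by (simp add: insert_absorb)
  next
    case False
    have eq: "{i \<in> insert x S. \<rho> i \<le> \<rho> x} = insert x S" using insert.hyps(2) by auto
    have "(\<Sum>j\<in>S. (1 / 2 :: real) ^ card {i \<in> insert x S. \<rho> i \<le> \<rho> j}) \<le>
        (\<Sum>j\<in>S. (1 / 2) ^ card {i \<in> S. \<rho> i \<le> \<rho> j})"
      using insert.hyps(1) by (intro sum_mono power_decreasing card_mono) auto
    then have "(\<Sum>j\<in>insert x S. (1 / 2 :: real) ^ card {i \<in> insert x S. \<rho> i \<le> \<rho> j}) \<le>
        (1 / 2) ^ card (insert x S) + (1 - (1 / 2) ^ card S)"
      unfolding sum.insert[OF insert.hyps(1) False] eq using insert.IH by linarith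
    then show ?thesis using insert.hyps(1) False by simp
  qed
qed simp

text \<open>What the bound on \<open>N\<close> provides, in a form that is uniform in finite sets of points: few points in discs
  around the origin (\<open>count\<close>), little accumulation around each \<open>\<zeta> j\<close> on the scale \<open>tau (\<zeta> j)\<close>
  (\<open>clustering\<close>), and a multiplicity that is small even against \<open>ln (tau (\<zeta> j))\<close> (\<open>m_ln_le\<close>). The last
  condition is needed because jets are prescribed in the unit scale, not in the scale \<open>tau (\<zeta> j)\<close>.\<close>

locale spread_points = regular_growth Q \<delta> D for Q :: "real \<Rightarrow> real" and \<delta> D :: real +
  fixes \<zeta> :: "nat \<Rightarrow> complex" and m :: "nat \<Rightarrow> nat" and C0 :: real
  assumes inj_\<zeta>: "inj \<zeta>" and m_pos: "0 < m j"
    and C0: "0 \<le> C0"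
    and count: "finite J \<Longrightarrow> 1 \<le> R \<Longrightarrow> (\<Sum>k | k \<in> J \<and> tau (\<zeta> k) \<le> R. real (m k)) \<le> C0 * Q R"
    and clustering: "finite J \<Longrightarrow> j \<notin> J \<Longrightarrow> (\<And>k. k \<in> J \<Longrightarrow> cmod (\<zeta> k - \<zeta> j) \<le> tau (\<zeta> j)) \<Longrightarrow>
      (\<Sum>k\<in>J. real (m k) * ln (tau (\<zeta> j) / cmod (\<zeta> k - \<zeta> j))) \<le> C0 * Q (tau (\<zeta> j))"
    and m_ln_le: "real (m j) * ln (tau (\<zeta> j)) \<le> C0 * Q (tau (\<zeta> j))"
begin

abbreviation \<rho> :: "nat \<Rightarrow> real" where "\<rho> j \<equiv> tau (\<zeta> j)"

abbreviation near :: "nat set \<Rightarrow> nat \<Rightarrow> nat set" where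
  "near J j \<equiv> {k \<in> J. k \<noteq> j \<and> \<rho> k \<le> 4 * \<rho> j}"

abbreviation far :: "nat set \<Rightarrow> nat \<Rightarrow> nat set" where
  "far J j \<equiv> {k \<in> J. 4 * \<rho> j < \<rho> k}"

definition near_prod :: "nat set \<Rightarrow> nat \<Rightarrow> complex \<Rightarrow> complex" where
  "near_prod J j z = (\<Prod>k\<in>near J j. ((z - \<zeta> k) / of_real (\<rho> j)) ^ m k)"

definition far_prod :: "nat \<Rightarrow> nat set \<Rightarrow> nat \<Rightarrow> complex \<Rightarrow> complex" where
  "far_prod L J j z = (\<Prod>k\<in>far J j. (1 - (z / \<zeta> k) ^ L) ^ m k)"

definition log_const :: real where "log_const = ln 5 + 1 / \<delta>"

lemma log_const_nonneg: "0 \<le> log_const" using \<delta>_pos by (simp add: log_const_def)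

lemma Q_log_le': "Q (\<rho> j) * ln (4 + tau z / \<rho> j) \<le> log_const * (Q (\<rho> j) + Q (tau z))"
  unfolding log_const_def by (rule Q_log_le) auto

lemma Q_pos [simp]: "0 < Q (tau z)" using Q_ge_1[of "tau z"] by simp

lemma Q_nonneg [simp]: "0 \<le> Q (tau z)" by (simp add: less_imp_le)

lemma m_le: "real (m j) \<le> C0 * Q (\<rho> j)"
proof -
  have "{k. k \<in> {j} \<and> \<rho> k \<le> \<rho> j} = {j}" by auto
  then show ?thesis using count[of "{j}" "\<rho> j"] by simp
qed

text \<open>A point of high multiplicity cannot be close to any other point. This uses the condition at the other
  point \<open>\<zeta> k\<close>, in whose clustering sum \<open>m j\<close> appears.\<close>

lemma m_ln_dist_le:
  assumes "k \<noteq> j"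
  shows "real (m j) * ln (\<rho> j / cmod (\<zeta> k - \<zeta> j)) \<le> C0 * (1 + D) * Q (\<rho> j)"
proof -
  define d where "d = cmod (\<zeta> k - \<zeta> j)"
  have d: "0 < d" using assms inj_\<zeta> by (auto simp: d_def inj_eq)
  have m1: "real (m j) * ln 2 \<le> C0 * Q (\<rho> j)"
    using m_le[of j] ln_2_less_1 mult_left_mono[of "ln 2" 1 "real (m j)"] by simp
  have D0: "0 \<le> C0 * (D * Q (\<rho> j))" using C0 D_ge_1 by (intro mult_nonneg_nonneg) auto
  show ?thesis
  proof (cases "\<rho> j / 2 \<le> d")
    case True
    then have "ln (\<rho> j / d) \<le> ln 2" using d by (subst ln_le_cancel_iff) (auto simp: field_simps)
    then have "real (m j) * ln (\<rho> j / d) \<le> real (m j) * ln 2" by (intro mult_left_mono) auto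
    then show ?thesis using m1 D0 by (simp add: d_def algebra_simps)
  next
    case False
    have t: "\<rho> k \<le> 2 * \<rho> j" "\<rho> j / 2 \<le> \<rho> k"
      using False norm_triangle_ineq2[of "\<zeta> k" "\<zeta> j"] norm_triangle_ineq3[of "\<zeta> k" "\<zeta> j"]
      unfolding d_def tau_def by auto
    have "ln (\<rho> j / d) \<le> ln (2 * (\<rho> k / d))"
      using d t by (subst ln_le_cancel_iff) (auto simp: field_simps)
    also have "\<dots> = ln 2 + ln (\<rho> k / d)" using d by (subst ln_mult_pos) auto
    finally have "real (m j) * ln (\<rho> j / d) \<le> real (m j) * (ln 2 + ln (\<rho> k / d))"
      by (intro mult_left_mono) auto
    also have "real (m j) * (ln 2 + ln (\<rho> k / d)) \<le> C0 * Q (\<rho> j) + real (m j) * ln (\<rho> k / d)"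
      using m1 by (simp add: algebra_simps)
    also have "real (m j) * ln (\<rho> k / d) \<le> C0 * Q (\<rho> k)"
      using clustering[of "{j}" k] assms False t by (auto simp: d_def norm_minus_commute)
    also have "\<dots> \<le> C0 * (D * Q (\<rho> j))"
      using C0 t Q_mono[of "\<rho> k" "2 * \<rho> j"] doubling[of "\<rho> j"] by (intro mult_left_mono) auto
    finally show ?thesis by (simp add: d_def algebra_simps)
  qed
qed

lemma sum_near_le:
  assumes "finite J"
  shows "(\<Sum>k\<in>near J j. real (m k)) \<le> C0 * D\<^sup>2 * Q (\<rho> j)"
proof -
  have "1 \<le> 4 * \<rho> j" using tau_ge_1[of "\<zeta> j"] by linarith
  have "(\<Sum>k\<in>near J j. real (m k)) \<le> (\<Sum>k | k \<in> J \<and> \<rho> k \<le> 4 * \<rho> j. real (m k))"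
    using assms by (intro sum_mono2) auto
  also have "\<dots> \<le> C0 * Q (4 * \<rho> j)" using assms \<open>1 \<le> 4 * \<rho> j\<close> by (rule count)
  also have "\<dots> \<le> C0 * (D\<^sup>2 * Q (\<rho> j))"
    using C0 doubling_power[of "\<rho> j" 2] by (intro mult_left_mono) auto
  finally show ?thesis by simp
qed

lemma near_prod_le:
  assumes J: "finite J"
  shows "cmod (near_prod J j z) \<le> exp (C0 * D\<^sup>2 * log_const * (Q (\<rho> j) + Q (tau z)))"
proof -
  have x: "0 \<le> tau z / \<rho> j" by (simp add: less_imp_le)
  have "cmod (near_prod J j z) \<le> exp (\<Sum>k\<in>near J j. real (m k) * ln (4 + tau z / \<rho> j))"
    unfolding near_prod_def
  proof (rule norm_prod_power_le_exp)
    fix k assume k: "k \<in> near J j"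
    have "cmod (z - \<zeta> k) \<le> tau z + 4 * \<rho> j"
      using k norm_triangle_ineq4[of z "\<zeta> k"] by (auto simp: tau_def)
    then have "cmod ((z - \<zeta> k) / of_real (\<rho> j)) \<le> (tau z + 4 * \<rho> j) / \<rho> j"
      by (simp add: norm_divide divide_right_mono less_imp_le)
    also have "\<dots> = 4 + tau z / \<rho> j" by (simp add: add_divide_distrib less_imp_neq[symmetric])
    finally show "cmod ((z - \<zeta> k) / of_real (\<rho> j)) \<le> exp (ln (4 + tau z / \<rho> j))"
      using x by (subst exp_ln) linarith+
  qed
  also have "(\<Sum>k\<in>near J j. real (m k) * ln (4 + tau z / \<rho> j)) =
      (\<Sum>k\<in>near J j. real (m k)) * ln (4 + tau z / \<rho> j)"
    by (simp add: sum_distrib_right)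
  also have "exp \<dots> \<le> exp (C0 * D\<^sup>2 * Q (\<rho> j) * ln (4 + tau z / \<rho> j))"
    using sum_near_le[OF J, of j] x by (simp add: mult_right_mono)
  also have "C0 * D\<^sup>2 * Q (\<rho> j) * ln (4 + tau z / \<rho> j) \<le> C0 * D\<^sup>2 * (log_const * (Q (\<rho> j) + Q (tau z)))"
    unfolding mult.assoc[of "C0 * D\<^sup>2"] using C0 by (intro mult_left_mono Q_log_le') auto
  finally show ?thesis by (simp add: mult.assoc)
qed

lemma far_norm_ge:
  assumes "k \<in> far J j"
  shows "3 / 4 * \<rho> k \<le> cmod (\<zeta> k)" "0 < cmod (\<zeta> k)"
proof -
  have "4 \<le> 4 * \<rho> j" "4 * \<rho> j < \<rho> k" "\<rho> k = 1 + cmod (\<zeta> k)"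
    using assms tau_ge_1[of "\<zeta> j"] by (auto simp: tau_def)
  then show "3 / 4 * \<rho> k \<le> cmod (\<zeta> k)" "0 < cmod (\<zeta> k)" by linarith+
qed

text \<open>The inequality \<open>\<bar>1 - (z / \<zeta> k) ^ L\<bar> \<le> 1 + (2 tau z / \<rho> k) ^ L\<close> holds since \<open>\<rho> k > 4\<close>
  forces \<open>\<rho> k \<le> 2 * \<bar>\<zeta> k\<bar>\<close>; then \<open>log_sum_le\<close> applies.\<close>

lemma far_prod_le:
  assumes L: "2 * D \<le> 2 ^ L"
  obtains K where "0 < K" "\<And>J j z. finite J \<Longrightarrow> cmod (far_prod L J j z) \<le> exp (K * Q (tau z))"
proof -
  obtain K where K: "0 < K" "\<And>(J :: nat set) r. finite J \<Longrightarrow> (\<And>k. k \<in> J \<Longrightarrow> 1 \<le> \<rho> k) \<Longrightarrow>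
      (\<And>R. 1 \<le> R \<Longrightarrow> (\<Sum>k | k \<in> J \<and> \<rho> k \<le> R. real (m k)) \<le> C0 * Q R) \<Longrightarrow> 1 \<le> r \<Longrightarrow>
      (\<Sum>k\<in>J. real (m k) * ln (1 + (r / \<rho> k) ^ L)) \<le> K * Q r"
    using log_sum_le[OF L C0, of \<rho> m] by blast
  show ?thesis
  proof (rule that[of "K * D"])
    show "0 < K * D" using K(1) D_ge_1 by simp
    fix J :: "nat set" and j z assume J: "finite J"
    have r: "1 \<le> 2 * tau z" using tau_ge_1[of z] by linarith
    have "cmod (far_prod L J j z) \<le> exp (\<Sum>k\<in>far J j. real (m k) * ln (1 + (2 * tau z / \<rho> k) ^ L))"
      unfolding far_prod_def
    proof (rule norm_prod_power_le_exp)
      fix k assume k: "k \<in> far J j"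
      have "cmod (z / \<zeta> k) \<le> tau z / (\<rho> k / 2)"
        unfolding norm_divide using far_norm_ge[OF k] tau_pos[of "\<zeta> k"] by (intro frac_le) (auto simp: tau_def)
      then have "cmod (z / \<zeta> k) \<le> 2 * tau z / \<rho> k" by (simp add: mult.commute)
      then have "cmod (z / \<zeta> k) ^ L \<le> (2 * tau z / \<rho> k) ^ L" by (intro power_mono) auto
      moreover have "cmod (1 - (z / \<zeta> k) ^ L) \<le> 1 + cmod (z / \<zeta> k) ^ L"
        using norm_triangle_ineq4[of 1 "(z / \<zeta> k) ^ L"] by (simp add: norm_power)
      moreover have "0 < 1 + (2 * tau z / \<rho> k) ^ L" by (intro add_pos_nonneg) (auto simp: less_imp_le)
      ultimately show "cmod (1 - (z / \<zeta> k) ^ L) \<le> exp (ln (1 + (2 * tau z / \<rho> k) ^ L))" by simp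
    qed
    also have "(\<Sum>k\<in>far J j. real (m k) * ln (1 + (2 * tau z / \<rho> k) ^ L)) \<le> K * Q (2 * tau z)"
      using J r by (intro K(2) count) auto
    also have "\<dots> \<le> K * (D * Q (tau z))" using K(1) doubling[of "tau z"] by (intro mult_left_mono) auto
    finally show "cmod (far_prod L J j z) \<le> exp (K * D * Q (tau z))" by (simp add: mult.assoc)
  qed
qed

text \<open>On a disc around \<open>\<zeta> j\<close> that stays away from the other points by half their distance, each factor is at
  least half of its value at \<open>\<zeta> j\<close>. The values at the centre are what \<open>clustering\<close> bounds from below, and
  there are \<open>O(Q)\<close> factors to lose \<open>1 / 2\<close> in.\<close>

lemma near_prod_ge:
  assumes J: "finite J" and z: "cmod (z - \<zeta> j) \<le> s"
    and s: "\<And>k. k \<in> near J j \<Longrightarrow> s \<le> cmod (\<zeta> k - \<zeta> j) / 2"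
  shows "exp (- ((C0 * D\<^sup>2 + C0) * Q (\<rho> j))) \<le> cmod (near_prod J j z)"
proof -
  define d where "d k = cmod (\<zeta> k - \<zeta> j)" for k
  have d: "0 < d k" if "k \<in> near J j" for k using that inj_\<zeta> by (auto simp: d_def inj_eq)
  define b where "b k = - (ln 2 + (if d k \<le> \<rho> j then ln (\<rho> j / d k) else 0))" for k
  have "(\<Sum>k\<in>near J j. real (m k) * - b k) =
      (\<Sum>k\<in>near J j. real (m k) * ln 2) + (\<Sum>k\<in>near J j. if d k \<le> \<rho> j then real (m k) * ln (\<rho> j / d k) else 0)"
    unfolding sum.distrib[symmetric] by (intro sum.cong) (auto simp: b_def algebra_simps)
  also have "(\<Sum>k\<in>near J j. real (m k) * ln 2) \<le> (\<Sum>k\<in>near J j. real (m k) * 1)"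
    using ln_2_less_1 by (intro sum_mono mult_left_mono) auto
  also have "\<dots> \<le> C0 * D\<^sup>2 * Q (\<rho> j)" using sum_near_le[OF J] by simp
  also have "(\<Sum>k\<in>near J j. if d k \<le> \<rho> j then real (m k) * ln (\<rho> j / d k) else 0) =
      (\<Sum>k | k \<in> near J j \<and> d k \<le> \<rho> j. real (m k) * ln (\<rho> j / d k))"
    using J by (intro sum.inter_filter[symmetric]) auto
  also have "\<dots> \<le> C0 * Q (\<rho> j)"
    unfolding d_def using J by (intro clustering) auto
  finally have "(\<Sum>k\<in>near J j. real (m k) * - b k) \<le> (C0 * D\<^sup>2 + C0) * Q (\<rho> j)"
    by (simp add: algebra_simps)
  then have "- ((C0 * D\<^sup>2 + C0) * Q (\<rho> j)) \<le> (\<Sum>k\<in>near J j. real (m k) * b k)"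
    by (simp add: sum_negf)
  then have "exp (- ((C0 * D\<^sup>2 + C0) * Q (\<rho> j))) \<le> exp (\<Sum>k\<in>near J j. real (m k) * b k)" by simp
  also have "\<dots> \<le> cmod (near_prod J j z)"
    unfolding near_prod_def
  proof (rule norm_prod_power_ge_exp)
    fix k assume k: "k \<in> near J j"
    have "d k - cmod (z - \<zeta> j) \<le> cmod (z - \<zeta> k)"
      using norm_triangle_ineq2[of "\<zeta> k - \<zeta> j" "z - \<zeta> j"] by (simp add: d_def norm_minus_commute)
    then have "d k / 2 \<le> cmod (z - \<zeta> k)" using z s[OF k] by (simp add: d_def)
    then have "d k / 2 / \<rho> j \<le> cmod (z - \<zeta> k) / \<rho> j" by (rule divide_right_mono) simp
    then have low: "d k / 2 / \<rho> j \<le> cmod ((z - \<zeta> k) / of_real (\<rho> j))"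
      by (simp add: norm_divide)
    have "exp (b k) \<le> d k / 2 / \<rho> j"
    proof (cases "d k \<le> \<rho> j")
      case True
      then have "b k = - ln (2 * (\<rho> j / d k))" using d[OF k] by (subst ln_mult_pos) (auto simp: b_def)
      then show ?thesis using d[OF k] by (simp add: exp_minus)
    next
      case False
      then show ?thesis by (simp add: b_def exp_minus field_simps)
    qed
    then show "exp (b k) \<le> cmod ((z - \<zeta> k) / of_real (\<rho> j))" using low by linarith
  qed
  finally show ?thesis .
qed

lemma far_prod_ge:
  assumes L: "2 * D \<le> 2 ^ L" and J: "finite J" and z: "cmod (z - \<zeta> j) \<le> \<rho> j / 4"
  shows "exp (- (4 * C0 * D\<^sup>2 * Q (\<rho> j))) \<le> cmod (far_prod L J j z)"
proof -
  have L0: "L \<noteq> 0" using L D_ge_1 by (cases L) auto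
  have r: "1 \<le> 2 * \<rho> j" using tau_ge_1[of "\<zeta> j"] by linarith
  let ?x = "\<lambda>k. (2 * \<rho> j / \<rho> k) ^ L"
  have "(\<Sum>k\<in>far J j. real (m k) * ?x k) \<le> (\<Sum>k | k \<in> J \<and> 2 * \<rho> j < \<rho> k. real (m k) * ?x k)"
    using J by (intro sum_mono2) (auto simp: less_imp_le intro: less_trans[rotated])
  also have "\<dots> \<le> 2 * C0 * D * Q (2 * \<rho> j)"
    using J count L r by (intro tail_sum_le) auto
  also have "\<dots> \<le> 2 * C0 * D * (D * Q (\<rho> j))"
    using C0 D_ge_1 doubling[of "\<rho> j"] by (intro mult_left_mono) auto
  finally have "- (4 * C0 * D\<^sup>2 * Q (\<rho> j)) \<le> - (2 * (\<Sum>k\<in>far J j. real (m k) * ?x k))"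
    by (simp add: power2_eq_square)
  also have "\<dots> = (\<Sum>k\<in>far J j. real (m k) * (- 2 * ?x k))"
    by (simp add: sum_distrib_left sum_negf[symmetric] algebra_simps)
  finally have "exp (- (4 * C0 * D\<^sup>2 * Q (\<rho> j))) \<le> exp (\<Sum>k\<in>far J j. real (m k) * (- 2 * ?x k))"
    by simp
  also have "\<dots> \<le> cmod (far_prod L J j z)"
    unfolding far_prod_def
  proof (rule norm_prod_power_ge_exp)
    fix k assume k: "k \<in> far J j"
    have "cmod z \<le> 5 / 4 * \<rho> j"
      using z norm_triangle_ineq2[of z "\<zeta> j"] by (simp add: tau_def)
    then have "cmod (z / \<zeta> k) \<le> (5 / 4 * \<rho> j) / (3 / 4 * \<rho> k)"
      unfolding norm_divide using far_norm_ge[OF k] by (intro frac_le) auto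
    also have "\<dots> = (5 / 3) * (\<rho> j / \<rho> k)" by simp
    also have "\<dots> \<le> 2 * (\<rho> j / \<rho> k)" by (intro mult_right_mono) auto
    finally have u: "cmod (z / \<zeta> k) \<le> 2 * \<rho> j / \<rho> k" by simp
    then have uL: "cmod (z / \<zeta> k) ^ L \<le> ?x k" by (intro power_mono) auto
    have h: "2 * \<rho> j / \<rho> k \<le> 1 / 2" using k by (auto simp: field_simps)
    have "?x k \<le> (1 / 2) ^ L" using h by (intro power_mono) (auto simp: less_imp_le)
    also have "(1 / 2) ^ L \<le> (1 / 2 :: real) ^ 1" using L0 by (intro power_decreasing) auto
    finally have "exp (- 2 * ?x k) \<le> 1 - ?x k"
      by (intro exp_minus_double_le) (auto simp: less_imp_le)
    also have "\<dots> \<le> 1 - cmod (z / \<zeta> k) ^ L" using uL by simp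
    also have "\<dots> \<le> cmod (1 - (z / \<zeta> k) ^ L)"
      using norm_triangle_ineq2[of 1 "(z / \<zeta> k) ^ L"] by (simp add: norm_power)
    finally show "exp (- 2 * ?x k) \<le> cmod (1 - (z / \<zeta> k) ^ L)" .
  qed
  finally show ?thesis .
qed

end

section \<open>Interpolation of jets\<close>

context spread_points begin

text \<open>The case distinction avoids division by a tiny or vanishing \<open>\<zeta> j\<close>. Decay is only required at points with
  \<open>16 * tau z < \<rho> j\<close>, and there are none unless \<open>\<zeta> j\<close> is large.\<close>

definition peak :: "nat \<Rightarrow> nat \<Rightarrow> complex \<Rightarrow> complex" where
  "peak N j z = (if 1 \<le> cmod (\<zeta> j) then (z / \<zeta> j) ^ N else 1)"

lemma holomorphic_peak: "peak N j holomorphic_on S"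
  unfolding peak_def by (cases "1 \<le> cmod (\<zeta> j)") (auto intro!: holomorphic_intros)

lemma peak_ge:
  assumes "cmod (z - \<zeta> j) \<le> \<rho> j / 4"
  shows "(1 / 2) ^ N \<le> cmod (peak N j z)"
proof (cases "1 \<le> cmod (\<zeta> j)")
  case True
  have "cmod (\<zeta> j) \<le> cmod z + cmod (z - \<zeta> j)"
    using norm_triangle_sub[of "\<zeta> j" z] by (simp add: norm_minus_commute)
  then have "1 / 2 * cmod (\<zeta> j) \<le> cmod z" using assms True by (simp add: tau_def)
  moreover have "0 < cmod (\<zeta> j)" using True by linarith
  ultimately have "1 / 2 \<le> cmod (z / \<zeta> j)" by (simp add: norm_divide pos_le_divide_eq)
  then show ?thesis using True by (auto simp: peak_def norm_power intro: power_mono)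
qed (simp add: peak_def power_le_one)

lemma norm_ratio_le:
  assumes "1 \<le> cmod (\<zeta> j)"
  shows "cmod (z / \<zeta> j) \<le> 2 * (tau z / \<rho> j)"
proof -
  have "cmod (z / \<zeta> j) \<le> tau z / (\<rho> j / 2)"
    unfolding norm_divide using assms tau_pos[of "\<zeta> j"] by (intro frac_le) (auto simp: tau_def)
  then show ?thesis by (simp add: mult.commute)
qed

lemma peak_le: "cmod (peak N j z) \<le> (4 + tau z / \<rho> j) ^ (2 * N)"
proof -
  define x where "x = tau z / \<rho> j"
  have x: "0 \<le> x" by (simp add: x_def)
  show ?thesis
  proof (cases "1 \<le> cmod (\<zeta> j)")
    case True
    have "cmod (z / \<zeta> j) \<le> 2 * x" using norm_ratio_le[OF True] by (simp add: x_def)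
    also have "\<dots> \<le> (4 + x)\<^sup>2" using x by (simp add: power2_eq_square algebra_simps)
    finally have "cmod (z / \<zeta> j) ^ N \<le> ((4 + x)\<^sup>2) ^ N" by (intro power_mono) auto
    then show ?thesis using True by (simp add: peak_def norm_power x_def power_mult)
  next
    case False
    have "1 \<le> (4 + x) ^ (2 * N)" using x by (intro one_le_power) simp
    then show ?thesis using False by (simp add: peak_def x_def)
  qed
qed

lemma peak_small:
  assumes "16 * tau z < \<rho> j"
  shows "cmod (peak N j z) \<le> (1 / 8) ^ N"
proof -
  have 1: "1 \<le> cmod (\<zeta> j)" using assms tau_ge_1[of z] unfolding tau_def[of "\<zeta> j"] by linarith
  have "2 * (tau z / \<rho> j) \<le> 1 / 8" using assms by (simp add: pos_divide_le_eq)
  then have "cmod (z / \<zeta> j) \<le> 1 / 8" using norm_ratio_le[OF 1, of z] by linarith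
  then have "cmod (z / \<zeta> j) ^ N \<le> (1 / 8) ^ N" by (intro power_mono) auto
  then show ?thesis using 1 by (simp add: peak_def norm_power)
qed

lemma product_bounds:
  assumes L: "2 * D \<le> 2 ^ L"
  obtains K where "0 < K"
    "\<And>J j z. finite J \<Longrightarrow>
      cmod (near_prod J j z * far_prod L J j z) \<le> exp (K * (Q (\<rho> j) + Q (tau z)))"
    "\<And>J j z s. finite J \<Longrightarrow> cmod (z - \<zeta> j) \<le> s \<Longrightarrow> s \<le> \<rho> j / 4 \<Longrightarrow>
      (\<And>k. k \<in> near J j \<Longrightarrow> s \<le> cmod (\<zeta> k - \<zeta> j) / 2) \<Longrightarrow>
      exp (- (K * Q (\<rho> j))) \<le> cmod (near_prod J j z * far_prod L J j z)"
proof -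
  obtain K1 where K1: "0 < K1" "\<And>J j z. finite J \<Longrightarrow> cmod (far_prod L J j z) \<le> exp (K1 * Q (tau z))"
    using far_prod_le[OF L] by blast
  define a where "a = C0 * D\<^sup>2 * log_const"
  define b where "b = C0 * D\<^sup>2 + C0 + 4 * C0 * D\<^sup>2"
  have ab: "0 \<le> a" "0 \<le> b" using C0 log_const_nonneg by (auto simp: a_def b_def)
  show ?thesis
  proof (rule that[of "a + b + K1"])
    show "0 < a + b + K1" using ab K1 by simp
    show "cmod (near_prod J j z * far_prod L J j z) \<le> exp ((a + b + K1) * (Q (\<rho> j) + Q (tau z)))"
      if J: "finite J" for J j z
    proof -
      have "cmod (near_prod J j z * far_prod L J j z) \<le> exp (a * (Q (\<rho> j) + Q (tau z))) * exp (K1 * Q (tau z))"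
        unfolding norm_mult a_def using near_prod_le[OF J] K1(2)[OF J] by (intro mult_mono) auto
      also have "\<dots> = exp (a * (Q (\<rho> j) + Q (tau z)) + K1 * Q (tau z))" by (simp add: exp_add)
      also have "a * (Q (\<rho> j) + Q (tau z)) + K1 * Q (tau z) \<le>
          a * (Q (\<rho> j) + Q (tau z)) + K1 * (Q (\<rho> j) + Q (tau z))"
        using K1(1) by (intro add_left_mono mult_left_mono) auto
      also have "\<dots> \<le> (a + b + K1) * (Q (\<rho> j) + Q (tau z))"
        using ab unfolding distrib_right[symmetric] by (intro mult_right_mono) (auto simp: add_nonneg_nonneg)
      finally show ?thesis by simp
    qed
    show "exp (- ((a + b + K1) * Q (\<rho> j))) \<le> cmod (near_prod J j z * far_prod L J j z)"
      if J: "finite J" and z: "cmod (z - \<zeta> j) \<le> s" and s: "s \<le> \<rho> j / 4"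
        "\<And>k. k \<in> near J j \<Longrightarrow> s \<le> cmod (\<zeta> k - \<zeta> j) / 2" for J j z s
    proof -
      have z4: "cmod (z - \<zeta> j) \<le> \<rho> j / 4" using z s by linarith
      have "b * Q (\<rho> j) \<le> (a + b + K1) * Q (\<rho> j)" using ab K1 by (intro mult_right_mono) auto
      then have "exp (- ((a + b + K1) * Q (\<rho> j))) \<le> exp (- (b * Q (\<rho> j)))" by simp
      also have "\<dots> = exp (- ((C0 * D\<^sup>2 + C0) * Q (\<rho> j))) * exp (- (4 * C0 * D\<^sup>2 * Q (\<rho> j)))"
        by (simp add: b_def exp_add[symmetric] algebra_simps)
      also have "\<dots> \<le> cmod (near_prod J j z) * cmod (far_prod L J j z)"
        by (intro mult_mono near_prod_ge[OF J z s(2)] far_prod_ge[OF L J z4]) auto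
      finally show ?thesis by (simp add: norm_mult)
    qed
  qed
qed

text \<open>The radius is half the distance to the nearest other point, cut off at \<open>\<rho> j / 4\<close>. Not only \<open>s / \<rho> j\<close> but
  also its \<open>m j\<close>-th power, which enters the Cauchy estimates, is at least \<open>exp (- C Q)\<close>, by \<open>m_ln_dist_le\<close>.\<close>

lemma zero_free_radius:
  assumes J: "finite J"
  obtains s where "0 < s" "s \<le> \<rho> j / 4" "\<And>k. k \<in> near J j \<Longrightarrow> s \<le> cmod (\<zeta> k - \<zeta> j) / 2"
    "real (m j) * ln (\<rho> j / s) \<le> (2 * C0 + C0 * (1 + D)) * Q (\<rho> j)"
proof -
  define S where "S = insert (\<rho> j / 4) ((\<lambda>k. cmod (\<zeta> k - \<zeta> j) / 2) ` (J - {j}))"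
  define s where "s = Min S"
  have S: "finite S" "S \<noteq> {}" using J by (auto simp: S_def)
  have sS: "s \<in> S" unfolding s_def using S by (rule Min_in)
  have le: "s \<le> x" if "x \<in> S" for x unfolding s_def using S(1) that by (rule Min_le)
  have pos: "0 < x" if "x \<in> S" for x
    using that inj_\<zeta> tau_pos[of "\<zeta> j"] by (auto simp: S_def inj_eq simp del: tau_pos)
  have m2: "real (m j) * ln 2 \<le> C0 * Q (\<rho> j)"
    using m_le[of j] ln_2_less_1 mult_left_mono[of "ln 2" 1 "real (m j)"] by simp
  have DD: "0 \<le> C0 * (1 + D) * Q (\<rho> j)" using C0 D_ge_1 by simp
  show ?thesis
  proof (rule that[of s])
    show "0 < s" using sS pos by blast
    show "s \<le> \<rho> j / 4" by (rule le) (simp add: S_def)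
    show "s \<le> cmod (\<zeta> k - \<zeta> j) / 2" if "k \<in> near J j" for k
      using that by (intro le) (auto simp: S_def)
    consider "s = \<rho> j / 4" | k where "k \<noteq> j" "s = cmod (\<zeta> k - \<zeta> j) / 2"
      using sS unfolding S_def by blast
    then show "real (m j) * ln (\<rho> j / s) \<le> (2 * C0 + C0 * (1 + D)) * Q (\<rho> j)"
    proof cases
      case 1
      then have "\<rho> j / s = 2 ^ 2" using tau_pos[of "\<zeta> j"] by (simp add: field_simps del: tau_pos)
      then have "ln (\<rho> j / s) = 2 * ln 2" by (simp only: ln_realpow)
      then show ?thesis using m2 DD by (simp add: algebra_simps)
    next
      case 2
      then have "0 < cmod (\<zeta> k - \<zeta> j)" using inj_\<zeta> by (auto simp: inj_eq)
      moreover have "\<rho> j / s = 2 * (\<rho> j / cmod (\<zeta> k - \<zeta> j))" unfolding 2(2) by simp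
      ultimately have "ln (\<rho> j / s) = ln 2 + ln (\<rho> j / cmod (\<zeta> k - \<zeta> j))"
        by (simp only:) (subst ln_mult_pos, auto)
      then have "real (m j) * ln (\<rho> j / s) \<le> C0 * Q (\<rho> j) + C0 * (1 + D) * Q (\<rho> j)"
        using m2 m_ln_dist_le[OF 2(1)] by (simp add: distrib_left)
      moreover have "0 \<le> C0 * Q (\<rho> j)" using C0 by simp
      ultimately show ?thesis by (simp add: algebra_simps)
    qed
  qed
qed

text \<open>The bound of \<open>jet_correction\<close> with lower bound \<open>(1 / 2) ^ N * exp (- K Q)\<close> for \<open>E\<close>. The factor \<open>2 ^ N\<close>
  is kept separate, since \<open>N\<close> will be chosen after all the other constants.\<close>

lemma correction_factor_le:
  assumes s: "0 < s" "s \<le> \<rho> j / 4" "real (m j) * ln (\<rho> j / s) \<le> C1 * Q (\<rho> j)"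
    and C: "0 \<le> C1" "0 \<le> B" "0 \<le> K"
  shows "real (m j) * (exp (B * Q (\<rho> j)) * max 1 s ^ m j / ((1 / 2) ^ N * exp (- (K * Q (\<rho> j)))) *
      max 1 (cmod (z - \<zeta> j) / s) ^ m j)
    \<le> 2 ^ N * exp ((2 * C0 + B + K + C1 + C0 * log_const) * (Q (\<rho> j) + Q (tau z)))"
proof -
  define q where "q = Q (\<rho> j)"
  define x where "x = tau z / \<rho> j"
  have x: "0 \<le> x" by (simp add: x_def)
  have q: "0 \<le> q" by (simp add: q_def)
  have qt: "0 \<le> Q (tau z)" by simp
  have "real (m j) \<le> exp (real (m j))" using exp_ge_add_one_self[of "real (m j)"] by linarith
  also have "\<dots> \<le> exp (C0 * q)" using m_le[of j] by (simp add: q_def)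
  finally have 1: "real (m j) \<le> exp (C0 * q)" .
  have "max 1 s ^ m j \<le> \<rho> j ^ m j"
    using s tau_ge_1[of "\<zeta> j"] by (intro power_mono) auto
  also have "\<dots> = exp (real (m j) * ln (\<rho> j))" by (simp add: exp_of_nat_mult)
  also have "\<dots> \<le> exp (C0 * q)" using m_ln_le[of j] by (simp add: q_def)
  finally have 2: "max 1 s ^ m j \<le> exp (C0 * q)" .
  have rs: "1 \<le> \<rho> j / s" using s by (simp add: field_simps)
  have "cmod (z - \<zeta> j) \<le> tau z + \<rho> j"
    using norm_triangle_ineq4[of z "\<zeta> j"] by (simp add: tau_def)
  then have "cmod (z - \<zeta> j) / s \<le> (tau z + \<rho> j) / s" using s by (intro divide_right_mono) auto
  also have "\<dots> = (\<rho> j / s) * (1 + x)" using s by (simp add: x_def field_simps less_imp_neq[symmetric])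
  also have "\<dots> \<le> (\<rho> j / s) * (4 + x)" using rs by (intro mult_left_mono) auto
  finally have "cmod (z - \<zeta> j) / s \<le> (\<rho> j / s) * (4 + x)" .
  moreover have "1 * 1 \<le> (\<rho> j / s) * (4 + x)" using rs x by (intro mult_mono) auto
  ultimately have "max 1 (cmod (z - \<zeta> j) / s) ^ m j \<le> ((\<rho> j / s) * (4 + x)) ^ m j"
    by (intro power_mono) auto
  also have "\<dots> = exp (real (m j) * ln ((\<rho> j / s) * (4 + x)))"
    using s x by (simp add: exp_of_nat_mult add_pos_nonneg)
  also have "ln ((\<rho> j / s) * (4 + x)) = ln (\<rho> j / s) + ln (4 + x)"
    using s x by (subst ln_mult_pos) auto
  also have "real (m j) * (ln (\<rho> j / s) + ln (4 + x)) \<le> C1 * q + C0 * (log_const * (q + Q (tau z)))"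
  proof -
    have "real (m j) * ln (4 + x) \<le> C0 * q * ln (4 + x)"
      using m_le[of j] x by (intro mult_right_mono) (auto simp: q_def)
    also have "\<dots> \<le> C0 * (log_const * (q + Q (tau z)))"
      unfolding mult.assoc using C0 Q_log_le'[of j z] by (intro mult_left_mono) (auto simp: q_def x_def)
    finally show ?thesis using s(3) by (simp add: q_def distrib_left)
  qed
  finally have 3: "max 1 (cmod (z - \<zeta> j) / s) ^ m j \<le> exp (C1 * q + C0 * (log_const * (q + Q (tau z))))"
    by simp
  have "real (m j) * (exp (B * q) * max 1 s ^ m j / ((1 / 2) ^ N * exp (- (K * q))) * max 1 (cmod (z - \<zeta> j) / s) ^ m j)
    \<le> exp (C0 * q) * (exp (B * q) * exp (C0 * q) / ((1 / 2) ^ N * exp (- (K * q))) *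
        exp (C1 * q + C0 * (log_const * (q + Q (tau z)))))"
    using 1 2 3 by (intro mult_mono divide_right_mono) auto
  also have "\<dots> = 2 ^ N * exp (C0 * q + B * q + C0 * q + K * q + (C1 * q + C0 * (log_const * (q + Q (tau z)))))"
    unfolding exp_add exp_minus by (simp add: field_simps)
  also have "C0 * q + B * q + C0 * q + K * q + (C1 * q + C0 * (log_const * (q + Q (tau z)))) \<le>
      (2 * C0 + B + K + C1 + C0 * log_const) * (q + Q (tau z))"
    using C C0 q qt by (simp add: algebra_simps)
  finally show ?thesis by (simp add: q_def)
qed

text \<open>One summand of the interpolating function. The exponent \<open>N\<close> of the peak function is taken so large that
  its decay \<open>(1 / 8) ^ N\<close> beats the loss \<open>2 ^ N\<close> of the correction factor together with the growth
  \<open>exp (2 (C3 + K) Q)\<close> of everything else, and still leaves \<open>exp (- C0 Q)\<close>, which is summable over \<open>j\<close>.\<close>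

lemma jet_function:
  assumes B: "0 \<le> B"
  obtains C where "0 < C"
    "\<And>J j w. finite J \<Longrightarrow> j \<in> J \<Longrightarrow> (\<Sum>l<m j. cmod (w l)) \<le> exp (B * Q (\<rho> j)) \<Longrightarrow>
      \<exists>T. T holomorphic_on UNIV \<and> (\<forall>k\<in>J - {j}. vanishes_to_order (m k) T (\<zeta> k)) \<and>
        (\<forall>l<m j. (deriv ^^ l) T (\<zeta> j) / fact l = w l) \<and>
        (\<forall>z. \<rho> j \<le> 16 * tau z \<longrightarrow> cmod (T z) \<le> exp (C * Q (tau z))) \<and>
        (\<forall>z. 16 * tau z < \<rho> j \<longrightarrow> cmod (T z) \<le> exp (- (C0 * Q (\<rho> j))))"
proof -
  obtain L :: nat where L: "2 * D \<le> 2 ^ L" using real_arch_pow[of 2 "2 * D"] by (auto intro: less_imp_le)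
  obtain K where K: "0 < K"
    "\<And>J j z. finite J \<Longrightarrow>
      cmod (near_prod J j z * far_prod L J j z) \<le> exp (K * (Q (\<rho> j) + Q (tau z)))"
    "\<And>J j z s. finite J \<Longrightarrow> cmod (z - \<zeta> j) \<le> s \<Longrightarrow> s \<le> \<rho> j / 4 \<Longrightarrow>
      (\<And>k. k \<in> near J j \<Longrightarrow> s \<le> cmod (\<zeta> k - \<zeta> j) / 2) \<Longrightarrow>
      exp (- (K * Q (\<rho> j))) \<le> cmod (near_prod J j z * far_prod L J j z)"
    using product_bounds[OF L] by blast
  define C1 where "C1 = 2 * C0 + C0 * (1 + D)"
  define C3 where "C3 = 2 * C0 + B + K + C1 + C0 * log_const"
  define M where "M = 2 * (C3 + K) + C0"
  define C where "C = (C3 + K + 3 * (M + 1) * log_const) * (D ^ 4 + 1)"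
  have C1: "0 \<le> C1" using C0 D_ge_1 by (simp add: C1_def)
  have C3: "0 \<le> C3" using C0 C1 B K(1) log_const_nonneg by (simp add: C3_def)
  have M: "0 \<le> M" using C3 K(1) C0 by (simp add: M_def)
  have C: "0 < C" unfolding C_def using C3 K(1) M log_const_nonneg D_ge_1
    by (intro mult_pos_pos add_nonneg_pos add_pos_nonneg) auto
  show ?thesis
  proof (rule that[OF C])
    fix J :: "nat set" and j w
    assume J: "finite J" and j: "j \<in> J" and w: "(\<Sum>l<m j. cmod (w l)) \<le> exp (B * Q (\<rho> j))"
    obtain s where s: "0 < s" "s \<le> \<rho> j / 4" "\<And>k. k \<in> near J j \<Longrightarrow> s \<le> cmod (\<zeta> k - \<zeta> j) / 2"
      "real (m j) * ln (\<rho> j / s) \<le> C1 * Q (\<rho> j)"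
      unfolding C1_def using zero_free_radius[OF J, of j] by blast
    \<comment> \<open>The degree must be an integer; rounding up costs at most \<open>1 \<le> Q (\<rho> j)\<close>.\<close>
    define N where "N = nat \<lceil>M * Q (\<rho> j)\<rceil>"
    have N: "M * Q (\<rho> j) \<le> real N" "real N \<le> (M + 1) * Q (\<rho> j)"
    proof -
      show "M * Q (\<rho> j) \<le> real N" unfolding N_def by linarith
      have "real N \<le> M * Q (\<rho> j) + 1"
        unfolding N_def using M by (simp add: of_nat_nat)
      also have "\<dots> \<le> (M + 1) * Q (\<rho> j)" using Q_ge_1[of "\<rho> j"] by (simp add: algebra_simps)
      finally show "real N \<le> (M + 1) * Q (\<rho> j)" .
    qed
    define P where "P z = near_prod J j z * far_prod L J j z" for z
    define E where "E z = peak N j z * P z" for z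
    have holP: "P holomorphic_on S" for S
      unfolding P_def near_prod_def far_prod_def
      using far_norm_ge(2) by (intro holomorphic_intros) (auto simp: less_imp_neq[symmetric])
    have holE: "E holomorphic_on S" for S
      unfolding E_def by (intro holomorphic_intros holP holomorphic_peak)
    have low: "(1 / 2) ^ N * exp (- (K * Q (\<rho> j))) \<le> cmod (E z)" if "cmod (z - \<zeta> j) \<le> s" for z
    proof -
      have "cmod (E z) = cmod (peak N j z) * cmod (near_prod J j z * far_prod L J j z)"
        unfolding E_def P_def by (rule norm_mult)
      then show ?thesis
        using that s by (simp only:) (intro mult_mono peak_ge K(3)[OF J that s(2,3)], auto)
    qed
    obtain R where R: "R holomorphic_on UNIV"
      "\<And>l. l < m j \<Longrightarrow> (deriv ^^ l) (\<lambda>z. R z * E z) (\<zeta> j) / fact l = w l"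
      "\<And>z. cmod (R z) \<le> real (m j) * (exp (B * Q (\<rho> j)) * max 1 s ^ m j /
          ((1 / 2) ^ N * exp (- (K * Q (\<rho> j)))) * max 1 (cmod (z - \<zeta> j) / s) ^ m j)"
      using jet_correction[OF holE s(1) _ low w] by auto
    have R_le: "cmod (R z) \<le> 2 ^ N * exp (C3 * (Q (\<rho> j) + Q (tau z)))" for z
      using R(3)[of z] correction_factor_le[OF s(1,2,4) C1 B less_imp_le[OF K(1)], of N z]
      unfolding C3_def by linarith
    define T where "T z = R z * E z" for z
    have T_le: "cmod (T z) \<le> 2 ^ N * cmod (peak N j z) * exp ((C3 + K) * (Q (\<rho> j) + Q (tau z)))" for z
    proof -
      have "cmod (T z) = cmod (R z) * (cmod (peak N j z) * cmod (P z))"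
        by (simp add: T_def E_def norm_mult)
      also have "\<dots> \<le> (2 ^ N * exp (C3 * (Q (\<rho> j) + Q (tau z)))) *
          (cmod (peak N j z) * exp (K * (Q (\<rho> j) + Q (tau z))))"
        using R_le[of z] K(2)[OF J, of j z] unfolding P_def by (intro mult_mono) auto
      finally show ?thesis by (simp add: distrib_right exp_add mult_ac)
    qed
    show "\<exists>T. T holomorphic_on UNIV \<and> (\<forall>k\<in>J - {j}. vanishes_to_order (m k) T (\<zeta> k)) \<and>
        (\<forall>l<m j. (deriv ^^ l) T (\<zeta> j) / fact l = w l) \<and>
        (\<forall>z. \<rho> j \<le> 16 * tau z \<longrightarrow> cmod (T z) \<le> exp (C * Q (tau z))) \<and>
        (\<forall>z. 16 * tau z < \<rho> j \<longrightarrow> cmod (T z) \<le> exp (- (C0 * Q (\<rho> j))))"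
    proof (intro exI[of _ T] conjI allI impI ballI)
      show "T holomorphic_on UNIV" unfolding T_def by (intro holomorphic_intros R(1) holE)
      show "(deriv ^^ l) T (\<zeta> j) / fact l = w l" if "l < m j" for l
        using R(2)[OF that] by (simp add: T_def[abs_def])
      show "vanishes_to_order (m k) T (\<zeta> k)" if k: "k \<in> J - {j}" for k
      proof -
        have v: "vanishes_to_order (m k) (\<lambda>z. u z * (f z ^ m k)) (\<zeta> k)"
          if u: "u holomorphic_on UNIV" and f: "f holomorphic_on UNIV" "f (\<zeta> k) = 0" for u f
        proof -
          have "vanishes_to_order 1 f (\<zeta> k)" using f by (simp add: vanishes_to_order_def)
          then obtain h where h: "h holomorphic_on UNIV" "\<And>z. f z = (z - \<zeta> k) ^ 1 * h z"
            using vanishes_to_order_factor[OF f(1)] by blast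
          have "(\<lambda>z. u z * (f z ^ m k)) = (\<lambda>z. (z - \<zeta> k) ^ m k * (u z * h z ^ m k))"
            by (simp add: h(2) power_mult_distrib mult_ac)
          moreover have "vanishes_to_order (m k) (\<lambda>z. (z - \<zeta> k) ^ m k * (u z * h z ^ m k)) (\<zeta> k)"
            by (intro vanishes_to_order_power_mult holomorphic_intros u h(1))
          ultimately show ?thesis by simp
        qed
        consider "k \<in> near J j" | "k \<in> far J j" using k by force
        then show ?thesis
        proof cases
          case 1
          define u where "u z = R z * peak N j z * far_prod L J j z *
            (\<Prod>k\<in>near J j - {k}. ((z - \<zeta> k) / of_real (\<rho> j)) ^ m k)" for z
          have "near_prod J j z = ((z - \<zeta> k) / of_real (\<rho> j)) ^ m k *
              (\<Prod>k\<in>near J j - {k}. ((z - \<zeta> k) / of_real (\<rho> j)) ^ m k)" for z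
            unfolding near_prod_def using 1 J by (intro prod.remove) auto
          then have "T = (\<lambda>z. u z * ((z - \<zeta> k) / of_real (\<rho> j)) ^ m k)"
            by (auto simp: fun_eq_iff T_def E_def P_def u_def mult_ac)
          moreover have "u holomorphic_on UNIV"
            unfolding u_def far_prod_def using far_norm_ge(2)
            by (intro holomorphic_intros R(1) holomorphic_peak) (auto simp: less_imp_neq[symmetric])
          moreover have "(\<lambda>z. (z - \<zeta> k) / complex_of_real (\<rho> j)) holomorphic_on UNIV"
            by (intro holomorphic_intros) (auto simp: less_imp_neq[symmetric])
          ultimately show ?thesis using v[of u "\<lambda>z. (z - \<zeta> k) / of_real (\<rho> j)"] by simp
        next
          case 2
          define u where "u z = R z * peak N j z * near_prod J j z *
            (\<Prod>k\<in>far J j - {k}. (1 - (z / \<zeta> k) ^ L) ^ m k)" for z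
          have "far_prod L J j z = (1 - (z / \<zeta> k) ^ L) ^ m k *
              (\<Prod>k\<in>far J j - {k}. (1 - (z / \<zeta> k) ^ L) ^ m k)" for z
            unfolding far_prod_def using 2 J by (intro prod.remove) auto
          then have "T = (\<lambda>z. u z * (1 - (z / \<zeta> k) ^ L) ^ m k)"
            by (auto simp: fun_eq_iff T_def E_def P_def u_def mult_ac)
          moreover have "u holomorphic_on UNIV"
            unfolding u_def near_prod_def using far_norm_ge(2)
            by (intro holomorphic_intros R(1) holomorphic_peak) (auto simp: less_imp_neq[symmetric])
          moreover have "\<zeta> k \<noteq> 0" using far_norm_ge(2)[OF 2] by auto
          moreover have "(\<lambda>z. 1 - (z / \<zeta> k) ^ L) holomorphic_on UNIV"
            using \<open>\<zeta> k \<noteq> 0\<close> by (intro holomorphic_intros) auto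
          ultimately show ?thesis using v[of u "\<lambda>z. 1 - (z / \<zeta> k) ^ L"] by simp
        qed
      qed
      show "cmod (T z) \<le> exp (C * Q (tau z))" if z: "\<rho> j \<le> 16 * tau z" for z
      proof -
        define y where "y = 4 + tau z / \<rho> j"
        have y: "4 \<le> y" by (simp add: y_def)
        have t1: "1 \<le> 16 * tau z" using tau_ge_1[of z] by linarith
        have "Q (\<rho> j) \<le> Q (16 * tau z)" using z by (intro Q_mono) auto
        also have "\<dots> \<le> D ^ 4 * Q (tau z)" using doubling_power[of "tau z" 4] by simp
        finally have qD: "Q (\<rho> j) + Q (tau z) \<le> (D ^ 4 + 1) * Q (tau z)" by (simp add: algebra_simps)
        have "2 ^ N * cmod (peak N j z) \<le> y ^ N * y ^ (2 * N)"
          using y peak_le[of N j z] unfolding y_def[symmetric] by (intro mult_mono power_mono) auto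
        also have "\<dots> = y ^ (3 * N)" by (simp add: power_add[symmetric])
        also have "\<dots> = exp (3 * real N * ln y)" using y by (simp add: exp_of_nat_mult[of "3 * N", simplified])
        also have "3 * real N * ln y \<le> 3 * ((M + 1) * Q (\<rho> j)) * ln y"
          using N(2) y by (intro mult_right_mono mult_left_mono) auto
        also have "\<dots> = 3 * (M + 1) * (Q (\<rho> j) * ln y)" by simp
        also have "\<dots> \<le> 3 * (M + 1) * (log_const * (Q (\<rho> j) + Q (tau z)))"
          using M Q_log_le'[of j z] unfolding y_def by (intro mult_left_mono) auto
        finally have pk: "2 ^ N * cmod (peak N j z) \<le> exp (3 * (M + 1) * log_const * (Q (\<rho> j) + Q (tau z)))"
          by (simp add: mult.assoc)
        have "cmod (T z) \<le> exp (3 * (M + 1) * log_const * (Q (\<rho> j) + Q (tau z))) *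
            exp ((C3 + K) * (Q (\<rho> j) + Q (tau z)))"
          by (rule order_trans[OF T_le mult_right_mono[OF pk]]) simp
        also have "\<dots> = exp ((C3 + K + 3 * (M + 1) * log_const) * (Q (\<rho> j) + Q (tau z)))"
          by (simp add: exp_add[symmetric] algebra_simps)
        also have "(C3 + K + 3 * (M + 1) * log_const) * (Q (\<rho> j) + Q (tau z)) \<le> C * Q (tau z)"
          unfolding C_def mult.assoc[of _ "D ^ 4 + 1"] using C3 K(1) M log_const_nonneg
          by (intro mult_left_mono qD) auto
        finally show ?thesis by simp
      qed
      show "cmod (T z) \<le> exp (- (C0 * Q (\<rho> j)))" if z: "16 * tau z < \<rho> j" for z
      proof -
        have "tau z \<le> \<rho> j" using z tau_ge_1[of z] by linarith
        then have qq: "Q (tau z) \<le> Q (\<rho> j)" by (intro Q_mono) auto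
        have "2 ^ N * cmod (peak N j z) \<le> 2 ^ N * (1 / 8) ^ N"
          using peak_small[OF z] by (intro mult_left_mono) auto
        also have "\<dots> = (1 / 4) ^ N" by (simp add: power_mult_distrib[symmetric])
        also have "\<dots> \<le> exp (- 1) ^ N"
          using exp_le by (intro power_mono) (auto simp: exp_minus field_simps)
        also have "\<dots> = exp (- real N)" by (simp add: exp_of_nat_mult[symmetric])
        also have "\<dots> \<le> exp (- (M * Q (\<rho> j)))" using N(1) by simp
        finally have pk: "2 ^ N * cmod (peak N j z) \<le> exp (- (M * Q (\<rho> j)))" .
        have "cmod (T z) \<le> exp (- (M * Q (\<rho> j))) * exp ((C3 + K) * (Q (\<rho> j) + Q (tau z)))"
          by (rule order_trans[OF T_le mult_right_mono[OF pk]]) simp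
        also have "\<dots> \<le> exp (- (M * Q (\<rho> j))) * exp ((C3 + K) * (Q (\<rho> j) + Q (\<rho> j)))"
          using qq C3 K(1) by (intro mult_left_mono) (auto intro!: mult_left_mono)
        also have "\<dots> = exp (- (C0 * Q (\<rho> j)))"
          by (simp add: M_def exp_add[symmetric] algebra_simps)
        finally show ?thesis .
      qed
    qed
  qed
qed

text \<open>At a given \<open>z\<close>, the points with \<open>\<rho> j \<le> 16 * tau z\<close> are at most \<open>O(Q (tau z))\<close> many, and each contributes
  \<open>exp (O(Q (tau z)))\<close>. For the others, \<open>exp (- C0 Q (\<rho> j))\<close> is at most \<open>2\<close> to the minus the rank of \<open>\<rho> j\<close>, so
  that they contribute at most \<open>1\<close> in total. The constant is independent of \<open>J\<close>.\<close>

lemma finite_interpolation: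
  assumes B: "0 \<le> B"
  obtains C where "0 < C"
    "\<And>J w. finite J \<Longrightarrow> (\<And>j. j \<in> J \<Longrightarrow> (\<Sum>l<m j. cmod (w j l)) \<le> exp (B * Q (\<rho> j))) \<Longrightarrow>
      \<exists>f. f holomorphic_on UNIV \<and> (\<forall>j\<in>J. \<forall>l<m j. (deriv ^^ l) f (\<zeta> j) / fact l = w j l) \<and>
        (\<forall>z. cmod (f z) \<le> exp (C * Q (tau z)))"
proof -
  obtain C where C: "0 < C"
    "\<And>J j w. finite J \<Longrightarrow> j \<in> J \<Longrightarrow> (\<Sum>l<m j. cmod (w l)) \<le> exp (B * Q (\<rho> j)) \<Longrightarrow>
      \<exists>T. T holomorphic_on UNIV \<and> (\<forall>k\<in>J - {j}. vanishes_to_order (m k) T (\<zeta> k)) \<and>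
        (\<forall>l<m j. (deriv ^^ l) T (\<zeta> j) / fact l = w l) \<and>
        (\<forall>z. \<rho> j \<le> 16 * tau z \<longrightarrow> cmod (T z) \<le> exp (C * Q (tau z))) \<and>
        (\<forall>z. 16 * tau z < \<rho> j \<longrightarrow> cmod (T z) \<le> exp (- (C0 * Q (\<rho> j))))"
    using jet_function[OF B] by metis
  define C' where "C' = C0 * D ^ 4 + C + 1"
  have CD: "0 \<le> C0 * D ^ 4" using C0 D_ge_1 by simp
  show ?thesis
  proof (rule that[of C'])
    show "0 < C'" using CD C(1) by (simp add: C'_def)
    fix J :: "nat set" and w assume J: "finite J"
      and w: "\<And>j. j \<in> J \<Longrightarrow> (\<Sum>l<m j. cmod (w j l)) \<le> exp (B * Q (\<rho> j))"
    define good where "good j T \<longleftrightarrow> T holomorphic_on UNIV \<and>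
        (\<forall>k\<in>J - {j}. vanishes_to_order (m k) T (\<zeta> k)) \<and>
        (\<forall>l<m j. (deriv ^^ l) T (\<zeta> j) / fact l = w j l) \<and>
        (\<forall>z. \<rho> j \<le> 16 * tau z \<longrightarrow> cmod (T z) \<le> exp (C * Q (tau z))) \<and>
        (\<forall>z. 16 * tau z < \<rho> j \<longrightarrow> cmod (T z) \<le> exp (- (C0 * Q (\<rho> j))))" for j T
    have "\<forall>j\<in>J. \<exists>T. good j T"
      unfolding good_def using C(2)[OF J _ w] by blast
    then obtain T where good: "\<forall>j\<in>J. good j (T j)"
      using bchoice[of J good] by blast
    have T: "T j holomorphic_on UNIV"
      "\<And>k. k \<in> J - {j} \<Longrightarrow> vanishes_to_order (m k) (T j) (\<zeta> k)"
      "\<And>l. l < m j \<Longrightarrow> (deriv ^^ l) (T j) (\<zeta> j) / fact l = w j l"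
      "\<And>z. \<rho> j \<le> 16 * tau z \<Longrightarrow> cmod (T j z) \<le> exp (C * Q (tau z))"
      "\<And>z. 16 * tau z < \<rho> j \<Longrightarrow> cmod (T j z) \<le> exp (- (C0 * Q (\<rho> j)))"
      if "j \<in> J" for j
      using bspec[OF good that] unfolding good_def by auto
    define f where "f z = (\<Sum>j\<in>J. T j z)" for z
    show "\<exists>f. f holomorphic_on UNIV \<and> (\<forall>j\<in>J. \<forall>l<m j. (deriv ^^ l) f (\<zeta> j) / fact l = w j l) \<and>
        (\<forall>z. cmod (f z) \<le> exp (C' * Q (tau z)))"
    proof (intro exI[of _ f] conjI ballI allI impI)
      show "f holomorphic_on UNIV" unfolding f_def by (intro holomorphic_intros T(1))
      show "(deriv ^^ l) f (\<zeta> j) / fact l = w j l" if j: "j \<in> J" and l: "l < m j" for j l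
      proof -
        have "(deriv ^^ l) f (\<zeta> j) = (\<Sum>i\<in>J. (deriv ^^ l) (T i) (\<zeta> j))"
          unfolding f_def using T(1) by (intro deriv_funpow_sum) auto
        also have "\<dots> = (deriv ^^ l) (T j) (\<zeta> j) + (\<Sum>i\<in>J - {j}. (deriv ^^ l) (T i) (\<zeta> j))"
          using J j by (rule sum.remove)
        also have "(\<Sum>i\<in>J - {j}. (deriv ^^ l) (T i) (\<zeta> j)) = 0"
          using T(2)[of _ j] j l by (intro sum.neutral) (auto simp: vanishes_to_order_def)
        finally show ?thesis using T(3)[OF j l] by simp
      qed
      show "cmod (f z) \<le> exp (C' * Q (tau z))" for z
      proof -
        have t1: "1 \<le> 16 * tau z" using tau_ge_1[of z] by linarith
        define I where "I = {j \<in> J. \<rho> j \<le> 16 * tau z}"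
        have I: "finite I" "I \<subseteq> J" using J by (auto simp: I_def)
        have "cmod (f z) \<le> (\<Sum>j\<in>J. cmod (T j z))" unfolding f_def by (rule norm_sum)
        also have "\<dots> = (\<Sum>j\<in>J - I. cmod (T j z)) + (\<Sum>j\<in>I. cmod (T j z))"
          using J I by (intro sum.subset_diff) auto
        also have "(\<Sum>j\<in>I. cmod (T j z)) \<le> (\<Sum>j\<in>I. exp (C * Q (tau z)))"
          using T(4) by (intro sum_mono) (auto simp: I_def)
        also have "\<dots> = real (card I) * exp (C * Q (tau z))" by simp
        also have "real (card I) \<le> exp (C0 * D ^ 4 * Q (tau z))"
        proof -
          have "real (card I) = (\<Sum>k\<in>I. 1)" by simp
          also have "\<dots> \<le> (\<Sum>k\<in>I. real (m k))" using m_pos by (intro sum_mono) (simp add: Suc_le_eq)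
          also have "\<dots> \<le> C0 * Q (16 * tau z)" using count[OF J t1] by (simp add: I_def)
          also have "\<dots> \<le> C0 * (D ^ 4 * Q (tau z))"
            using doubling_power[of "tau z" 4] C0 by (intro mult_left_mono) auto
          also have "\<dots> \<le> exp (C0 * D ^ 4 * Q (tau z))"
            using exp_ge_add_one_self[of "C0 * (D ^ 4 * Q (tau z))"] unfolding mult.assoc by linarith
          finally show ?thesis .
        qed
        also have "(\<Sum>j\<in>J - I. cmod (T j z)) \<le> (\<Sum>j\<in>J - I. (1 / 2) ^ card {i \<in> J. \<rho> i \<le> \<rho> j})"
        proof (rule sum_mono)
          fix j assume j: "j \<in> J - I"
          have "real (card {i \<in> J. \<rho> i \<le> \<rho> j}) = (\<Sum>k\<in>{i \<in> J. \<rho> i \<le> \<rho> j}. 1)" by simp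
          also have "\<dots> \<le> (\<Sum>k\<in>{i \<in> J. \<rho> i \<le> \<rho> j}. real (m k))"
            using m_pos by (intro sum_mono) (simp add: Suc_le_eq)
          also have "\<dots> \<le> C0 * Q (\<rho> j)" using count[OF J, of "\<rho> j"] by simp
          finally have c: "real (card {i \<in> J. \<rho> i \<le> \<rho> j}) \<le> C0 * Q (\<rho> j)" .
          have "cmod (T j z) \<le> exp (- (C0 * Q (\<rho> j)))" using j by (intro T(5)) (auto simp: I_def)
          also have "\<dots> \<le> exp (- real (card {i \<in> J. \<rho> i \<le> \<rho> j}))" using c by simp
          also have "\<dots> = exp (- 1) ^ card {i \<in> J. \<rho> i \<le> \<rho> j}"
            by (simp add: exp_of_nat_mult[symmetric])
          also have "\<dots> \<le> (1 / 2) ^ card {i \<in> J. \<rho> i \<le> \<rho> j}"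
            using exp_ge_add_one_self[of 1] by (intro power_mono) (auto simp: exp_minus field_simps)
          finally show "cmod (T j z) \<le> (1 / 2) ^ card {i \<in> J. \<rho> i \<le> \<rho> j}" .
        qed
        also have "\<dots> \<le> (\<Sum>j\<in>J. (1 / 2) ^ card {i \<in> J. \<rho> i \<le> \<rho> j})"
          using J by (intro sum_mono2) auto
        also have "\<dots> \<le> 1 - (1 / 2) ^ card J" using J by (rule sum_rank_le_1)
        also have "\<dots> \<le> 1" by simp
        finally have "cmod (f z) \<le> 1 + exp (C0 * D ^ 4 * Q (tau z)) * exp (C * Q (tau z))"
          by simp
        also have "\<dots> = 1 + exp ((C0 * D ^ 4 + C) * Q (tau z))" by (simp add: exp_add[symmetric] algebra_simps)
        also have "\<dots> \<le> 2 * exp ((C0 * D ^ 4 + C) * Q (tau z))"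
          using CD C(1) by (simp add: add_nonneg_nonneg)
        also have "\<dots> \<le> exp (Q (tau z)) * exp ((C0 * D ^ 4 + C) * Q (tau z))"
        proof (rule mult_right_mono)
          show "2 \<le> exp (Q (tau z))"
            using exp_ge_add_one_self[of "Q (tau z)"] Q_ge_1[of "tau z"] tau_ge_1[of z] by linarith
        qed simp
        also have "\<dots> = exp (C' * Q (tau z))" by (simp add: C'_def exp_add[symmetric] algebra_simps)
        finally show ?thesis .
      qed
    qed
  qed
qed

text \<open>The functions that interpolate at the first \<open>n\<close> points are locally bounded uniformly in \<open>n\<close>. A locally
  uniform limit exists by Montel's theorem, and keeps both the jets and the bound.\<close>

theorem interpolation_sequence:
  assumes B: "0 \<le> B" and w: "\<And>j. (\<Sum>l<m j. cmod (w j l)) \<le> exp (B * Q (\<rho> j))"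
  obtains f C where "f holomorphic_on UNIV" "0 < C" "\<And>z. cmod (f z) \<le> exp (C * Q (tau z))"
    "\<And>j l. l < m j \<Longrightarrow> (deriv ^^ l) f (\<zeta> j) / fact l = w j l"
proof -
  obtain C where C: "0 < C"
    "\<And>J w. finite J \<Longrightarrow> (\<And>j. j \<in> J \<Longrightarrow> (\<Sum>l<m j. cmod (w j l)) \<le> exp (B * Q (\<rho> j))) \<Longrightarrow>
      \<exists>f. f holomorphic_on UNIV \<and> (\<forall>j\<in>J. \<forall>l<m j. (deriv ^^ l) f (\<zeta> j) / fact l = w j l) \<and>
        (\<forall>z. cmod (f z) \<le> exp (C * Q (tau z)))"
    using finite_interpolation[OF B] by metis
  have "\<forall>n. \<exists>f. f holomorphic_on UNIV \<and> (\<forall>j<n. \<forall>l<m j. (deriv ^^ l) f (\<zeta> j) / fact l = w j l) \<and>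
        (\<forall>z. cmod (f z) \<le> exp (C * Q (tau z)))"
  proof
    fix n :: nat
    show "\<exists>f. f holomorphic_on UNIV \<and> (\<forall>j<n. \<forall>l<m j. (deriv ^^ l) f (\<zeta> j) / fact l = w j l) \<and>
        (\<forall>z. cmod (f z) \<le> exp (C * Q (tau z)))"
      using C(2)[OF finite_lessThan w, of n] unfolding Ball_def lessThan_iff by blast
  qed
  then obtain F where F: "\<And>n. F n holomorphic_on UNIV"
    "\<And>n j l. j < n \<Longrightarrow> l < m j \<Longrightarrow> (deriv ^^ l) (F n) (\<zeta> j) / fact l = w j l"
    "\<And>n z. cmod (F n z) \<le> exp (C * Q (tau z))"
    by metis
  obtain g r where g: "g holomorphic_on UNIV" "strict_mono (r :: nat \<Rightarrow> nat)"
    "\<And>x. x \<in> UNIV \<Longrightarrow> ((\<lambda>n. F (r n) x) \<longlongrightarrow> g x) sequentially"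
    "\<And>K. compact K \<Longrightarrow> K \<subseteq> UNIV \<Longrightarrow> uniform_limit K (F \<circ> r) g sequentially"
  proof (rule Montel[of UNIV "range F" F])
    show "\<exists>b. \<forall>h\<in>range F. \<forall>z\<in>K. cmod (h z) \<le> b" if K: "compact K" for K
    proof -
      obtain b where b: "\<And>z. z \<in> K \<Longrightarrow> cmod z \<le> b"
        using compact_imp_bounded[OF K] by (auto simp: bounded_iff)
      have "cmod (F n z) \<le> exp (C * Q (1 + \<bar>b\<bar>))" if "z \<in> K" for n z
      proof -
        have "Q (tau z) \<le> Q (1 + \<bar>b\<bar>)" using b[OF that] by (intro Q_mono) (auto simp: tau_def)
        then have "exp (C * Q (tau z)) \<le> exp (C * Q (1 + \<bar>b\<bar>))" using C(1) by simp
        then show ?thesis using F(3)[of n z] by linarith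
      qed
      then show ?thesis by blast
    qed
  qed (use F(1) in auto)
  show ?thesis
  proof (rule that[OF g(1) C(1)])
    show "cmod (g z) \<le> exp (C * Q (tau z))" for z
      using g(3)[of z] F(3) by (intro tendsto_upperbound[OF tendsto_norm]) auto
    show "(deriv ^^ l) g (\<zeta> j) / fact l = w j l" if l: "l < m j" for j l
    proof -
      have "uniform_limit (ball (\<zeta> j) 1) (F \<circ> r) g sequentially"
        using g(4)[of "cball (\<zeta> j) 1"] by (rule uniform_limit_on_subset) auto
      then have "(\<lambda>n. (deriv ^^ l) ((F \<circ> r) n) (\<zeta> j)) \<longlonglongrightarrow> (deriv ^^ l) g (\<zeta> j)"
      proof (rule higher_deriv_complex_uniform_limit)
        show "\<forall>\<^sub>F n in sequentially. (F \<circ> r) n holomorphic_on ball (\<zeta> j) 1"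
          by (intro always_eventually allI) (auto simp: o_def intro: holomorphic_on_subset[OF F(1)])
      qed auto
      then have "(\<lambda>n. (deriv ^^ l) (F (r n)) (\<zeta> j) / fact l) \<longlonglongrightarrow> (deriv ^^ l) g (\<zeta> j) / fact l"
        by (intro tendsto_divide) auto
      moreover have "eventually (\<lambda>n. (deriv ^^ l) (F (r n)) (\<zeta> j) / fact l = w j l) sequentially"
        using eventually_gt_at_top[of j]
      proof eventually_elim
        case (elim n)
        then have "j < r n" using seq_suble[OF g(2), of n] by linarith
        then show ?case using F(2) l by blast
      qed
      then have "(\<lambda>n. (deriv ^^ l) (F (r n)) (\<zeta> j) / fact l) \<longlonglongrightarrow> w j l"
        by (rule tendsto_eventually)
      ultimately show ?thesis by (rule LIMSEQ_unique)
    qed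
  qed
qed

end

section \<open>The weight as a growth function\<close>

lemma second_derivative_test:
  fixes f :: "real \<Rightarrow> real"
  assumes e: "0 < e" and max: "\<And>t. \<bar>t\<bar> < e \<Longrightarrow> f t \<le> f 0"
    and f': "\<And>t. \<bar>t\<bar> < e \<Longrightarrow> (f has_real_derivative f' t) (at t)"
    and f'': "(f' has_real_derivative c) (at 0)"
  shows "c \<le> 0"
proof (rule ccontr)
  assume "\<not> c \<le> 0"
  then have "0 < c" by simp
  have 0: "f' 0 = 0"
    using DERIV_local_max[of f "f' 0" 0 e] f'[of 0] e max by simp
  obtain d where d: "0 < d" "\<And>h. 0 < h \<Longrightarrow> h < d \<Longrightarrow> f' 0 < f' (0 + h)"
    using DERIV_pos_inc_right[OF f'' \<open>0 < c\<close>] by auto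
  define h where "h = min d e / 2"
  have h: "0 < h" "h < d" "h < e" using d(1) e by (auto simp: h_def min_def)
  have "\<exists>z. 0 < z \<and> z < h \<and> f h - f 0 = (h - 0) * f' z"
    using h by (intro MVT2) (auto intro: f')
  then obtain z where z: "0 < z" "z < h" "f h - f 0 = h * f' z" by auto
  have "0 < f' z" using d(2)[of z] z h 0 by simp
  then have "f 0 < f h" using z h by (metis diff_gt_0_iff_gt mult_pos_pos)
  then show False using max[of h] h by simp
qed

lemma dir_deriv_along_line:
  assumes "C1_on S f" "v \<in> {1, \<i>}" "z + of_real t * v \<in> S"
  shows "((\<lambda>s. f (z + of_real s * v)) has_real_derivative dir_deriv v f (z + of_real t * v)) (at t)"
proof -
  have "(\<lambda>s::real. f ((z + of_real t * v) + of_real s * v)) differentiable at 0"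
    using assms unfolding C1_on_def by blast
  then have "((\<lambda>s::real. f ((z + of_real t * v) + of_real s * v)) has_real_derivative
      dir_deriv v f (z + of_real t * v)) (at 0)"
    unfolding dir_deriv_def by (simp add: DERIV_deriv_iff_real_differentiable)
  moreover have "(\<lambda>s::real. f ((z + of_real t * v) + of_real s * v)) = (\<lambda>s. f (z + of_real (s + t) * v))"
    by (simp add: algebra_simps)
  ultimately show ?thesis
    using DERIV_shift[of "\<lambda>s. f (z + of_real s * v)" "dir_deriv v f (z + of_real t * v)" 0 t] by simp
qed

text \<open>The Laplacian of \<open>\<psi> (ln \<bar>z\<bar>\<^sup>2)\<close> is \<open>4 \<psi>'' (ln \<bar>z\<bar>\<^sup>2) / \<bar>z\<bar>\<^sup>2\<close>. At a maximum the second derivatives in both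
  coordinate directions are nonpositive, and so is their sum.\<close>

lemma laplacian_maximum_principle:
  fixes p :: "complex \<Rightarrow> real" and \<psi> :: "real \<Rightarrow> real"
  assumes C2: "C2_on U p" and U: "open U" "z0 \<in> U" and z0: "z0 \<noteq> 0"
    and \<psi>: "\<And>x. (\<psi> has_real_derivative \<psi>' x) (at x)" "\<And>x. (\<psi>' has_real_derivative \<psi>'' x) (at x)"
    and max: "\<And>z. z \<in> U \<Longrightarrow> a * p z + \<psi> (ln ((cmod z)\<^sup>2)) \<le> a * p z0 + \<psi> (ln ((cmod z0)\<^sup>2))"
  shows "a * laplacian p z0 + 4 * \<psi>'' (ln ((cmod z0)\<^sup>2)) / (cmod z0)\<^sup>2 \<le> 0"
proof -
  obtain e1 where e1: "0 < e1" "ball z0 e1 \<subseteq> U" using U open_contains_ball by blast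
  define e where "e = min e1 (cmod z0)"
  have e: "0 < e" "e \<le> e1" "e \<le> cmod z0" using e1 z0 by (auto simp: e_def)
  define A where "A = (cmod z0)\<^sup>2"
  have A: "0 < A" using z0 by (simp add: A_def)
  define s where "s = ln A"
  have main: "a * dir_deriv v (dir_deriv v p) z0 +
      (\<psi>'' s * (2 * b)\<^sup>2 / A\<^sup>2 + \<psi>' s * (2 / A - (2 * b)\<^sup>2 / A\<^sup>2)) \<le> 0"
    if v: "v \<in> {1, \<i>}" and b: "b = Re (z0 * cnj v)" for v b
  proof -
    have nv: "cmod v = 1" using v by auto
    define q where "q t = A + 2 * b * t + t\<^sup>2" for t
    have inU: "z0 + of_real t * v \<in> U" and nz: "z0 + of_real t * v \<noteq> 0" if "\<bar>t\<bar> < e" for t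
    proof -
      have n: "cmod (of_real t * v) < e" using that nv by (simp add: norm_mult)
      then have "z0 + of_real t * v \<in> ball z0 e1" using e by (simp add: dist_norm)
      then show "z0 + of_real t * v \<in> U" using e1 by blast
      show "z0 + of_real t * v \<noteq> 0"
      proof
        assume "z0 + of_real t * v = 0"
        then have "z0 = - (of_real t * v)" by (simp add: eq_neg_iff_add_eq_0)
        then have "cmod z0 = cmod (of_real t * v)" by simp
        then show False using n e by simp
      qed
    qed
    have q: "(cmod (z0 + of_real t * v))\<^sup>2 = q t" for t
      using v unfolding q_def A_def b cmod_power2 by (auto simp: power2_eq_square algebra_simps)
    have qpos: "0 < q t" if "\<bar>t\<bar> < e" for t
      using nz[OF that] by (simp flip: q)
    define f where "f t = a * p (z0 + of_real t * v) + \<psi> (ln (q t))" for t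
    define f' where "f' t = a * dir_deriv v p (z0 + of_real t * v) + \<psi>' (ln (q t)) * ((2 * b + 2 * t) / q t)" for t
    have C1: "C1_on U p" "C1_on U (dir_deriv v p)" using C2 v by (auto simp: C2_on_def)
    have q': "(q has_real_derivative (2 * b + 2 * t)) (at t)" for t
      unfolding q_def by (auto intro!: derivative_eq_intros)
    have lnq: "((\<lambda>t. ln (q t)) has_real_derivative ((2 * b + 2 * t) / q t)) (at t)" if "\<bar>t\<bar> < e" for t
      using DERIV_chain2[OF DERIV_ln_divide[OF qpos[OF that]] q'] by simp
    show ?thesis
    proof (rule second_derivative_test[OF e(1), of f f'])
      show "f t \<le> f 0" if "\<bar>t\<bar> < e" for t
        using max[OF inU[OF that]] by (simp add: f_def q[symmetric])
      show "(f has_real_derivative f' t) (at t)" if "\<bar>t\<bar> < e" for t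
        unfolding f_def f'_def
        by (intro DERIV_add DERIV_cmult dir_deriv_along_line[OF C1(1) v inU[OF that]]
            DERIV_chain2[OF \<psi>(1) lnq[OF that]])
      have e0: "\<bar>0::real\<bar> < e" using e by simp
      have "((\<lambda>t. (2 * b + 2 * t) / q t) has_real_derivative
          (2 * q 0 - (2 * b + 2 * 0) * (2 * b + 2 * 0)) / (q 0 * q 0)) (at 0)"
        using qpos[OF e0] by (intro DERIV_divide q') (auto intro!: derivative_eq_intros)
      also have "(2 * q 0 - (2 * b + 2 * 0) * (2 * b + 2 * 0)) / (q 0 * q 0) = 2 / A - (2 * b)\<^sup>2 / A\<^sup>2"
        using A by (simp add: q_def power2_eq_square field_simps)
      finally have r: "((\<lambda>t. (2 * b + 2 * t) / q t) has_real_derivative (2 / A - (2 * b)\<^sup>2 / A\<^sup>2)) (at 0)" .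
      have "((\<lambda>t. \<psi>' (ln (q t)) * ((2 * b + 2 * t) / q t)) has_real_derivative
          \<psi>'' (ln (q 0)) * ((2 * b + 2 * 0) / q 0) * ((2 * b + 2 * 0) / q 0) +
          (2 / A - (2 * b)\<^sup>2 / A\<^sup>2) * \<psi>' (ln (q 0))) (at 0)"
        by (intro DERIV_mult r DERIV_chain2[OF \<psi>(2) lnq[OF e0]])
      moreover have "((\<lambda>t. a * dir_deriv v p (z0 + of_real t * v)) has_real_derivative
          a * dir_deriv v (dir_deriv v p) (z0 + of_real 0 * v)) (at 0)"
        by (intro DERIV_cmult dir_deriv_along_line[OF C1(2) v inU[OF e0]])
      ultimately have "(f' has_real_derivative
          (a * dir_deriv v (dir_deriv v p) (z0 + of_real 0 * v) +
          (\<psi>'' (ln (q 0)) * ((2 * b + 2 * 0) / q 0) * ((2 * b + 2 * 0) / q 0) +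
          (2 / A - (2 * b)\<^sup>2 / A\<^sup>2) * \<psi>' (ln (q 0))))) (at 0)"
        unfolding f'_def by (intro DERIV_add)
      then show "(f' has_real_derivative a * dir_deriv v (dir_deriv v p) z0 +
          (\<psi>'' s * (2 * b)\<^sup>2 / A\<^sup>2 + \<psi>' s * (2 / A - (2 * b)\<^sup>2 / A\<^sup>2))) (at 0)"
        by (simp add: q_def s_def power2_eq_square mult_ac)
    qed
  qed
  define b1 where "b1 = Re (z0 * cnj 1)"
  define b2 where "b2 = Re (z0 * cnj \<i>)"
  have bb: "(2 * b1)\<^sup>2 + (2 * b2)\<^sup>2 = 4 * A"
    by (simp add: b1_def b2_def A_def cmod_power2)
  have "a * laplacian p z0 + (\<psi>'' s * ((2 * b1)\<^sup>2 + (2 * b2)\<^sup>2) / A\<^sup>2 +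
      \<psi>' s * (2 / A + 2 / A - ((2 * b1)\<^sup>2 + (2 * b2)\<^sup>2) / A\<^sup>2)) \<le> 0"
    using add_mono[OF main[of 1 b1] main[of \<i> b2]] unfolding laplacian_def
    by (simp add: b1_def b2_def algebra_simps add_divide_distrib)
  also have "\<psi>'' s * ((2 * b1)\<^sup>2 + (2 * b2)\<^sup>2) / A\<^sup>2 +
      \<psi>' s * (2 / A + 2 / A - ((2 * b1)\<^sup>2 + (2 * b2)\<^sup>2) / A\<^sup>2) = 4 * \<psi>'' s / A"
    unfolding bb using A by (simp add: power2_eq_square)
  finally show ?thesis by (simp add: s_def A_def)
qed

text \<open>The Laplacian has no zeros, so it has constant sign on the connected set \<open>R0 < \<bar>z\<bar>\<close>. A negative sign is
  excluded as in Sturm's comparison theorem: a positive \<open>p\<close> with \<open>\<Delta>p \<le> - p / (M \<bar>z\<bar>\<^sup>2)\<close> cannot exist on an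
  annulus that contains a full positive arch of a slower oscillation \<open>h z = sin (\<omega> (ln \<bar>z\<bar>\<^sup>2 - s1))\<close>. The
  comparison takes place at a maximum of \<open>h / p\<close>.\<close>

lemma laplacian_pos_of_growth:
  fixes p :: "complex \<Rightarrow> real"
  assumes C2: "C2_on {z. R0 < cmod z} p" and R0: "0 \<le> R0" and M: "0 < M"
    and pos: "\<And>z. R0 < cmod z \<Longrightarrow> 0 < p z"
    and le: "\<And>z. R0 < cmod z \<Longrightarrow> p z \<le> M * \<bar>(cmod z)\<^sup>2 * laplacian p z\<bar>"
    and z: "R0 < cmod z"
  shows "0 < laplacian p z"
proof -
  define S where "S = {z::complex. R0 < cmod z}"
  have S_eq: "S = - cball 0 R0" by (auto simp: S_def)
  have S: "open S" "connected S"
    unfolding S_eq by (auto intro!: connected_complement_bounded_convex)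
  have contL: "continuous_on S (laplacian p)"
    using C2 unfolding laplacian_def[abs_def] S_def C2_on_def C1_on_def by (intro continuous_on_add) auto
  have contp: "continuous_on S p" using C2 by (auto simp: S_def C2_on_def C1_on_def)
  have nz: "laplacian p z \<noteq> 0" if "z \<in> S" for z
    using le[of z] pos[of z] that by (auto simp: S_def)
  \<comment> \<open>Any \<open>\<omega>\<close> with \<open>4 * \<omega>\<^sup>2 * M < 1\<close> oscillates slowly enough.\<close>
  define \<omega> where "\<omega> = 1 / (2 * sqrt (2 * M))"
  have \<omega>: "0 < \<omega>" "4 * \<omega>\<^sup>2 * M < 1"
    using M by (simp_all add: \<omega>_def power_divide power_mult_distrib)
  define r1 where "r1 = R0 + 1"
  define r2 where "r2 = r1 * exp (pi / (2 * \<omega>))"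
  have r1: "0 < r1" "R0 < r1" "r1 < r2" using R0 \<omega> by (auto simp: r1_def r2_def)
  define s1 where "s1 = ln (r1\<^sup>2)"
  have s2: "ln (r2\<^sup>2) = s1 + pi / \<omega>"
    using r1 by (simp add: r2_def s1_def ln_mult_pos ln_realpow power_mult_distrib)
  define \<psi> where "\<psi> s = sin (\<omega> * (s - s1))" for s
  define h where "h z = \<psi> (ln ((cmod z)\<^sup>2))" for z
  define K where "K = {z::complex. r1 \<le> cmod z \<and> cmod z \<le> r2}"
  have K: "compact K"
  proof -
    have "K = cball 0 r2 - ball 0 r1" by (auto simp: K_def)
    then show ?thesis by (simp add: compact_diff)
  qed
  have KS: "K \<subseteq> S" using r1 by (auto simp: K_def S_def)
  \<comment> \<open>The crest of the arch, which shows that the maximum is positive.\<close>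
  define z1 :: complex where "z1 = of_real (r1 * exp (pi / (4 * \<omega>)))"
  have "pi / (4 * \<omega>) \<le> pi / (2 * \<omega>)" using \<omega>(1) by (intro divide_left_mono) auto
  then have z1: "z1 \<in> K"
    using r1 \<omega> by (auto simp: K_def z1_def r2_def norm_mult mult_le_cancel_left1 divide_le_cancel)
  have "ln ((cmod z1)\<^sup>2) = s1 + pi / (2 * \<omega>)"
    using r1 by (simp add: z1_def s1_def ln_mult_pos ln_realpow norm_mult power_mult_distrib)
  then have hz1: "h z1 = 1" using \<omega> by (simp add: h_def \<psi>_def)
  have "continuous_on K (\<lambda>z. h z / p z)"
    unfolding h_def \<psi>_def using r1 pos KS
    by (intro continuous_intros continuous_on_subset[OF contp]) (force simp: K_def S_def)+
  then obtain z0 where z0: "z0 \<in> K" "\<And>z. z \<in> K \<Longrightarrow> h z / p z \<le> h z0 / p z0"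
    using continuous_attains_sup[OF K] z1 by blast
  define c where "c = h z0 / p z0"
  have p0: "0 < p z0" using z0(1) KS pos by (auto simp: S_def)
  have "0 < p z1" using z1 KS pos by (auto simp: S_def)
  then have c: "0 < c" using z0(2)[OF z1] hz1 unfolding c_def by (metis divide_pos_pos less_le_trans zero_less_one)
  then have h0: "0 < h z0" using p0 by (simp add: c_def zero_less_divide_iff)
  have "cmod z0 \<noteq> r1" using h0 by (auto simp: h_def \<psi>_def s1_def)
  moreover have "cmod z0 \<noteq> r2"
  proof
    assume "cmod z0 = r2"
    then have "h z0 = sin (\<omega> * (pi / \<omega>))" unfolding h_def \<psi>_def by (simp only: s2) simp
    then show False using h0 \<omega> by simp
  qed
  ultimately have z0_int: "r1 < cmod z0" "cmod z0 < r2" using z0(1) by (auto simp: K_def)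
  define U where "U = {z::complex. r1 < cmod z \<and> cmod z < r2}"
  have U: "open U" "z0 \<in> U"
    unfolding U_def using z0_int by (auto intro!: open_Collect_conj open_Collect_less continuous_intros)
  have US: "U \<subseteq> S" "U \<subseteq> K" using r1 by (auto simp: U_def S_def K_def)
  have C2U: "C2_on U p"
    using C2 US unfolding S_def C2_on_def C1_on_def by (auto intro: continuous_on_subset)
  have "- c * laplacian p z0 + 4 * (- (\<omega>\<^sup>2 * \<psi> (ln ((cmod z0)\<^sup>2)))) / (cmod z0)\<^sup>2 \<le> 0"
  proof (rule laplacian_maximum_principle[OF C2U U, of \<psi> "\<lambda>s. \<omega> * cos (\<omega> * (s - s1))" "\<lambda>s. - (\<omega>\<^sup>2 * \<psi> s)"])
    show "z0 \<noteq> 0" using z0_int r1 by auto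
    show "(\<psi> has_real_derivative \<omega> * cos (\<omega> * (x - s1))) (at x)" for x
      unfolding \<psi>_def by (auto intro!: derivative_eq_intros)
    show "((\<lambda>s. \<omega> * cos (\<omega> * (s - s1))) has_real_derivative - (\<omega>\<^sup>2 * \<psi> x)) (at x)" for x
      unfolding \<psi>_def by (auto intro!: derivative_eq_intros simp: power2_eq_square)
    show "- c * p z + \<psi> (ln ((cmod z)\<^sup>2)) \<le> - c * p z0 + \<psi> (ln ((cmod z0)\<^sup>2))" if "z \<in> U" for z
    proof -
      have "0 < p z" using that US pos by (auto simp: S_def)
      then have "h z \<le> c * p z" using z0(2)[of z] that US by (auto simp: c_def divide_le_eq)
      moreover have "h z0 = c * p z0" using p0 by (simp add: c_def)
      ultimately show ?thesis by (simp add: h_def)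
    qed
  qed
  then have "- c * laplacian p z0 \<le> 4 * \<omega>\<^sup>2 * (c * p z0) / (cmod z0)\<^sup>2"
    using p0 by (simp add: h_def[symmetric] c_def)
  also have "\<dots> = c * (4 * \<omega>\<^sup>2 * p z0 / (cmod z0)\<^sup>2)" by simp
  finally have "c * (- laplacian p z0) \<le> c * (4 * \<omega>\<^sup>2 * p z0 / (cmod z0)\<^sup>2)" by simp
  then have L0: "- laplacian p z0 \<le> 4 * \<omega>\<^sup>2 * p z0 / (cmod z0)\<^sup>2" using c by (simp only: mult_le_cancel_left_pos)
  have cz0: "0 < (cmod z0)\<^sup>2" using z0_int r1 by auto
  have L0_pos: "0 < laplacian p z0"
  proof (rule ccontr)
    assume "\<not> 0 < laplacian p z0"
    then have neg: "laplacian p z0 < 0" using nz[of z0] z0(1) KS by force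
    have "p z0 \<le> M * ((cmod z0)\<^sup>2 * - laplacian p z0)"
      using le[of z0] z0(1) KS neg by (auto simp: S_def abs_mult)
    also have "\<dots> \<le> M * ((cmod z0)\<^sup>2 * (4 * \<omega>\<^sup>2 * p z0 / (cmod z0)\<^sup>2))"
      using L0 M by (intro mult_left_mono) auto
    also have "\<dots> = (4 * \<omega>\<^sup>2 * M) * p z0" using cz0 by simp
    also have "\<dots> < 1 * p z0" using \<omega> p0 by (intro mult_strict_right_mono) auto
    finally show False by simp
  qed
  show ?thesis
  proof (rule ccontr)
    assume "\<not> 0 < laplacian p z"
    moreover have zS: "z \<in> S" using z by (simp add: S_def)
    ultimately have "{laplacian p z..laplacian p z0} \<subseteq> laplacian p ` S"
      using L0_pos z0(1) KS connected_continuous_image[OF contL S(2)]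
      by (intro connected_contains_Icc) auto
    moreover have "0 \<in> {laplacian p z..laplacian p z0}" using \<open>\<not> 0 < laplacian p z\<close> L0_pos by simp
    ultimately show False using nz by force
  qed
qed

text \<open>Comparison on an annulus with the solution \<open>h\<close> of \<open>\<bar>z\<bar>\<^sup>2 \<Delta>h = \<delta>\<^sup>2 h\<close> on the right-hand side, which dominates
  \<open>p\<close> on both boundary circles. At an interior maximum of \<open>p - h\<close> with positive value, the Laplacian of
  \<open>p - h\<close> would have to be positive.\<close>

lemma subsolution_le_powers:
  fixes p :: "complex \<Rightarrow> real"
  assumes C2: "C2_on {z. R0 < cmod z} p" and R0: "0 \<le> R0"
    and pos: "\<And>z. R0 < cmod z \<Longrightarrow> 0 < p z"
    and lap: "\<And>z. R0 < cmod z \<Longrightarrow> \<delta>\<^sup>2 * p z \<le> (cmod z)\<^sup>2 * laplacian p z"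
    and \<delta>: "0 < \<delta>"
    and r: "R0 < r" "r \<le> cmod z" "cmod z \<le> R"
    and A1: "\<And>z. cmod z = r \<Longrightarrow> p z \<le> A1" and A2: "\<And>z. cmod z = R \<Longrightarrow> p z \<le> A2"
  shows "p z \<le> A2 * (cmod z / R) powr \<delta> + A1 * (r / cmod z) powr \<delta>"
proof (rule ccontr)
  assume gt: "\<not> p z \<le> A2 * (cmod z / R) powr \<delta> + A1 * (r / cmod z) powr \<delta>"
  have r0: "0 < r" "0 < R" using r R0 by auto
  have A: "0 \<le> A1" "0 \<le> A2"
    using A1[of "of_real r"] A2[of "of_real R"] pos[of "of_real r"] pos[of "of_real R"] r r0 by auto
  define a where "a = A2 * R powr - \<delta>"
  define b where "b = A1 * r powr \<delta>"
  define \<psi> where "\<psi> s = a * exp (\<delta> / 2 * s) + b * exp (- \<delta> / 2 * s)" for s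
  define h where "h z = \<psi> (ln ((cmod z)\<^sup>2))" for z
  have h_eq: "h z = A2 * (cmod z / R) powr \<delta> + A1 * (r / cmod z) powr \<delta>" if "0 < cmod z" for z
    using that r0 by (simp add: h_def \<psi>_def a_def b_def powr_def ln_realpow ln_div exp_add[symmetric]
        algebra_simps exp_minus exp_diff divide_simps)
  define K where "K = {z::complex. r \<le> cmod z \<and> cmod z \<le> R}"
  have K: "compact K"
  proof -
    have "K = cball 0 R - ball 0 r" by (auto simp: K_def)
    then show ?thesis by (simp add: compact_diff)
  qed
  have contp: "continuous_on {z. R0 < cmod z} p" using C2 by (auto simp: C2_on_def C1_on_def)
  have "continuous_on K (\<lambda>z. p z - h z)"
    unfolding h_def \<psi>_def using r0 r
    by (intro continuous_intros continuous_on_subset[OF contp]) (force simp: K_def)+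
  moreover have zK: "z \<in> K" using r by (simp add: K_def)
  ultimately obtain z0 where z0: "z0 \<in> K" "\<And>z. z \<in> K \<Longrightarrow> p z - h z \<le> p z0 - h z0"
    using continuous_attains_sup[OF K] by blast
  have z0_pos: "0 < cmod z0" using z0(1) r0(1) unfolding K_def mem_Collect_eq by linarith
  have "0 < cmod z" using r r0 by linarith
  then have "0 < p z - h z" using gt h_eq[of z] by linarith
  then have gt0: "h z0 < p z0" using z0(2)[OF zK] by simp
  have "cmod z0 \<noteq> r"
  proof
    assume z0r: "cmod z0 = r"
    then have "p z0 \<le> A1" by (rule A1)
    also have "A1 \<le> h z0" using h_eq[OF z0_pos] A z0r r0 by simp
    finally show False using gt0 by simp
  qed
  moreover have "cmod z0 \<noteq> R"
  proof
    assume z0r: "cmod z0 = R"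
    then have "p z0 \<le> A2" by (rule A2)
    also have "A2 \<le> h z0" using h_eq[OF z0_pos] A z0r r0 by simp
    finally show False using gt0 by simp
  qed
  ultimately have z0_int: "r < cmod z0" "cmod z0 < R" using z0(1) by (auto simp: K_def)
  define U where "U = {z::complex. r < cmod z \<and> cmod z < R}"
  have U: "open U" "z0 \<in> U"
    unfolding U_def using z0_int by (auto intro!: open_Collect_conj open_Collect_less continuous_intros)
  have C2U: "C2_on U p"
    using C2 r unfolding U_def C2_on_def C1_on_def by (auto intro: continuous_on_subset)
  have "1 * laplacian p z0 + 4 * (- ((\<delta> / 2)\<^sup>2 * \<psi> (ln ((cmod z0)\<^sup>2)))) / (cmod z0)\<^sup>2 \<le> 0"
  proof (rule laplacian_maximum_principle[OF C2U U, of "\<lambda>s. - \<psi> s"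
        "\<lambda>s. - (a * (\<delta> / 2) * exp (\<delta> / 2 * s) - b * (\<delta> / 2) * exp (- \<delta> / 2 * s))" "\<lambda>s. - ((\<delta> / 2)\<^sup>2 * \<psi> s)"])
    show "z0 \<noteq> 0" using z0_pos by auto
    show "((\<lambda>s. - \<psi> s) has_real_derivative
        - (a * (\<delta> / 2) * exp (\<delta> / 2 * x) - b * (\<delta> / 2) * exp (- \<delta> / 2 * x))) (at x)" for x
      unfolding \<psi>_def by (auto intro!: derivative_eq_intros simp: mult_ac)
    show "((\<lambda>s. - (a * (\<delta> / 2) * exp (\<delta> / 2 * s) - b * (\<delta> / 2) * exp (- \<delta> / 2 * s)))
        has_real_derivative - ((\<delta> / 2)\<^sup>2 * \<psi> x)) (at x)" for x
      unfolding \<psi>_def by (auto intro!: derivative_eq_intros simp: power2_eq_square algebra_simps)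
    show "1 * p z + - \<psi> (ln ((cmod z)\<^sup>2)) \<le> 1 * p z0 + - \<psi> (ln ((cmod z0)\<^sup>2))" if "z \<in> U" for z
      using z0(2)[of z] that by (simp add: U_def K_def h_def)
  qed
  then have "laplacian p z0 \<le> \<delta>\<^sup>2 * h z0 / (cmod z0)\<^sup>2" by (simp add: h_def power_divide)
  then have "(cmod z0)\<^sup>2 * laplacian p z0 \<le> \<delta>\<^sup>2 * h z0" using z0_pos by (simp add: field_simps)
  moreover have "\<delta>\<^sup>2 * h z0 < \<delta>\<^sup>2 * p z0" using gt0 \<delta> by simp
  moreover have "\<delta>\<^sup>2 * p z0 \<le> (cmod z0)\<^sup>2 * laplacian p z0" using lap[of z0] z0_int r by simp
  ultimately show False by simp
qed

text \<open>Three rotations by at most \<open>\<pi> / 3\<close>, each of which moves \<open>z\<close> by at most \<open>\<bar>z\<bar>\<close>, reach the direction of \<open>w\<close>; one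
  radial step then reaches \<open>w\<close>.\<close>

lemma essentially_radial:
  fixes p :: "complex \<Rightarrow> real"
  assumes p: "\<And>z. 0 \<le> p z" and C: "0 < C1" "0 < C2"
    and doubling: "\<And>z w. cmod (z - w) \<le> cmod z \<Longrightarrow> p w \<le> C1 * p z + C2"
  obtains K where "1 \<le> K" "\<And>z w. cmod w \<le> 2 * cmod z \<Longrightarrow> p w + 1 \<le> K * (p z + 1)"
proof -
  define c where "c = C1 + C2 + 1"
  have c: "1 \<le> c" using C by (simp add: c_def)
  have step: "p w + 1 \<le> c * (p z + 1)" if "cmod (z - w) \<le> cmod z" for z w
  proof -
    have "0 \<le> C2 * p z + p z + C1" using C p[of z] by simp
    then show ?thesis using doubling[OF that] by (simp add: c_def algebra_simps)
  qed
  have rot: "p (z * cis t) + 1 \<le> c * (p z + 1)" if "\<bar>t\<bar> \<le> pi / 3" for z t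
  proof (rule step)
    have "cos (pi / 3) \<le> cos \<bar>t\<bar>" using that by (intro cos_monotone_0_pi_le) auto
    then have ct: "1 / 2 \<le> cos t" by (simp add: cos_60)
    have "(cmod (1 - cis t))\<^sup>2 = (1 - cos t)\<^sup>2 + (sin t)\<^sup>2" by (simp add: cmod_power2)
    also have "\<dots> = 2 - 2 * cos t"
      using sin_cos_squared_add[of t] by (simp add: power2_eq_square algebra_simps)
    also have "\<dots> \<le> 1\<^sup>2" using ct by simp
    finally have "cmod (1 - cis t) \<le> 1" by (rule power2_le_imp_le) simp
    then have "cmod z * cmod (1 - cis t) \<le> cmod z * 1" by (intro mult_left_mono) auto
    then show "cmod (z - z * cis t) \<le> cmod z" by (simp add: norm_mult[symmetric] right_diff_distrib)
  qed
  have rot3: "p (z * cis t) + 1 \<le> c ^ 3 * (p z + 1)" if "\<bar>t\<bar> \<le> pi" for z t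
  proof -
    have t: "\<bar>t / 3\<bar> \<le> pi / 3" using that by simp
    have "z * cis t = z * cis (t / 3) * cis (t / 3) * cis (t / 3)"
      by (simp add: mult.assoc cis_mult)
    then have "p (z * cis t) + 1 \<le> c * (p (z * cis (t / 3) * cis (t / 3)) + 1)"
      using rot[OF t, of "z * cis (t / 3) * cis (t / 3)"] by (simp only:)
    also have "\<dots> \<le> c * (c * (p (z * cis (t / 3)) + 1))"
      using rot[OF t] c by (intro mult_left_mono) auto
    also have "\<dots> \<le> c * (c * (c * (p z + 1)))"
      using rot[OF t] c by (intro mult_left_mono) auto
    finally show ?thesis by (simp add: power3_eq_cube mult_ac)
  qed
  show ?thesis
  proof (rule that[of "c ^ 4"])
    show "1 \<le> c ^ 4" using c by simp
    fix z w assume wz: "cmod w \<le> 2 * cmod z"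
    have mono: "c * (p z + 1) \<le> c ^ 4 * (p z + 1)" 
      using c p[of z] power_increasing[of 1 4 c] by (intro mult_right_mono) auto
    show "p w + 1 \<le> c ^ 4 * (p z + 1)"
    proof (cases "w = 0 \<or> z = 0")
      case True
      then have "cmod (z - w) \<le> cmod z" using wz by auto
      then show ?thesis using step mono by (meson order_trans)
    next
      case False
      define z' where "z' = z * cis (Arg (w / z))"
      have "w / z = of_real (cmod (w / z)) * cis (Arg (w / z))"
        by (metis rcis_cmod_Arg rcis_def)
      then have w: "w = of_real (cmod w / cmod z) * z'"
        using False by (simp add: z'_def norm_divide field_simps)
      have "z' - w = of_real (1 - cmod w / cmod z) * z'" by (subst w) (simp add: algebra_simps)
      then have "cmod (z' - w) = \<bar>1 - cmod w / cmod z\<bar> * cmod z'" by (simp only: norm_mult norm_of_real)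
      also have "\<dots> \<le> 1 * cmod z'" 
        using wz False by (intro mult_right_mono) (auto simp: abs_le_iff divide_simps)
      finally have "p w + 1 \<le> c * (p z' + 1)" by (intro step) simp
      also have "\<dots> \<le> c * (c ^ 3 * (p z + 1))"
        unfolding z'_def using c Arg_bounded[of "w / z"] by (intro mult_left_mono rot3) auto
      also have "\<dots> = c ^ 4 * (p z + 1)" by (simp add: power_numeral_reduce mult_ac)
      finally show ?thesis .
    qed
  qed
qed

text \<open>The function \<open>Q\<close> is the smallest majorant of \<open>u\<close> for which \<open>Q r / r powr \<delta>\<close> is nondecreasing. The
  constant \<open>K\<close>, which would accumulate in dyadic iterations, is thereby removed from the growth condition.\<close>

lemma regular_growth_regularization:
  fixes u :: "real \<Rightarrow> real"
  assumes \<delta>: "0 < \<delta>" and u1: "\<And>r. 1 \<le> r \<Longrightarrow> 1 \<le> u r"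
    and grow: "\<And>s R. 1 \<le> s \<Longrightarrow> s \<le> R \<Longrightarrow> u s \<le> K * (s / R) powr \<delta> * u R"
    and dbl: "\<And>r. 1 \<le> r \<Longrightarrow> u (2 * r) \<le> A * u r" and A: "0 \<le> A" and K: "0 \<le> K"
  obtains Q where "regular_growth Q \<delta> (K * A)" "\<And>r. 1 \<le> r \<Longrightarrow> u r \<le> Q r" "\<And>r. 1 \<le> r \<Longrightarrow> Q r \<le> K * u r"
proof -
  define Q where "Q r = (SUP s\<in>{1..r}. (r / s) powr \<delta> * u s)" for r
  have bd: "(r / s) powr \<delta> * u s \<le> K * u r" if "1 \<le> s" "s \<le> r" for r s
  proof -
    have "(r / s) powr \<delta> * u s \<le> (r / s) powr \<delta> * (K * (s / r) powr \<delta> * u r)"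
      using grow[OF that] by (intro mult_left_mono) auto
    also have "\<dots> = ((r / s) * (s / r)) powr \<delta> * (K * u r)"
      using that by (subst powr_mult) auto
    finally show ?thesis using that by simp
  qed
  have bdd: "bdd_above ((\<lambda>s. (r / s) powr \<delta> * u s) ` {1..r})" for r
    using bd by (intro bdd_aboveI2) auto
  have uQ: "u r \<le> Q r" if "1 \<le> r" for r
    unfolding Q_def using cSUP_upper[OF _ bdd, of r r] that by simp
  have Qu: "Q r \<le> K * u r" if "1 \<le> r" for r
    unfolding Q_def using that by (intro cSUP_least bd) auto
  have "regular_growth Q \<delta> (K * A)"
  proof
    show "0 < \<delta>" by (rule \<delta>)
    show "1 \<le> Q r" if "1 \<le> r" for r using u1[OF that] uQ[OF that] by linarith
    show "Q r \<le> (r / R) powr \<delta> * Q R" if r: "1 \<le> r" "r \<le> R" for r R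
      unfolding Q_def[of r]
    proof (rule cSUP_least)
      fix s assume s: "s \<in> {1..r}"
      have "(r / s) powr \<delta> = ((r / R) * (R / s)) powr \<delta>" using s r by simp
      also have "\<dots> = (r / R) powr \<delta> * (R / s) powr \<delta>" using s r by (subst powr_mult) auto
      finally have "(r / s) powr \<delta> * u s = (r / R) powr \<delta> * ((R / s) powr \<delta> * u s)" by simp
      also have "(R / s) powr \<delta> * u s \<le> Q R"
        unfolding Q_def using s r by (intro cSUP_upper bdd) auto
      finally show "(r / s) powr \<delta> * u s \<le> (r / R) powr \<delta> * Q R" by (simp add: mult_left_mono)
    qed (use r in auto)
    show "Q (2 * r) \<le> K * A * Q r" if r: "1 \<le> r" for r
    proof -
      have "Q (2 * r) \<le> K * u (2 * r)" using r by (intro Qu) auto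
      also have "\<dots> \<le> K * (A * u r)" using dbl[OF r] K by (intro mult_left_mono) auto
      also have "\<dots> \<le> K * (A * Q r)" using uQ[OF r] K A by (intro mult_left_mono) auto
      finally show ?thesis by (simp add: mult.assoc)
    qed
  qed
  then show ?thesis using that uQ Qu by blast
qed

lemma C2_on_subset: "C2_on S f \<Longrightarrow> T \<subseteq> S \<Longrightarrow> C2_on T f"
  unfolding C2_on_def C1_on_def by (blast intro: continuous_on_subset)

text \<open>Along the positive axis put \<open>u s = p s + 1\<close>. Comparison on the annulus between a fixed circle and the
  circle of radius \<open>R\<close> gives \<open>u s \<le> Ka * ((s / R) powr \<delta> * u R + 1)\<close>. Since \<open>p\<close> tends to infinity, the inequality
  at one large \<open>s0\<close> forces \<open>u R\<close> to grow at least like \<open>R powr \<delta>\<close>, and the additive constant is absorbed.\<close>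

lemma weight_regular_growth:
  fixes p :: "complex \<Rightarrow> real"
  assumes w: "weight p"
    and C2: "\<exists>R0\<ge>0. C2_on {z. cmod z > R0} p"
    and O: "p \<in> O[at_infinity](\<lambda>z. (cmod z)\<^sup>2 * laplacian p z)"
    and dbl: "\<exists>C1>0. \<exists>C2>0. \<forall>z w. cmod (z - w) \<le> cmod z \<longrightarrow> p w \<le> C1 * p z + C2"
  obtains Q \<delta> D K where "regular_growth Q \<delta> D" "1 \<le> K"
    "\<And>z. Q (tau z) \<le> K * (p z + 1)" "\<And>z. p z + 1 \<le> K * Q (tau z)"
proof -
  have p0: "0 \<le> p z" for z using w by (auto simp: weight_def)
  obtain K0 where K0: "1 \<le> K0" "\<And>z w. cmod w \<le> 2 * cmod z \<Longrightarrow> p w + 1 \<le> K0 * (p z + 1)"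
    using dbl essentially_radial[of p] p0 by metis
  obtain R0 where R0: "0 \<le> R0" "C2_on {z. cmod z > R0} p" using C2 by blast
  have "(\<lambda>z. ln (1 + (cmod z)\<^sup>2)) \<in> O[at_infinity](p)" using w by (simp add: weight_def)
  then obtain c where c: "0 < c" "eventually (\<lambda>z. norm (ln (1 + (cmod z)\<^sup>2)) \<le> c * norm (p z)) at_infinity"
    by (elim landau_o.bigE)
  obtain b1 where b1: "\<And>z. b1 \<le> cmod z \<Longrightarrow> \<bar>ln (1 + (cmod z)\<^sup>2)\<bar> \<le> c * p z"
    using c(2) p0 by (auto simp: eventually_at_infinity)
  obtain M where M: "0 < M" "eventually (\<lambda>z. norm (p z) \<le> M * norm ((cmod z)\<^sup>2 * laplacian p z)) at_infinity"
    using O by (elim landau_o.bigE)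
  obtain b2 where b2: "\<And>z. b2 \<le> cmod z \<Longrightarrow> p z \<le> M * \<bar>(cmod z)\<^sup>2 * laplacian p z\<bar>"
    using M(2) p0 by (auto simp: eventually_at_infinity)
  define R1 where "R1 = max R0 (max 1 (max b1 b2))"
  have R1: "R0 \<le> R1" "1 \<le> R1" "b1 \<le> R1" "b2 \<le> R1" by (auto simp: R1_def)
  have C2': "C2_on {z. R1 < cmod z} p"
    using R0(2) by (rule C2_on_subset) (use R1 in auto)
  have pos: "0 < p z" if "R1 < cmod z" for z
  proof -
    have "0 < (cmod z)\<^sup>2" using that R1 by (intro zero_less_power) linarith
    then have "0 < ln (1 + (cmod z)\<^sup>2)" by (intro ln_gt_zero) linarith
    also have "\<dots> \<le> c * p z" using b1[of z] that R1 by linarith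
    finally show ?thesis using c(1) by (simp add: zero_less_mult_iff)
  qed
  have lap: "0 < laplacian p z" if "R1 < cmod z" for z
    using C2' _ M(1) pos _ that
  proof (rule laplacian_pos_of_growth)
    show "p z \<le> M * \<bar>(cmod z)\<^sup>2 * laplacian p z\<bar>" if "R1 < cmod z" for z
      using b2[of z] that R1 by linarith
  qed (use R1 in auto)
  define \<delta> where "\<delta> = 1 / sqrt M"
  have \<delta>: "0 < \<delta>" "\<delta>\<^sup>2 * M = 1" using M(1) by (auto simp: \<delta>_def power_divide)
  have lap_ge: "\<delta>\<^sup>2 * p z \<le> (cmod z)\<^sup>2 * laplacian p z" if "R1 < cmod z" for z
  proof -
    have "p z \<le> M * ((cmod z)\<^sup>2 * laplacian p z)"
      using b2[of z] lap[OF that] that R1 by (simp add: abs_mult)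
    then have "\<delta>\<^sup>2 * p z \<le> \<delta>\<^sup>2 * (M * ((cmod z)\<^sup>2 * laplacian p z))" by (intro mult_left_mono) auto
    also have "\<dots> = (\<delta>\<^sup>2 * M) * ((cmod z)\<^sup>2 * laplacian p z)" by simp
    finally show ?thesis using \<delta>(2) by simp
  qed
  define u where "u s = p (of_real s) + 1" for s :: real
  have u1: "1 \<le> u s" for s using p0 by (simp add: u_def)
  define r where "r = R1 + 1"
  have r: "R1 < r" "1 \<le> r" using R1 by (auto simp: r_def)
  have circle: "p z \<le> K0 * u s" if "cmod z = s" for z s
    using K0(2)[of z "of_real s"] that by (auto simp: u_def)
  define Ka where "Ka = K0 * u r + K0 + 1"
  have Ka: "1 \<le> Ka" "K0 \<le> Ka" "K0 * u r + 1 \<le> Ka" using K0(1) u1[of r] by (auto simp: Ka_def)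
  have weak: "u s \<le> Ka * ((s / R) powr \<delta> * u R + 1)" if s: "1 \<le> s" "s \<le> R" for s R
  proof -
    have nn: "0 \<le> (s / R) powr \<delta> * u R" using u1[of R] by simp
    show ?thesis
    proof (cases "s < r")
      case True
      then have "u s \<le> K0 * u r" using K0(2)[of "of_real s" "of_real r"] s by (simp add: u_def)
      also have "\<dots> \<le> Ka * 1" using Ka by simp
      also have "\<dots> \<le> Ka * ((s / R) powr \<delta> * u R + 1)" using Ka(1) nn by (intro mult_left_mono) auto
      finally show ?thesis .
    next
      case False
      have "p (of_real s) \<le> (K0 * u R) * (cmod (of_real s) / R) powr \<delta> + (K0 * u r) * (r / cmod (of_real s)) powr \<delta>"
        using C2' _ pos lap_ge \<delta>(1) r(1) _ _ circle circle
        by (rule subsolution_le_powers) (use R1 s False in auto)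
      also have "\<dots> = K0 * ((s / R) powr \<delta> * u R) + (K0 * u r) * (r / s) powr \<delta>" using s by simp
      also have "\<dots> \<le> Ka * ((s / R) powr \<delta> * u R) + (K0 * u r) * 1"
        using Ka(2) nn K0(1) u1[of r] False r \<delta>(1) by (intro add_mono mult_right_mono mult_left_mono powr_le1) auto
      finally show ?thesis using Ka(3) by (simp add: u_def distrib_left)
    qed
  qed
  obtain s0 where s0: "1 \<le> s0" "2 * Ka \<le> u s0"
  proof -
    \<comment> \<open>The bound \<open>ln (1 + \<bar>z\<bar>\<^sup>2) \<le> c * p z\<close> yields a radius at which \<open>p\<close> exceeds the given constant.\<close>
    define s0 where "s0 = max R1 (exp (2 * Ka * c))"
    have s0: "1 \<le> s0" "b1 \<le> s0" "exp (2 * Ka * c) \<le> s0" using R1 by (auto simp: s0_def)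
    have "s0 \<le> s0\<^sup>2" using s0(1) by (simp add: power2_eq_square)
    have "2 * Ka * c = ln (exp (2 * Ka * c))" by simp
    also have "\<dots> \<le> ln (1 + s0\<^sup>2)" using s0 \<open>s0 \<le> s0\<^sup>2\<close> by (subst ln_le_cancel_iff) (auto simp: add_pos_nonneg)
    also have "\<dots> \<le> c * p (of_real s0)" using b1[of "of_real s0"] s0 by auto
    finally have "c * (2 * Ka) \<le> c * p (of_real s0)" by (simp add: mult_ac)
    then have "2 * Ka \<le> u s0" using c(1) by (simp add: u_def)
    then show thesis using that s0(1) by blast
  qed
  have low: "1 \<le> (s0 / R) powr \<delta> * u R" if R: "1 \<le> R" for R
  proof (cases "s0 \<le> R")
    case True
    have "Ka * 2 \<le> Ka * ((s0 / R) powr \<delta> * u R + 1)" using weak[OF s0(1) True] s0(2) by simp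
    then show ?thesis using Ka(1) by simp
  next
    case False
    then have "1 \<le> (s0 / R) powr \<delta>" using R \<delta>(1) by (intro ge_one_powr_ge_zero) auto
    then show ?thesis using u1[of R] mult_mono[of 1 "(s0 / R) powr \<delta>" 1 "u R"] by simp
  qed
  define K1 where "K1 = Ka * (1 + s0 powr \<delta>)"
  have K1: "0 \<le> K1" using Ka by (simp add: K1_def)
  have strong: "u s \<le> K1 * (s / R) powr \<delta> * u R" if s: "1 \<le> s" "s \<le> R" for s R
  proof -
    have "1 \<le> (s0 / R) powr \<delta> * u R" using low[of R] s by simp
    also have "(s0 / R) powr \<delta> \<le> (s0 * (s / R)) powr \<delta>"
      using s s0 \<delta>(1) by (intro powr_mono2) (auto simp: divide_right_mono)
    also have "(s0 * (s / R)) powr \<delta> = s0 powr \<delta> * (s / R) powr \<delta>" by (rule powr_mult)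
    finally have "1 \<le> s0 powr \<delta> * (s / R) powr \<delta> * u R" using u1[of R] by (simp add: mult_right_mono)
    then have "Ka * ((s / R) powr \<delta> * u R + 1) \<le> Ka * ((s / R) powr \<delta> * u R + s0 powr \<delta> * (s / R) powr \<delta> * u R)"
      using Ka by (intro mult_left_mono) auto
    also have "\<dots> = K1 * (s / R) powr \<delta> * u R" by (simp add: K1_def algebra_simps)
    finally show ?thesis using weak[OF s] by linarith
  qed
  obtain Q where Q: "regular_growth Q \<delta> (K1 * K0)" "\<And>r. 1 \<le> r \<Longrightarrow> u r \<le> Q r" "\<And>r. 1 \<le> r \<Longrightarrow> Q r \<le> K1 * u r"
  proof (rule regular_growth_regularization[of \<delta> u K1 K0])
    show "u (2 * r) \<le> K0 * u r" if "1 \<le> r" for r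
      using K0(2)[of "of_real (2 * r)" "of_real r"] that by (simp add: u_def norm_mult)
  qed (use \<delta> u1 strong K0 K1 in auto)
  define P1 where "P1 = p 1 + 1"
  have P1: "1 \<le> P1" using p0 by (simp add: P1_def)
  have up: "u (tau z) \<le> (K0 * P1) * (p z + 1)" for z
  proof (cases "1 \<le> cmod z")
    case True
    then have "tau z \<le> 2 * cmod z" by (simp add: tau_def)
    then have "u (tau z) \<le> K0 * (p z + 1)"
      using K0(2)[of "of_real (tau z)" z] by (simp add: u_def)
    also have "K0 * (p z + 1) \<le> (K0 * P1) * (p z + 1)"
      using K0(1) P1 p0[of z] by (intro mult_right_mono) auto
    finally show ?thesis .
  next
    case False
    then have "tau z \<le> 2" by (simp add: tau_def)
    then have "u (tau z) \<le> K0 * P1"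
      using K0(2)[of "of_real (tau z)" 1] by (simp add: u_def P1_def)
    also have "K0 * P1 * 1 \<le> (K0 * P1) * (p z + 1)"
      using K0(1) P1 p0[of z] by (intro mult_left_mono) auto
    finally show ?thesis by simp
  qed
  show thesis
  proof (rule that[OF Q(1), of "K1 * (K0 * P1) + K0"])
    have nn: "0 \<le> K1 * (K0 * P1)" using K1 K0(1) P1 by simp
    then show "1 \<le> K1 * (K0 * P1) + K0" using K0(1) by linarith
    show "Q (tau z) \<le> (K1 * (K0 * P1) + K0) * (p z + 1)" for z
    proof -
      have "Q (tau z) \<le> K1 * u (tau z)" by (intro Q(3)) simp
      also have "\<dots> \<le> K1 * ((K0 * P1) * (p z + 1))" using up K1 by (intro mult_left_mono) auto
      also have "\<dots> \<le> (K1 * (K0 * P1) + K0) * (p z + 1)"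
        using K0(1) p0[of z] by (simp add: algebra_simps)
      finally show ?thesis .
    qed
    show "p z + 1 \<le> (K1 * (K0 * P1) + K0) * Q (tau z)" for z
    proof -
      have "cmod z \<le> 2 * tau z" by (simp add: tau_def)
      then have "p z + 1 \<le> K0 * u (tau z)"
        using K0(2)[of z "of_real (tau z)"] by (simp add: u_def)
      also have "\<dots> \<le> K0 * Q (tau z)" using Q(2)[of "tau z"] K0(1) by (intro mult_left_mono) auto
      also have "\<dots> \<le> (K1 * (K0 * P1) + K0) * Q (tau z)"
        using nn Q(2)[of "tau z"] u1[of "tau z"] tau_ge_1[of z] by (intro mult_right_mono) linarith+
      finally show ?thesis .
    qed
  qed
qed

section \<open>Counting functions and interpolating varieties\<close>

lemma counting_N_self:
  assumes V: "multiplicity_variety \<zeta> m" and "\<zeta> j \<noteq> 0"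
  shows "counting_N \<zeta> m (\<zeta> j) (cmod (\<zeta> j)) =
    (\<Sum>k | 0 < cmod (\<zeta> j - \<zeta> k) \<and> cmod (\<zeta> j - \<zeta> k) \<le> cmod (\<zeta> j).
      real (m k) * ln (cmod (\<zeta> j) / cmod (\<zeta> j - \<zeta> k))) + real (m j) * ln (cmod (\<zeta> j))"
  using assms counting_N_eq_sum[OF V, of "cmod (\<zeta> j)" "\<zeta> j"] counting_n_0(1)[OF V, of j] by simp

lemma sum_le_sum_cover:
  fixes f :: "'k \<Rightarrow> real"
  assumes "finite X" "finite A" "\<And>k. k \<in> A \<Longrightarrow> 0 \<le> f k" "\<And>k. k \<in> A \<Longrightarrow> \<exists>x\<in>X. k \<in> S x"
  shows "(\<Sum>k\<in>A. f k) \<le> (\<Sum>x\<in>X. \<Sum>k\<in>A \<inter> S x. f k)"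
proof -
  have "(\<Sum>k\<in>A. f k) \<le> (\<Sum>k\<in>A. \<Sum>x\<in>X. if k \<in> S x then f k else 0)"
  proof (rule sum_mono)
    fix k assume k: "k \<in> A"
    then obtain x where x: "x \<in> X" "k \<in> S x" using assms(4) by blast
    have "(\<Sum>y\<in>{x}. if k \<in> S y then f k else 0) \<le> (\<Sum>x\<in>X. if k \<in> S x then f k else 0)"
      using x assms k by (intro sum_mono2) auto
    then show "f k \<le> (\<Sum>x\<in>X. if k \<in> S x then f k else 0)" using x by simp
  qed
  also have "\<dots> = (\<Sum>x\<in>X. \<Sum>k\<in>A. if k \<in> S x then f k else 0)" by (rule sum.swap)
  also have "\<dots> = (\<Sum>x\<in>X. \<Sum>k\<in>A \<inter> S x. f k)"
    using assms by (simp add: sum.inter_restrict)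
  finally show ?thesis .
qed

text \<open>The terms of \<open>N (\<zeta> j, \<bar>\<zeta> j\<bar>)\<close> that come from the disc of radius \<open>\<bar>\<zeta> j\<bar> / 2\<close> around \<open>\<zeta> j\<close> are at least
  \<open>m k * ln 2\<close>, so this disc has multiplicity \<open>O(Q)\<close>. An annulus \<open>R / 2 < tau \<le> R\<close> is covered by a number of
  small discs that does not depend on \<open>R\<close>, and the points of the annulus that share a small disc with
  \<open>\<zeta> j\<close> are within \<open>\<bar>\<zeta> j\<bar> / 2\<close> of it.
  The bound for discs around the origin follows by \<open>halving_recursion\<close>. The finitely many points
  with \<open>\<bar>\<zeta> j\<bar> \<le> 2\<close> are absorbed into the constant.\<close>

lemma (in regular_growth) spread_points_of_counting_N:
  assumes V: "multiplicity_variety \<zeta> m" and A: "0 \<le> A"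
    and N: "\<And>j. \<zeta> j \<noteq> 0 \<Longrightarrow> counting_N \<zeta> m (\<zeta> j) (cmod (\<zeta> j)) \<le> A * Q (tau (\<zeta> j))"
  shows "\<exists>C0. spread_points Q \<delta> D \<zeta> m C0"
proof -
  have inj: "inj \<zeta>" and m_pos: "\<And>j. 0 < m j" using V by (auto simp: multiplicity_variety_def)
  have fin: "finite {k. cmod (z - \<zeta> k) \<le> r}" for z r by (rule multiplicity_variety_finite[OF V])
  have fin_tau: "finite {k. tau (\<zeta> k) \<le> R}" for R
    by (rule finite_subset[OF _ fin[of 0 R]]) (auto simp: tau_def)
  have Q1: "1 \<le> Q (tau z)" for z by (rule Q_ge_1) simp
  have main: "(\<Sum>k\<in>J. real (m k) * ln (cmod (\<zeta> j) / cmod (\<zeta> j - \<zeta> k))) + real (m j) * ln (cmod (\<zeta> j))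
      \<le> A * Q (tau (\<zeta> j))"
    if big: "2 \<le> cmod (\<zeta> j)" and J: "j \<notin> J" "\<And>k. k \<in> J \<Longrightarrow> cmod (\<zeta> j - \<zeta> k) \<le> cmod (\<zeta> j)" for j J
  proof -
    have "\<zeta> j \<noteq> 0" using big by auto
    have "(\<Sum>k\<in>J. real (m k) * ln (cmod (\<zeta> j) / cmod (\<zeta> j - \<zeta> k))) \<le>
        (\<Sum>k | 0 < cmod (\<zeta> j - \<zeta> k) \<and> cmod (\<zeta> j - \<zeta> k) \<le> cmod (\<zeta> j).
          real (m k) * ln (cmod (\<zeta> j) / cmod (\<zeta> j - \<zeta> k)))"
    proof (rule sum_mono2)
      show "finite {k. 0 < cmod (\<zeta> j - \<zeta> k) \<and> cmod (\<zeta> j - \<zeta> k) \<le> cmod (\<zeta> j)}"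
        by (rule finite_subset[OF _ fin[of "\<zeta> j" "cmod (\<zeta> j)"]]) auto
      show "J \<subseteq> {k. 0 < cmod (\<zeta> j - \<zeta> k) \<and> cmod (\<zeta> j - \<zeta> k) \<le> cmod (\<zeta> j)}"
        using J inj by (auto simp: inj_eq)
      show "0 \<le> real (m k) * ln (cmod (\<zeta> j) / cmod (\<zeta> j - \<zeta> k))"
        if "k \<in> {k. 0 < cmod (\<zeta> j - \<zeta> k) \<and> cmod (\<zeta> j - \<zeta> k) \<le> cmod (\<zeta> j)} - J" for k
        using that by (intro mult_nonneg_nonneg ln_ge_zero) auto
    qed
    then show ?thesis using N[OF \<open>\<zeta> j \<noteq> 0\<close>] unfolding counting_N_self[OF V \<open>\<zeta> j \<noteq> 0\<close>] by linarith
  qed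
  have ln2: "1 / 2 \<le> ln (2::real)" using ln_le_minus_one[of "1 / 2 :: real"] by (simp add: ln_div)
  have half_disc: "(\<Sum>k\<in>J. real (m k)) \<le> 2 * A * Q (tau (\<zeta> j))"
    if big: "2 \<le> cmod (\<zeta> j)" and J: "finite J" "\<And>k. k \<in> J \<Longrightarrow> cmod (\<zeta> j - \<zeta> k) \<le> cmod (\<zeta> j) / 2" for j J
  proof -
    have "(\<Sum>k\<in>J. real (m k)) \<le> (\<Sum>k\<in>insert j (J - {j}). real (m k))"
      using J by (intro sum_mono2) auto
    also have "\<dots> = (\<Sum>k\<in>J - {j}. real (m k)) + real (m j)"
      using sum.insert[of "J - {j}" j "\<lambda>k. real (m k)"] J(1) by simp
    finally have 1: "(\<Sum>k\<in>J. real (m k)) * (1 / 2) \<le> (\<Sum>k\<in>J - {j}. real (m k) * (1 / 2)) + real (m j) * (1 / 2)"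
      unfolding sum_distrib_right[symmetric] by linarith
    have "(\<Sum>k\<in>J - {j}. real (m k) * (1 / 2)) \<le>
        (\<Sum>k\<in>J - {j}. real (m k) * ln (cmod (\<zeta> j) / cmod (\<zeta> j - \<zeta> k)))"
    proof (intro sum_mono mult_left_mono)
      fix k assume k: "k \<in> J - {j}"
      then have d: "0 < cmod (\<zeta> j - \<zeta> k)" using inj by (auto simp: inj_eq)
      then have "2 \<le> cmod (\<zeta> j) / cmod (\<zeta> j - \<zeta> k)" using J(2)[of k] k by (simp add: pos_le_divide_eq)
      then have "ln 2 \<le> ln (cmod (\<zeta> j) / cmod (\<zeta> j - \<zeta> k))" by (subst ln_le_cancel_iff) auto
      then show "1 / 2 \<le> ln (cmod (\<zeta> j) / cmod (\<zeta> j - \<zeta> k))" using ln2 by linarith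
    qed auto
    moreover have "real (m j) * (1 / 2) \<le> real (m j) * ln (cmod (\<zeta> j))"
    proof (intro mult_left_mono)
      have "ln 2 \<le> ln (cmod (\<zeta> j))" using big by (subst ln_le_cancel_iff) auto
      then show "1 / 2 \<le> ln (cmod (\<zeta> j))" using ln2 by linarith
    qed auto
    moreover have "(\<Sum>k\<in>J - {j}. real (m k) * ln (cmod (\<zeta> j) / cmod (\<zeta> j - \<zeta> k))) + real (m j) * ln (cmod (\<zeta> j))
        \<le> A * Q (tau (\<zeta> j))"
    proof (rule main[OF big])
      show "cmod (\<zeta> j - \<zeta> k) \<le> cmod (\<zeta> j)" if "k \<in> J - {j}" for k
      proof -
        have "cmod (\<zeta> j - \<zeta> k) \<le> cmod (\<zeta> j) / 2" using J(2) that by blast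
        then show ?thesis using big by linarith
      qed
    qed simp
    ultimately show ?thesis using 1 by linarith
  qed
  define nn where "nn R = (\<Sum>k | tau (\<zeta> k) \<le> R. real (m k))" for R
  have nn0: "0 \<le> nn R" for R by (simp add: nn_def sum_nonneg)
  have nn_mono: "nn R \<le> nn R'" if "R \<le> R'" for R R'
    unfolding nn_def using that fin_tau by (intro sum_mono2) auto
  obtain X where X: "finite X" "cball 0 1 \<subseteq> (\<Union>x\<in>X. ball (x::complex) (1 / 16))"
    using compact_eq_totally_bounded[THEN iffD1, OF compact_cball, THEN conjunct2, rule_format, of "1 / 16" "0 :: complex" 1]
    by auto
  define Ca where "Ca = real (card X) * (2 * A) + nn 8"
  have Ca: "0 \<le> Ca" using A nn0 by (simp add: Ca_def)
  \<comment> \<open>For \<open>R > 8\<close>, points with \<open>tau > R / 2\<close> have modulus at least \<open>2\<close> and at least \<open>R / 4\<close>, so that two of them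
     in a disc of radius \<open>R / 16\<close> are closer to each other than half their moduli.\<close>
  have rec: "nn R \<le> 1 * nn (R / 2) + Ca * Q R" if R: "1 \<le> R" for R
  proof (cases "R \<le> 8")
    case True
    have "nn R \<le> nn 8 * 1" using nn_mono[OF True] by simp
    also have "\<dots> \<le> nn 8 * Q R" using Q_ge_1[OF R] nn0 by (intro mult_left_mono) auto
    also have "\<dots> \<le> Ca * Q R" using A Q_ge_1[OF R] by (intro mult_right_mono) (auto simp: Ca_def)
    finally show ?thesis using nn0[of "R / 2"] by linarith
  next
    case False
    define B where "B = {k. R / 2 < tau (\<zeta> k) \<and> tau (\<zeta> k) \<le> R}"
    have finB: "finite B" by (rule finite_subset[OF _ fin_tau[of R]]) (auto simp: B_def)
    define S where "S x = {k. \<zeta> k \<in> ball (of_real R * x) (R / 16)}" for x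
    have "{k. tau (\<zeta> k) \<le> R} = {k. tau (\<zeta> k) \<le> R / 2} \<union> B" using R by (auto simp: B_def)
    then have "nn R = nn (R / 2) + (\<Sum>k\<in>B. real (m k))"
      unfolding nn_def using finB fin_tau[of "R / 2"]
      by (simp only:) (subst sum.union_disjoint, auto simp: B_def)
    also have "(\<Sum>k\<in>B. real (m k)) \<le> (\<Sum>x\<in>X. \<Sum>k\<in>B \<inter> S x. real (m k))"
    proof (rule sum_le_sum_cover[OF X(1) finB])
      fix k assume k: "k \<in> B"
      then have "\<zeta> k / of_real R \<in> cball 0 1" using R by (auto simp: B_def tau_def norm_divide divide_le_eq)
      then obtain x where x: "x \<in> X" "cmod (x - \<zeta> k / of_real R) < 1 / 16" using X(2) by (force simp: dist_norm)
      have "of_real R * x - \<zeta> k = of_real R * (x - \<zeta> k / of_real R)" using R by (simp add: field_simps)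
      then have "cmod (of_real R * x - \<zeta> k) = R * cmod (x - \<zeta> k / of_real R)"
        using R by (simp only: norm_mult norm_of_real abs_of_nonneg)
      also have "\<dots> < R * (1 / 16)" using x(2) R by (intro mult_strict_left_mono) auto
      finally have "k \<in> S x" by (simp add: S_def dist_norm)
      then show "\<exists>x\<in>X. k \<in> S x" using x(1) by blast
    qed auto
    also have "\<dots> \<le> (\<Sum>x\<in>X. 2 * A * Q R)"
    proof (rule sum_mono)
      fix x assume "x \<in> X"
      show "(\<Sum>k\<in>B \<inter> S x. real (m k)) \<le> 2 * A * Q R"
      proof (cases "B \<inter> S x = {}")
        case True
        then show ?thesis using A Q_ge_1[OF R] by (simp only: sum.empty) simp
      next
        case False': False
        then obtain j where j: "j \<in> B" "j \<in> S x" by blast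
        have tj: "R / 2 < 1 + cmod (\<zeta> j)" "tau (\<zeta> j) \<le> R" using j(1) by (auto simp: B_def tau_def)
        have "(\<Sum>k\<in>B \<inter> S x. real (m k)) \<le> 2 * A * Q (tau (\<zeta> j))"
        proof (rule half_disc)
          show "2 \<le> cmod (\<zeta> j)" using tj False by linarith
          show "cmod (\<zeta> j - \<zeta> k) \<le> cmod (\<zeta> j) / 2" if k: "k \<in> B \<inter> S x" for k
          proof -
            have "dist (\<zeta> j) (\<zeta> k) < R / 8"
              using dist_triangle_less_add[of "\<zeta> j" "of_real R * x" "R / 16" "\<zeta> k" "R / 16"] j(2) k
              by (auto simp: S_def dist_commute)
            then show ?thesis using tj False by (simp add: dist_norm)
          qed
        qed (use finB in auto)
        also have "\<dots> \<le> 2 * A * Q R" using A tj(2) by (intro mult_left_mono Q_mono) auto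
        finally show ?thesis .
      qed
    qed
    also have "\<dots> = real (card X) * (2 * A) * Q R" by simp
    also have "\<dots> \<le> Ca * Q R" using Q_ge_1[OF R] nn0[of 8] by (intro mult_right_mono) (auto simp: Ca_def)
    finally show ?thesis by simp
  qed
  have p1: "1 < 2 powr \<delta>" using \<delta>_pos by simp
  define Cb where "Cb = Ca / (1 - 1 / 2 powr \<delta>)"
  have Cb: "0 \<le> Cb" using Ca p1 by (simp add: Cb_def)
  have nn_le: "nn R \<le> Cb * Q R" if "1 \<le> R" for R
    unfolding Cb_def
  proof (rule halving_recursion[where c = 1 and g = nn])
    show "nn r \<le> 0" if "r < 1" for r
    proof -
      have "{k. tau (\<zeta> k) \<le> r} = {}"
      proof -
        have "\<not> tau (\<zeta> k) \<le> r" for k using tau_ge_1[of "\<zeta> k"] that by linarith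
        then show ?thesis by blast
      qed
      then show ?thesis by (simp add: nn_def)
    qed
  qed (use rec p1 Ca that in auto)
  have count: "(\<Sum>k | k \<in> J \<and> tau (\<zeta> k) \<le> R. real (m k)) \<le> Cb * Q R" if "1 \<le> R" for J R
  proof -
    have "(\<Sum>k | k \<in> J \<and> tau (\<zeta> k) \<le> R. real (m k)) \<le> nn R"
      unfolding nn_def using fin_tau by (intro sum_mono2) auto
    then show ?thesis using nn_le[OF that] by linarith
  qed
  define I where "I = {j. cmod (0 - \<zeta> j) \<le> 2}"
  have I: "finite I" unfolding I_def by (rule fin)
  define G where "G j = {k. cmod (\<zeta> j - \<zeta> k) \<le> tau (\<zeta> j)} - {j}" for j
  have G: "finite (G j)" for j unfolding G_def using fin[of "\<zeta> j" "tau (\<zeta> j)"] by simp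
  define e1 where "e1 j = (\<Sum>k\<in>G j. real (m k) * ln (tau (\<zeta> j) / cmod (\<zeta> k - \<zeta> j)))" for j
  have lnG: "0 \<le> real (m k) * ln (tau (\<zeta> j) / cmod (\<zeta> k - \<zeta> j))" if "k \<in> G j" for j k
  proof -
    have "0 < cmod (\<zeta> k - \<zeta> j)" using that inj by (auto simp: G_def inj_eq)
    then show ?thesis using that by (intro mult_nonneg_nonneg ln_ge_zero) (auto simp: G_def norm_minus_commute)
  qed
  have e1: "0 \<le> e1 j" for j unfolding e1_def by (intro sum_nonneg lnG)
  define e2 where "e2 j = real (m j) * ln (tau (\<zeta> j))" for j
  have e2: "0 \<le> e2 j" for j by (simp add: e2_def)
  define E where "E = (\<Sum>j\<in>I. e1 j) + (\<Sum>j\<in>I. e2 j)"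
  have E: "e1 j \<le> E" "e2 j \<le> E" if "j \<in> I" for j
    using member_le_sum[of j I e1] member_le_sum[of j I e2] that I e1 e2 sum_nonneg[of I e1] sum_nonneg[of I e2]
    by (auto simp: E_def intro: add_increasing add_increasing2)
  have E0: "0 \<le> E" using e1 e2 by (simp add: E_def sum_nonneg)
  define C0 where "C0 = 2 * A + Cb + Cb * D + E"
  have CD: "0 \<le> Cb * D" using Cb D_ge_1 by simp
  have C0: "0 \<le> C0" "2 * A \<le> C0" "A + Cb * D \<le> C0" "Cb \<le> C0" "E \<le> C0"
    using A Cb CD E0 by (auto simp: C0_def)
  have le_C0: "x \<le> C0 * Q (tau z)" if "x \<le> y * Q (tau z)" "y \<le> C0" for x y z
    using that mult_right_mono[of y C0 "Q (tau z)"] Q1[of z] by linarith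
  have le_E: "x \<le> C0 * Q (tau z)" if "x \<le> E" for x z
  proof (rule le_C0[OF _ C0(5)])
    have "E * 1 \<le> E * Q (tau z)" using E0 Q1 by (intro mult_left_mono) auto
    then show "x \<le> E * Q (tau z)" using that by simp
  qed
  have "spread_points Q \<delta> D \<zeta> m C0"
  proof (unfold_locales)
    show "inj \<zeta>" by (rule inj)
    show "0 < m j" for j by (rule m_pos)
    show "0 \<le> C0" by (rule C0)
    show "(\<Sum>k | k \<in> J \<and> tau (\<zeta> k) \<le> R. real (m k)) \<le> C0 * Q R" if "finite J" "1 \<le> R" for J R
    proof -
      have "Cb * Q R \<le> C0 * Q R" using C0 Q_ge_1[OF that(2)] by (intro mult_right_mono) auto
      then show ?thesis using count[OF that(2), of J] by linarith
    qed
    show "real (m j) * ln (tau (\<zeta> j)) \<le> C0 * Q (tau (\<zeta> j))" for j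
    proof (cases "j \<in> I")
      case True
      then show ?thesis using E(2)[OF True] by (intro le_E) (simp add: e2_def)
    next
      case False
      then have big: "2 \<le> cmod (\<zeta> j)" by (simp add: I_def)
      have "ln (tau (\<zeta> j)) \<le> ln ((cmod (\<zeta> j))\<^sup>2)"
      proof (subst ln_le_cancel_iff)
        have "2 * cmod (\<zeta> j) \<le> (cmod (\<zeta> j))\<^sup>2" unfolding power2_eq_square using big by (intro mult_right_mono) auto
        then show "tau (\<zeta> j) \<le> (cmod (\<zeta> j))\<^sup>2" using big by (simp add: tau_def)
      qed (use big in auto)
      also have "\<dots> = 2 * ln (cmod (\<zeta> j))" using big by (subst ln_realpow) auto
      finally have "real (m j) * ln (tau (\<zeta> j)) \<le> 2 * (real (m j) * ln (cmod (\<zeta> j)))"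
        using mult_left_mono[of "ln (tau (\<zeta> j))" "2 * ln (cmod (\<zeta> j))" "real (m j)"] by simp
      also have "\<dots> \<le> 2 * A * Q (tau (\<zeta> j))" using main[OF big, of "{}"] by simp
      finally show ?thesis using C0(2) by (rule le_C0)
    qed
    show "(\<Sum>k\<in>J. real (m k) * ln (tau (\<zeta> j) / cmod (\<zeta> k - \<zeta> j))) \<le> C0 * Q (tau (\<zeta> j))"
      if J: "finite J" "j \<notin> J" "\<And>k. k \<in> J \<Longrightarrow> cmod (\<zeta> k - \<zeta> j) \<le> tau (\<zeta> j)" for J j
    proof (cases "j \<in> I")
      case True
      have "(\<Sum>k\<in>J. real (m k) * ln (tau (\<zeta> j) / cmod (\<zeta> k - \<zeta> j))) \<le> e1 j"
        unfolding e1_def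
      proof (rule sum_mono2[OF G])
        show "J \<subseteq> G j" using J by (auto simp: G_def norm_minus_commute)
      qed (use lnG in blast)
      then show ?thesis using E(1)[OF True] by (intro le_E) linarith
    next
      case False
      then have big: "2 \<le> cmod (\<zeta> j)" by (simp add: I_def)
      define J1 where "J1 = {k \<in> J. cmod (\<zeta> j - \<zeta> k) \<le> cmod (\<zeta> j)}"
      have J1: "J1 \<subseteq> J" "finite J1" using J by (auto simp: J1_def)
      have t2: "tau (\<zeta> j) \<le> 2 * cmod (\<zeta> j)" using big by (simp add: tau_def)
      have "(\<Sum>k\<in>J. real (m k) * ln (tau (\<zeta> j) / cmod (\<zeta> k - \<zeta> j))) \<le>
          (\<Sum>k\<in>J. (if cmod (\<zeta> j - \<zeta> k) \<le> cmod (\<zeta> j) then real (m k) * ln (cmod (\<zeta> j) / cmod (\<zeta> j - \<zeta> k)) else 0)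
            + real (m k))"
      proof (rule sum_mono)
        fix k assume k: "k \<in> J"
        then have d: "0 < cmod (\<zeta> j - \<zeta> k)" using J(2) inj by (auto simp: inj_eq)
        define y where "y = (if cmod (\<zeta> j - \<zeta> k) \<le> cmod (\<zeta> j) then ln (cmod (\<zeta> j) / cmod (\<zeta> j - \<zeta> k)) else 0)"
        have "ln (tau (\<zeta> j) / cmod (\<zeta> j - \<zeta> k)) \<le> y + 1"
        proof (cases "cmod (\<zeta> j - \<zeta> k) \<le> cmod (\<zeta> j)")
          case True
          have "ln (tau (\<zeta> j) / cmod (\<zeta> j - \<zeta> k)) \<le> ln (2 * (cmod (\<zeta> j) / cmod (\<zeta> j - \<zeta> k)))"
          proof (subst ln_le_cancel_iff)
            show "0 < 2 * (cmod (\<zeta> j) / cmod (\<zeta> j - \<zeta> k))"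
              using d big by (intro mult_pos_pos divide_pos_pos) linarith+
            show "tau (\<zeta> j) / cmod (\<zeta> j - \<zeta> k) \<le> 2 * (cmod (\<zeta> j) / cmod (\<zeta> j - \<zeta> k))"
              using d t2 by (simp add: divide_right_mono)
          qed (use d in simp)
          also have "\<dots> = ln 2 + y"
          proof -
            have "0 < cmod (\<zeta> j) / cmod (\<zeta> j - \<zeta> k)" using d big by (intro divide_pos_pos) linarith+
            then show ?thesis using True by (subst ln_mult_pos) (simp_all add: y_def)
          qed
          finally show ?thesis using ln_2_less_1 by linarith
        next
          case False
          then have "ln (tau (\<zeta> j) / cmod (\<zeta> j - \<zeta> k)) \<le> ln 2"
            using d t2 by (subst ln_le_cancel_iff) (auto simp: divide_le_eq)
          then show ?thesis using ln_2_less_1 False by (simp add: y_def)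
        qed
        then have "real (m k) * ln (tau (\<zeta> j) / cmod (\<zeta> k - \<zeta> j)) \<le> real (m k) * (y + 1)"
          by (intro mult_left_mono) (auto simp: norm_minus_commute)
        then show "real (m k) * ln (tau (\<zeta> j) / cmod (\<zeta> k - \<zeta> j)) \<le>
          (if cmod (\<zeta> j - \<zeta> k) \<le> cmod (\<zeta> j) then real (m k) * ln (cmod (\<zeta> j) / cmod (\<zeta> j - \<zeta> k)) else 0) + real (m k)"
          by (simp add: y_def algebra_simps split: if_splits)
      qed
      also have "\<dots> = (\<Sum>k\<in>J1. real (m k) * ln (cmod (\<zeta> j) / cmod (\<zeta> j - \<zeta> k))) + (\<Sum>k\<in>J. real (m k))"
        unfolding sum.distrib J1_def using J(1) by (simp add: sum.inter_filter)
      also have "(\<Sum>k\<in>J1. real (m k) * ln (cmod (\<zeta> j) / cmod (\<zeta> j - \<zeta> k))) \<le> A * Q (tau (\<zeta> j))"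
      proof -
        have "0 \<le> real (m j) * ln (cmod (\<zeta> j))" using big by (intro mult_nonneg_nonneg ln_ge_zero) auto
        moreover have "(\<Sum>k\<in>J1. real (m k) * ln (cmod (\<zeta> j) / cmod (\<zeta> j - \<zeta> k))) + real (m j) * ln (cmod (\<zeta> j))
            \<le> A * Q (tau (\<zeta> j))"
          using J(2) by (intro main[OF big]) (simp_all add: J1_def)
        ultimately show ?thesis by linarith
      qed
      also have "(\<Sum>k\<in>J. real (m k)) \<le> Cb * (D * Q (tau (\<zeta> j)))"
      proof -
        have t: "1 \<le> 2 * tau (\<zeta> j)" using tau_ge_1[of "\<zeta> j"] by linarith
        have "tau (\<zeta> k) \<le> 2 * tau (\<zeta> j)" if "k \<in> J" for k
          using J(3)[OF that] norm_triangle_sub[of "\<zeta> k" "\<zeta> j"] by (simp add: tau_def)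
        then have eq: "{k. k \<in> J \<and> tau (\<zeta> k) \<le> 2 * tau (\<zeta> j)} = J" by blast
        have "(\<Sum>k\<in>J. real (m k)) \<le> Cb * Q (2 * tau (\<zeta> j))" using count[OF t, of J] unfolding eq .
        also have "\<dots> \<le> Cb * (D * Q (tau (\<zeta> j)))" using Cb doubling[of "tau (\<zeta> j)"] by (intro mult_left_mono) auto
        finally show ?thesis .
      qed
      finally have "(\<Sum>k\<in>J. real (m k) * ln (tau (\<zeta> j) / cmod (\<zeta> k - \<zeta> j))) \<le> (A + Cb * D) * Q (tau (\<zeta> j))"
        by (simp add: algebra_simps)
      then show ?thesis using C0(3) by (rule le_C0)
    qed
  qed
  then show ?thesis by blast
qed

text \<open>A gliding hump: the points at which the bound on \<open>N\<close> fails with constant \<open>n\<close> are selected recursively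
  with moduli growing by a factor of more than \<open>4\<close>, and a single interpolation problem is solved for all of them.\<close>

lemma interpolating_imp_counting_N_bounded:
  fixes p :: "complex \<Rightarrow> real"
  assumes V: "multiplicity_variety \<zeta> m" and interp: "interpolating_variety p \<zeta> m"
    and p0: "\<And>z. 0 \<le> p z" and C: "0 < C1" "0 < C2"
    and doubling: "\<And>z w. cmod (z - w) \<le> cmod z \<Longrightarrow> p w \<le> C1 * p z + C2"
    and c: "0 \<le> c" and ln_le: "\<And>z. 1 \<le> cmod z \<Longrightarrow> ln (cmod z) \<le> c * (p z + 1)"
  shows "\<exists>A>0. \<exists>B>0. \<forall>j. \<zeta> j \<noteq> 0 \<longrightarrow> counting_N \<zeta> m (\<zeta> j) (cmod (\<zeta> j)) \<le> A * p (\<zeta> j) + B"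
proof (rule ccontr)
  assume not: "\<not> ?thesis"
  have inj: "inj \<zeta>" and m_pos: "\<And>j. 0 < m j" using V by (auto simp: multiplicity_variety_def)
  define N where "N j = counting_N \<zeta> m (\<zeta> j) (cmod (\<zeta> j))" for j
  have ex: "\<exists>j. X < cmod (\<zeta> j) \<and> real n * p (\<zeta> j) + 2 * real n < N j" if "1 \<le> X" for X n
  proof (rule ccontr)
    assume "\<not> ?thesis"
    then have le: "N j \<le> real n * p (\<zeta> j) + 2 * real n" if "X < cmod (\<zeta> j)" for j using that by force
    define S where "S = {j. cmod (0 - \<zeta> j) \<le> X}"
    have S: "finite S" unfolding S_def by (rule multiplicity_variety_finite[OF V])
    define B where "B = 2 * real n + (\<Sum>j\<in>S. \<bar>N j\<bar>) + 1"
    have sn: "0 \<le> (\<Sum>j\<in>S. \<bar>N j\<bar>)" by (simp add: sum_nonneg)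
    have "N j \<le> (real n + 1) * p (\<zeta> j) + B" for j
    proof (cases "j \<in> S")
      case True
      then have "\<bar>N j\<bar> \<le> (\<Sum>j\<in>S. \<bar>N j\<bar>)" using S by (intro member_le_sum) auto
      moreover have "0 \<le> (real n + 1) * p (\<zeta> j)" using p0 by simp
      ultimately show ?thesis unfolding B_def by linarith
    next
      case False
      then have "N j \<le> real n * p (\<zeta> j) + 2 * real n" by (intro le) (simp add: S_def)
      then show ?thesis using sn p0[of "\<zeta> j"] unfolding B_def distrib_right by linarith
    qed
    moreover have "0 < B" "0 < real n + 1" using sn unfolding B_def by linarith+
    ultimately show False using not unfolding N_def by blast
  qed
  obtain g where g: "\<And>n. 1 \<le> cmod (\<zeta> (g n)) \<and> real n * p (\<zeta> (g n)) + 2 * real n < N (g n)"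
    "\<And>n. 4 * cmod (\<zeta> (g n)) < cmod (\<zeta> (g (Suc n)))"
  proof (rule exE[OF dependent_nat_choice[of "\<lambda>n j. 1 \<le> cmod (\<zeta> j) \<and> real n * p (\<zeta> j) + 2 * real n < N j"
        "\<lambda>n j j'. 4 * cmod (\<zeta> j) < cmod (\<zeta> j')"]])
    show "\<exists>x. 1 \<le> cmod (\<zeta> x) \<and> real 0 * p (\<zeta> x) + 2 * real 0 < N x"
      using ex[of 1 0] by (auto intro: less_imp_le)
    show "\<exists>y. (1 \<le> cmod (\<zeta> y) \<and> real (Suc n) * p (\<zeta> y) + 2 * real (Suc n) < N y) \<and> 4 * cmod (\<zeta> x) < cmod (\<zeta> y)"
      if "1 \<le> cmod (\<zeta> x) \<and> real n * p (\<zeta> x) + 2 * real n < N x" for x n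
    proof -
      have x: "1 \<le> 4 * cmod (\<zeta> x)" using that by linarith
      obtain y where y: "4 * cmod (\<zeta> x) < cmod (\<zeta> y)" "real (Suc n) * p (\<zeta> y) + 2 * real (Suc n) < N y"
        using ex[OF x] by blast
      then show ?thesis using x by (intro exI[of _ y]) linarith
    qed
  qed (use that in blast)
  have g_gap: "4 * cmod (\<zeta> (g i)) < cmod (\<zeta> (g i'))" if "i < i'" for i i'
    using that
  proof (induction i')
    case (Suc i')
    show ?case
    proof (cases "i = i'")
      case False
      then have "4 * cmod (\<zeta> (g i)) < cmod (\<zeta> (g i'))" using Suc by simp
      then show ?thesis using g(2)[of i'] by (smt (verit) norm_ge_zero)
    qed (use g(2) in simp)
  qed simp
  define w where "w j l = (if j \<in> range g \<and> l = m j - 1 then 1 else 0 :: complex)" for j l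
  have "(\<Sum>l<m j. cmod (w j l)) \<le> 1 * exp (1 * p (\<zeta> j))" for j
  proof -
    have "(\<Sum>l<m j. cmod (w j l)) \<le> (\<Sum>l<m j. if l = m j - 1 then 1 else 0)"
      by (intro sum_mono) (simp add: w_def)
    also have "\<dots> \<le> 1" by simp
    also have "1 \<le> 1 * exp (1 * p (\<zeta> j))" using p0 by simp
    finally show ?thesis .
  qed
  then have "\<exists>A>0. \<exists>B>0. \<forall>j. (\<Sum>l<m j. cmod (w j l)) \<le> A * exp (B * p (\<zeta> j))"
    by (intro exI[of _ "1::real"] conjI allI) simp_all
  then obtain f where fA: "f \<in> A_space p" and fw: "\<And>j l. l < m j \<Longrightarrow> (deriv ^^ l) f (\<zeta> j) / fact l = w j l"
    using interp unfolding interpolating_variety_def by blast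
  obtain Af Bf where f: "f holomorphic_on UNIV" "0 < Af" "0 < Bf" "\<And>z. cmod (f z) \<le> Af * exp (Bf * p z)"
    using fA unfolding A_space_def by blast
  \<comment> \<open>Jensen's inequality at \<open>\<zeta> (g i)\<close> is contradictory as soon as \<open>i\<close> exceeds this constant.\<close>
  define c' where "c' = \<bar>ln Af\<bar> + Bf * C1 + Bf * C2 + c"
  obtain i where i: "c' < real i" using reals_Archimedean2 by blast
  define j where "j = g i"
  define r where "r = cmod (\<zeta> j)"
  have r: "1 \<le> r" using g(1)[of i] by (simp add: r_def j_def)
  have Nj: "real i * p (\<zeta> j) + 2 * real i < N j" using g(1)[of i] by (simp add: j_def)
  define K where "K = {k. 0 < cmod (\<zeta> j - \<zeta> k) \<and> cmod (\<zeta> j - \<zeta> k) \<le> r}"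
  have K: "finite K" by (rule finite_subset[OF _ multiplicity_variety_finite[OF V, of "\<zeta> j" r]]) (auto simp: K_def)
  define \<mu> where "\<mu> k = (if k \<in> range g then m k - 1 else m k)" for k
  have van: "vanishes_to_order (\<mu> k) f (\<zeta> k)" for k
    unfolding vanishes_to_order_def
  proof (intro allI impI)
    fix l assume l: "l < \<mu> k"
    then have "l < m k" "w k l = 0" by (auto simp: \<mu>_def w_def split: if_splits)
    then show "(deriv ^^ l) f (\<zeta> k) = 0" using fw[of l k] by simp
  qed
  have \<mu>j: "\<mu> j = m j - 1" by (simp add: \<mu>_def j_def)
  have "(\<Prod>k\<in>K. (r / cmod (\<zeta> j - \<zeta> k)) ^ \<mu> k) * r ^ \<mu> j \<le> Af * exp (Bf * (C1 * p (\<zeta> j) + C2))"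
  proof (rule jensen_inequality[OF f(1) _ K])
    show "inj_on \<zeta> K" using inj by (rule inj_on_subset) simp
    show "\<zeta> k \<noteq> \<zeta> j" "cmod (\<zeta> j - \<zeta> k) \<le> r" if "k \<in> K" for k using that by (auto simp: K_def)
    show "(deriv ^^ \<mu> j) f (\<zeta> j) / fact (\<mu> j) = 1"
      using fw[of "m j - 1" j] m_pos[of j] unfolding \<mu>j by (simp add: w_def j_def)
    show "cmod (f z) \<le> Af * exp (Bf * (C1 * p (\<zeta> j) + C2))" if "cmod (\<zeta> j - z) = r" for z
    proof -
      have "p z \<le> C1 * p (\<zeta> j) + C2" using that by (intro doubling) (simp add: r_def)
      then have "Af * exp (Bf * p z) \<le> Af * exp (Bf * (C1 * p (\<zeta> j) + C2))"
        using f(2,3) by simp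
      then show ?thesis using f(4)[of z] by linarith
    qed
  qed (use r van in auto)
  moreover have prod_pos: "0 < (\<Prod>k\<in>K. (r / cmod (\<zeta> j - \<zeta> k)) ^ \<mu> k)"
    using r by (intro prod_pos) (auto simp: K_def)
  ultimately have "ln ((\<Prod>k\<in>K. (r / cmod (\<zeta> j - \<zeta> k)) ^ \<mu> k) * r ^ \<mu> j) \<le> ln (Af * exp (Bf * (C1 * p (\<zeta> j) + C2)))"
    using r f(2) by (subst ln_le_cancel_iff) auto
  also have "\<dots> = ln Af + Bf * (C1 * p (\<zeta> j) + C2)" using f(2) by (subst ln_mult_pos) auto
  also have "ln ((\<Prod>k\<in>K. (r / cmod (\<zeta> j - \<zeta> k)) ^ \<mu> k) * r ^ \<mu> j) =
      (\<Sum>k\<in>K. real (\<mu> k) * ln (r / cmod (\<zeta> j - \<zeta> k))) + real (\<mu> j) * ln r"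
  proof -
    have "ln (\<Prod>k\<in>K. (r / cmod (\<zeta> j - \<zeta> k)) ^ \<mu> k) = (\<Sum>k\<in>K. ln ((r / cmod (\<zeta> j - \<zeta> k)) ^ \<mu> k))"
      by (rule ln_prod[OF K]) (use r in \<open>auto simp: K_def\<close>)
    also have "\<dots> = (\<Sum>k\<in>K. real (\<mu> k) * ln (r / cmod (\<zeta> j - \<zeta> k)))"
      by (intro sum.cong refl ln_realpow)
    finally show ?thesis using prod_pos r by (subst ln_mult_pos) (auto simp: ln_realpow)
  qed
  finally have J: "(\<Sum>k\<in>K. real (\<mu> k) * ln (r / cmod (\<zeta> j - \<zeta> k))) + real (\<mu> j) * ln r \<le>
      ln Af + Bf * (C1 * p (\<zeta> j) + C2)" .
  \<comment> \<open>Later members of the subsequence are too far away to lie in the disc around \<open>\<zeta> j\<close>.\<close>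
  have earlier: "i' < i" if i': "g i' \<in> K" for i'
  proof (rule ccontr)
    assume "\<not> i' < i"
    have d: "0 < cmod (\<zeta> j - \<zeta> (g i'))" "cmod (\<zeta> j - \<zeta> (g i')) \<le> r" using i' by (auto simp: K_def)
    then have "i' \<noteq> i" by (auto simp: j_def)
    then have "4 * r < cmod (\<zeta> (g i'))" using \<open>\<not> i' < i\<close> g_gap[of i i'] by (simp add: j_def r_def)
    moreover have "cmod (\<zeta> (g i')) \<le> cmod (\<zeta> j - \<zeta> (g i')) + r"
      unfolding r_def using norm_triangle_sub[of "\<zeta> (g i')" "\<zeta> j"] by (simp add: norm_minus_commute)
    ultimately show False using d r by linarith
  qed
  have "\<zeta> j \<noteq> 0" using r by (auto simp: r_def)
  have "N j = (\<Sum>k\<in>K. real (m k) * ln (r / cmod (\<zeta> j - \<zeta> k))) + real (m j) * ln r"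
    unfolding N_def counting_N_self[OF V \<open>\<zeta> j \<noteq> 0\<close>] K_def r_def ..
  also have "(\<Sum>k\<in>K. real (m k) * ln (r / cmod (\<zeta> j - \<zeta> k))) =
      (\<Sum>k\<in>K. real (\<mu> k) * ln (r / cmod (\<zeta> j - \<zeta> k))) + (\<Sum>k\<in>K. if k \<in> range g then ln (r / cmod (\<zeta> j - \<zeta> k)) else 0)"
    unfolding sum.distrib[symmetric] using m_pos
    by (intro sum.cong) (auto simp: \<mu>_def of_nat_diff Suc_le_eq algebra_simps)
  also have "real (m j) * ln r = real (\<mu> j) * ln r + ln r"
    using m_pos[of j] by (simp add: \<mu>j of_nat_diff Suc_le_eq algebra_simps)
  also have "(\<Sum>k\<in>K. if k \<in> range g then ln (r / cmod (\<zeta> j - \<zeta> k)) else 0) \<le> real i"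
  proof -
    have "(\<Sum>k\<in>K. if k \<in> range g then ln (r / cmod (\<zeta> j - \<zeta> k)) else 0) =
        (\<Sum>k | k \<in> K \<and> k \<in> range g. ln (r / cmod (\<zeta> j - \<zeta> k)))"
      using K by (rule sum.inter_filter[symmetric])
    also have "\<dots> \<le> (\<Sum>k | k \<in> K \<and> k \<in> range g. 1)"
    proof (rule sum_mono)
      fix k assume "k \<in> {k. k \<in> K \<and> k \<in> range g}"
      then obtain i' where i': "k = g i'" "k \<in> K" by blast
      then have "i' < i" using earlier by blast
      have tri: "r \<le> cmod (\<zeta> j - \<zeta> k) + cmod (\<zeta> k)"
        unfolding r_def using norm_triangle_sub[of "\<zeta> j" "\<zeta> k"] by simp
      have d: "0 < cmod (\<zeta> j - \<zeta> k)" "cmod (\<zeta> j - \<zeta> k) \<le> r" using i'(2) by (auto simp: K_def)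
      have "4 * cmod (\<zeta> k) < r" using \<open>i' < i\<close> g_gap[of i' i] i'(1) by (simp add: j_def r_def)
      then have "r / cmod (\<zeta> j - \<zeta> k) \<le> 2" using tri d r by (simp add: divide_le_eq)
      then have "ln (r / cmod (\<zeta> j - \<zeta> k)) \<le> ln 2" using r d by (subst ln_le_cancel_iff) auto
      then show "ln (r / cmod (\<zeta> j - \<zeta> k)) \<le> 1" using ln_2_less_1 by linarith
    qed
    also have "\<dots> = real (card {k. k \<in> K \<and> k \<in> range g})" by simp
    also have "\<dots> \<le> real (card (g ` {..<i}))"
    proof -
      have "{k. k \<in> K \<and> k \<in> range g} \<subseteq> g ` {..<i}"
      proof clarify
        fix i' assume "g i' \<in> K"
        then have "i' < i" by (rule earlier)
        then show "g i' \<in> g ` {..<i}" by blast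
      qed
      then show ?thesis by (simp add: card_mono)
    qed
    also have "\<dots> \<le> real i" using card_image_le[of "{..<i}" g] by simp
    finally show ?thesis .
  qed
  finally have "N j \<le> ln Af + Bf * (C1 * p (\<zeta> j) + C2) + real i + ln r"
    using J by linarith
  also have "ln r \<le> c * (p (\<zeta> j) + 1)" using ln_le[of "\<zeta> j"] r by (simp add: r_def)
  also have "ln Af \<le> \<bar>ln Af\<bar>" by simp
  finally have "real i * (p (\<zeta> j) + 1) < \<bar>ln Af\<bar> + Bf * (C1 * p (\<zeta> j) + C2) + c * (p (\<zeta> j) + 1)"
    using Nj by (simp add: algebra_simps)
  also have "\<dots> \<le> c' * (p (\<zeta> j) + 1)"
    using p0[of "\<zeta> j"] f(3) C by (simp add: c'_def algebra_simps)
  also have "\<dots> \<le> real i * (p (\<zeta> j) + 1)"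
    using i p0[of "\<zeta> j"] by (intro mult_right_mono) auto
  finally show False by simp
qed

theorem theorem1p10:
  fixes p :: "complex \<Rightarrow> real" and \<zeta> :: "nat \<Rightarrow> complex" and m :: "nat \<Rightarrow> nat"
  assumes "weight p"
    and "\<exists>R0\<ge>0. C2_on {z. cmod z > R0} p"
    and "p \<in> O[at_infinity](\<lambda>z. (cmod z)\<^sup>2 * laplacian p z)"
    and "\<exists>C1>0. \<exists>C2>0. \<forall>z w. cmod (z - w) \<le> cmod z \<longrightarrow> p w \<le> C1 * p z + C2"
    and "multiplicity_variety \<zeta> m"
  shows "interpolating_variety p \<zeta> m \<longleftrightarrow>
    (\<exists>A>0. \<exists>B>0. \<forall>j. \<zeta> j \<noteq> 0 \<longrightarrow> counting_N \<zeta> m (\<zeta> j) (cmod (\<zeta> j)) \<le> A * p (\<zeta> j) + B)"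
proof -
  have p0: "0 \<le> p z" for z using assms(1) by (auto simp: weight_def)
  obtain Q \<delta> D K where Q: "regular_growth Q \<delta> D" and K: "1 \<le> K"
    "\<And>z. Q (tau z) \<le> K * (p z + 1)" "\<And>z. p z + 1 \<le> K * Q (tau z)"
    using weight_regular_growth[OF assms(1-4)] by blast
  interpret regular_growth Q \<delta> D by (rule Q)
  show ?thesis
  proof
    assume interp: "interpolating_variety p \<zeta> m"
    obtain C1 C2 where C: "0 < C1" "0 < C2" "\<And>z w. cmod (z - w) \<le> cmod z \<Longrightarrow> p w \<le> C1 * p z + C2"
      using assms(4) by blast
    \<comment> \<open>The growth condition between the radii \<open>1\<close> and \<open>tau z\<close> makes \<open>Q\<close> at least a power, which dominates \<open>ln\<close>.\<close>
    have "ln (cmod z) \<le> (K / \<delta>) * (p z + 1)" if z: "1 \<le> cmod z" for z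
    proof -
      have "1 \<le> (1 / tau z) powr \<delta> * Q (tau z)"
        using growth[of 1 "tau z"] Q_ge_1[of 1] by simp
      then have "tau z powr \<delta> \<le> Q (tau z)"
        using tau_pos[of z] by (simp add: powr_divide pos_le_divide_eq del: tau_pos)
      have "ln (cmod z) \<le> ln (tau z)" using z by (subst ln_le_cancel_iff) (auto simp: tau_def)
      also have "\<dots> \<le> tau z powr \<delta> / \<delta>" by (rule ln_powr_bound) (use \<delta>_pos in auto)
      also have "\<dots> \<le> (K * (p z + 1)) / \<delta>"
        using \<open>tau z powr \<delta> \<le> Q (tau z)\<close> K(2)[of z] \<delta>_pos by (intro divide_right_mono) auto
      finally show ?thesis by simp
    qed
    then show "\<exists>A>0. \<exists>B>0. \<forall>j. \<zeta> j \<noteq> 0 \<longrightarrow> counting_N \<zeta> m (\<zeta> j) (cmod (\<zeta> j)) \<le> A * p (\<zeta> j) + B"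
      using K(1) \<delta>_pos
      by (intro interpolating_imp_counting_N_bounded[OF assms(5) interp p0 C, of "K / \<delta>"]) auto
  next
    assume "\<exists>A>0. \<exists>B>0. \<forall>j. \<zeta> j \<noteq> 0 \<longrightarrow> counting_N \<zeta> m (\<zeta> j) (cmod (\<zeta> j)) \<le> A * p (\<zeta> j) + B"
    then obtain A B where A: "0 < A" "0 < B"
      and N: "\<And>j. \<zeta> j \<noteq> 0 \<Longrightarrow> counting_N \<zeta> m (\<zeta> j) (cmod (\<zeta> j)) \<le> A * p (\<zeta> j) + B" by blast
    have "\<exists>C0. spread_points Q \<delta> D \<zeta> m C0"
    proof (rule spread_points_of_counting_N[OF assms(5), of "(A + B) * K"])
      show "0 \<le> (A + B) * K" using A K(1) by simp
      show "counting_N \<zeta> m (\<zeta> j) (cmod (\<zeta> j)) \<le> (A + B) * K * Q (tau (\<zeta> j))" if "\<zeta> j \<noteq> 0" for j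
      proof -
        have "A * p (\<zeta> j) + B \<le> (A + B) * (p (\<zeta> j) + 1)" using A p0[of "\<zeta> j"] by (simp add: algebra_simps)
        also have "\<dots> \<le> (A + B) * (K * Q (tau (\<zeta> j)))" using A K(3)[of "\<zeta> j"] by (intro mult_left_mono) auto
        finally show ?thesis using N[OF that] by (simp add: mult.assoc)
      qed
    qed
    then obtain C0 where "spread_points Q \<delta> D \<zeta> m C0" by blast
    then interpret spread_points Q \<delta> D \<zeta> m C0 .
    show "interpolating_variety p \<zeta> m"
      unfolding interpolating_variety_def
    proof (intro allI impI)
      fix w :: "nat \<Rightarrow> nat \<Rightarrow> complex"
      assume "\<exists>A>0. \<exists>B>0. \<forall>j. (\<Sum>l<m j. cmod (w j l)) \<le> A * exp (B * p (\<zeta> j))"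
      then obtain A B where AB: "0 < A" "0 < B" and w: "\<And>j. (\<Sum>l<m j. cmod (w j l)) \<le> A * exp (B * p (\<zeta> j))"
        by blast
      define B' where "B' = (\<bar>ln A\<bar> + B) * K"
      have B': "0 \<le> B'" using AB K(1) by (simp add: B'_def)
      have w': "(\<Sum>l<m j. cmod (w j l)) \<le> exp (B' * Q (\<rho> j))" for j
      proof -
        have "A * exp (B * p (\<zeta> j)) = exp (ln A + B * p (\<zeta> j))" using AB by (simp add: exp_add)
        also have "ln A + B * p (\<zeta> j) \<le> (\<bar>ln A\<bar> + B) * (p (\<zeta> j) + 1)"
        proof -
          have "0 \<le> \<bar>ln A\<bar> * p (\<zeta> j)" using p0 by simp
          then show ?thesis using AB by (simp add: algebra_simps)
        qed
        also have "\<dots> \<le> (\<bar>ln A\<bar> + B) * (K * Q (\<rho> j))" using AB K(3)[of "\<zeta> j"] by (intro mult_left_mono) auto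
        finally have "A * exp (B * p (\<zeta> j)) \<le> exp (B' * Q (\<rho> j))" by (simp add: B'_def mult.assoc)
        then show ?thesis using w[of j] by linarith
      qed
      obtain f C where f: "f holomorphic_on UNIV" "0 < C" "\<And>z. cmod (f z) \<le> exp (C * Q (tau z))"
        "\<And>j l. l < m j \<Longrightarrow> (deriv ^^ l) f (\<zeta> j) / fact l = w j l"
        using interpolation_sequence[OF B' w'] by blast
      have "cmod (f z) \<le> exp (C * K) * exp ((C * K) * p z)" for z
      proof -
        have "C * Q (tau z) \<le> C * (K * (p z + 1))" using f(2) K(2)[of z] by (intro mult_left_mono) auto
        then have "exp (C * Q (tau z)) \<le> exp (C * (K * (p z + 1)))" by simp
        also have "\<dots> = exp (C * K) * exp ((C * K) * p z)" by (simp add: exp_add[symmetric] algebra_simps)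
        finally show ?thesis using f(3)[of z] by linarith
      qed
      moreover have "0 < C * K" using f(2) K(1) by simp
      ultimately have "\<exists>A>0. \<exists>B>0. \<forall>z. cmod (f z) \<le> A * exp (B * p z)"
        by (intro exI[of _ "exp (C * K)"] exI[of _ "C * K"] conjI allI) auto
      then have "f \<in> A_space p"
        unfolding A_space_def using f(1) by blast
      then show "\<exists>f\<in>A_space p. \<forall>j. \<forall>l<m j. (deriv ^^ l) f (\<zeta> j) / fact l = w j l"
        using f(4) by blast
    qed
  qed
qed

end
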